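(* Let $G$ be a finitely generable group. Let $E$ and $Z$ be $G$-sets such that $E$ is $G$-quasifree and, for each $e\in E$, the $G$-stabilizer of $e$ stabilizes some element of $Z$. Then each $G$-stable almost equality class in the $G$-set $\mathrm{Maps}(E,Z)$ is the vertex $G$-set of some $G$-tree.
   Context: $G$ is a discrete group; $G$-sets are left $G$-sets. For sets $E,Z$, $\mathrm{Maps}(E,Z)$ is the set of all maps $v\colon E\to Z$, $e\mapsto\langle v,e\rangle$. Two maps $v,w$ are almost equal if $\{e\in E: \langle v,e\rangle\ne\langle w,e\rangle\}$ is finite; this is an equivalence relation whose (nonempty) classes are called almost equality classes. If $E,Z$ are $G$-sets, $\mathrm{Maps}(E,Z)$ is a $G$-set via $\langle gv,e\rangle := g\langle v,g^{-1}e\rangle$. A subset $W$ of a $G$-set is $G$-stable if $GW=W$. A $G$-set is $G$-quasifree if the $G$-stabilizer of each of its elements is finite. A subgroup $H\le G$ stabilizes an element $z$ if $hz=z$ for all $h\in H$. Finitely generable means having a finite generating set. A graph consists of disjoint sets of vertices and of edges together with maps $\iota,\tau$ (initial and terminal vertex) from edges to vertices. A $G$-graph is a graph whose vertex set and edge set are $G$-sets and for which $\iota,\tau$ are $G$-maps. Paths may traverse edges in either direction; a path is reduced if it never traverses an edge and then immediately traverses the same edge backwards. A tree is a graph, with nonempty vertex set, in which any two vertices are joined by a unique reduced path. A $G$-tree is a $G$-graph that is a tree. *)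

theory Defs
  imports
    "HOL-Algebra.Group_Action"
    "HOL-Algebra.Generated_Groups"
    "HOL-Library.FuncSet"
    "Graph_Theory.Arc_Walk"
begin

definition finitely_generable :: "('g, 'm) monoid_scheme \<Rightarrow> bool" where
  "finitely_generable G \<longleftrightarrow> (\<exists>S. finite S \<and> S \<subseteq> carrier G \<and> generate G S = carrier G)"

definition quasifree ::
  "('g, 'm) monoid_scheme \<Rightarrow> 'e set \<Rightarrow> ('g \<Rightarrow> 'e \<Rightarrow> 'e) \<Rightarrow> bool" where
  "quasifree G E \<phi> \<longleftrightarrow> (\<forall>e\<in>E. finite (stabilizer G \<phi> e))"

definition stabilizes :: "'g set \<Rightarrow> ('g \<Rightarrow> 'z \<Rightarrow> 'z) \<Rightarrow> 'z \<Rightarrow> bool" where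
  "stabilizes H \<psi> z \<longleftrightarrow> (\<forall>h\<in>H. \<psi> h z = z)"

definition G_stable ::
  "('g, 'm) monoid_scheme \<Rightarrow> ('g \<Rightarrow> 'x \<Rightarrow> 'x) \<Rightarrow> 'x set \<Rightarrow> bool" where
  "G_stable G \<phi> W \<longleftrightarrow> (\<Union>g\<in>carrier G. \<phi> g ` W) = W"

text \<open>
  Maps from a set \<open>E\<close> to a set \<open>Z\<close> are the extensional functions \<open>E \<rightarrow>\<^sub>E Z\<close>, so that
  maps are equal exactly when they agree on \<open>E\<close>.
\<close>

definition almost_eq :: "'e set \<Rightarrow> 'z set \<Rightarrow> (('e \<Rightarrow> 'z) \<times> ('e \<Rightarrow> 'z)) set" where
  "almost_eq E Z =
    {(v, w). v \<in> E \<rightarrow>\<^sub>E Z \<and> w \<in> E \<rightarrow>\<^sub>E Z \<and> finite {e \<in> E. v e \<noteq> w e}}"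

lemma equiv_almost_eq: "equiv (E \<rightarrow>\<^sub>E Z) (almost_eq E Z)"
proof (rule equivI)
  show "almost_eq E Z \<subseteq> (E \<rightarrow>\<^sub>E Z) \<times> (E \<rightarrow>\<^sub>E Z)"
    by (auto simp: almost_eq_def)
  show "refl_on (E \<rightarrow>\<^sub>E Z) (almost_eq E Z)"
    by (auto simp: almost_eq_def refl_on_def)
  show "sym (almost_eq E Z)"
    by (auto simp: almost_eq_def sym_def eq_commute)
  show "trans (almost_eq E Z)"
  proof (rule transI)
    fix u v w assume a: "(u, v) \<in> almost_eq E Z" "(v, w) \<in> almost_eq E Z"
    have "{e \<in> E. u e \<noteq> w e} \<subseteq> {e \<in> E. u e \<noteq> v e} \<union> {e \<in> E. v e \<noteq> w e}" by auto
    then show "(u, w) \<in> almost_eq E Z"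
      using a by (auto simp: almost_eq_def intro: finite_subset)
  qed
qed

definition maps_action ::
  "('g, 'm) monoid_scheme \<Rightarrow> 'e set \<Rightarrow> ('g \<Rightarrow> 'e \<Rightarrow> 'e) \<Rightarrow> 'z set \<Rightarrow> ('g \<Rightarrow> 'z \<Rightarrow> 'z)
    \<Rightarrow> 'g \<Rightarrow> ('e \<Rightarrow> 'z) \<Rightarrow> ('e \<Rightarrow> 'z)" where
  "maps_action G E \<phi> Z \<psi> g =
    (\<lambda>v\<in>E \<rightarrow>\<^sub>E Z. \<lambda>e\<in>E. \<psi> g (v (\<phi> (inv\<^bsub>G\<^esub> g) e)))"

lemma group_action_maps:
  assumes "group_action G E \<phi>" "group_action G Z \<psi>"
  shows "group_action G (E \<rightarrow>\<^sub>E Z) (maps_action G E \<phi> Z \<psi>)"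
proof -
  interpret e: group_action G E \<phi> by fact
  interpret z: group_action G Z \<psi> by fact
  interpret g: group G using e.group_hom group_hom.axioms(1) by blast
  let ?a = "maps_action G E \<phi> Z \<psi>"
  have mem: "?a g v \<in> E \<rightarrow>\<^sub>E Z" if "g \<in> carrier G" "v \<in> E \<rightarrow>\<^sub>E Z" for g v
  proof -
    have "\<psi> g (v (\<phi> (inv\<^bsub>G\<^esub> g) e)) \<in> Z" if "e \<in> E" for e
    proof -
      have "\<phi> (inv\<^bsub>G\<^esub> g) e \<in> E" using that \<open>g \<in> carrier G\<close> e.element_image by blast
      then have "v (\<phi> (inv\<^bsub>G\<^esub> g) e) \<in> Z" using \<open>v \<in> E \<rightarrow>\<^sub>E Z\<close> by auto
      then show ?thesis using \<open>g \<in> carrier G\<close> z.element_image by blast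
    qed
    then show ?thesis using that by (simp add: maps_action_def)
  qed
  have one: "?a \<one>\<^bsub>G\<^esub> v = v" if "v \<in> E \<rightarrow>\<^sub>E Z" for v
  proof (rule PiE_ext[OF _ that])
    show "?a \<one>\<^bsub>G\<^esub> v \<in> E \<rightarrow>\<^sub>E Z" using mem that by simp
    show "?a \<one>\<^bsub>G\<^esub> v e = v e" if "e \<in> E" for e
    proof -
      have "v e \<in> Z" using that \<open>v \<in> E \<rightarrow>\<^sub>E Z\<close> by auto
      then show ?thesis
        using that \<open>v \<in> E \<rightarrow>\<^sub>E Z\<close>
        by (simp add: maps_action_def flip: e.id_eq_one z.id_eq_one)
    qed
  qed
  have mult: "?a (g \<otimes>\<^bsub>G\<^esub> h) v = ?a g (?a h v)"
    if "g \<in> carrier G" "h \<in> carrier G" "v \<in> E \<rightarrow>\<^sub>E Z" for g h v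
  proof (rule PiE_ext)
    show "?a (g \<otimes>\<^bsub>G\<^esub> h) v \<in> E \<rightarrow>\<^sub>E Z" "?a g (?a h v) \<in> E \<rightarrow>\<^sub>E Z" using mem that by auto
    fix e assume e: "e \<in> E"
    have ge: "\<phi> (inv\<^bsub>G\<^esub> g) e \<in> E" using e that e.element_image by blast
    then have hge: "\<phi> (inv\<^bsub>G\<^esub> h) (\<phi> (inv\<^bsub>G\<^esub> g) e) \<in> E" using that e.element_image by blast
    then have v: "v (\<phi> (inv\<^bsub>G\<^esub> h) (\<phi> (inv\<^bsub>G\<^esub> g) e)) \<in> Z" using that by auto
    have "\<phi> (inv\<^bsub>G\<^esub> (g \<otimes>\<^bsub>G\<^esub> h)) e = \<phi> (inv\<^bsub>G\<^esub> h) (\<phi> (inv\<^bsub>G\<^esub> g) e)"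
      using that e by (simp add: g.inv_mult_group e.composition_rule)
    then show "?a (g \<otimes>\<^bsub>G\<^esub> h) v e = ?a g (?a h v) e"
      using that e ge v mem[of h v] z.composition_rule
      by (simp add: maps_action_def)
  qed
  have bij: "?a g \<in> Bij (E \<rightarrow>\<^sub>E Z)" if g: "g \<in> carrier G" for g
  proof -
    have "bij_betw (?a g) (E \<rightarrow>\<^sub>E Z) (E \<rightarrow>\<^sub>E Z)"
    proof (rule bij_betwI)
      show "?a g \<in> (E \<rightarrow>\<^sub>E Z) \<rightarrow> (E \<rightarrow>\<^sub>E Z)"
        "?a (inv\<^bsub>G\<^esub> g) \<in> (E \<rightarrow>\<^sub>E Z) \<rightarrow> (E \<rightarrow>\<^sub>E Z)" using mem g by blast+
      show "?a (inv\<^bsub>G\<^esub> g) (?a g v) = v" if "v \<in> E \<rightarrow>\<^sub>E Z" for v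
        using mult[of "inv\<^bsub>G\<^esub> g" g v] one that g by simp
      show "?a g (?a (inv\<^bsub>G\<^esub> g) v) = v" if "v \<in> E \<rightarrow>\<^sub>E Z" for v
        using mult[of g "inv\<^bsub>G\<^esub> g" v] one that g by simp
    qed
    then show ?thesis by (simp add: Bij_def maps_action_def)
  qed
  have "?a \<in> hom G (BijGroup (E \<rightarrow>\<^sub>E Z))"
  proof (rule homI)
    show "?a g \<in> carrier (BijGroup (E \<rightarrow>\<^sub>E Z))" if "g \<in> carrier G" for g
      using bij that by (simp add: BijGroup_def)
    show "?a (g \<otimes>\<^bsub>G\<^esub> h) = ?a g \<otimes>\<^bsub>BijGroup (E \<rightarrow>\<^sub>E Z)\<^esub> ?a h"
      if "g \<in> carrier G" "h \<in> carrier G" for g h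
    proof (rule extensionalityI[of _ "E \<rightarrow>\<^sub>E Z"])
      show "?a (g \<otimes>\<^bsub>G\<^esub> h) \<in> extensional (E \<rightarrow>\<^sub>E Z)" by (simp add: maps_action_def)
      show "?a g \<otimes>\<^bsub>BijGroup (E \<rightarrow>\<^sub>E Z)\<^esub> ?a h \<in> extensional (E \<rightarrow>\<^sub>E Z)"
        using that bij by (simp add: BijGroup_def compose_def)
      show "?a (g \<otimes>\<^bsub>G\<^esub> h) v = (?a g \<otimes>\<^bsub>BijGroup (E \<rightarrow>\<^sub>E Z)\<^esub> ?a h) v"
        if v: "v \<in> E \<rightarrow>\<^sub>E Z" for v
        using mult[OF \<open>g \<in> carrier G\<close> \<open>h \<in> carrier G\<close> v] v bij \<open>g \<in> carrier G\<close> \<open>h \<in> carrier G\<close>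
        by (simp add: BijGroup_def compose_def)
    qed
  qed
  then show ?thesis
    by (intro group_action.intro group_hom.intro group_hom_axioms.intro g.is_group group_BijGroup)
qed

text \<open>
  The digraph whose walks are the walks of \<open>T\<close> that may traverse arcs in either direction:
  \<open>(e, True)\<close> traverses \<open>e\<close> forwards and \<open>(e, False)\<close> traverses it backwards.
\<close>

definition either_way :: "('v, 'e) pre_digraph \<Rightarrow> ('v, 'e \<times> bool) pre_digraph" where
  "either_way T = \<lparr>verts = verts T, arcs = arcs T \<times> UNIV,
    tail = (\<lambda>(e, b). if b then tail T e else head T e),
    head = (\<lambda>(e, b). if b then head T e else tail T e)\<rparr>"

definition reduced :: "('e \<times> bool) list \<Rightarrow> bool" where
  "reduced p \<longleftrightarrow> successively (\<lambda>(e, b) (f, c). \<not> (f = e \<and> c \<noteq> b)) p"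

definition reduced_path ::
  "('v, 'e) pre_digraph \<Rightarrow> 'v \<Rightarrow> ('e \<times> bool) list \<Rightarrow> 'v \<Rightarrow> bool" where
  "reduced_path T u p v \<longleftrightarrow> pre_digraph.awalk (either_way T) u p v \<and> reduced p"

locale tree = wf_digraph T for T :: "('v, 'e) pre_digraph" +
  assumes verts_nonempty: "verts T \<noteq> {}"
    and unique_reduced_path:
      "\<lbrakk>u \<in> verts T; v \<in> verts T\<rbrakk> \<Longrightarrow> \<exists>!p. reduced_path T u p v"

lemma (in tree) arc_to_ends_inj: "inj_on (arc_to_ends T) (arcs T)"
proof (rule inj_onI)
  fix e f assume ef: "e \<in> arcs T" "f \<in> arcs T" "arc_to_ends T e = arc_to_ends T f"
  have "reduced_path T (tail T e) [(e, True)] (head T e)"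
    "reduced_path T (tail T e) [(f, True)] (head T e)"
    using ef by (auto simp: reduced_path_def reduced_def either_way_def arc_to_ends_def
        pre_digraph.awalk_def pre_digraph.cas.simps)
  then show "e = f"
    using unique_reduced_path[of "tail T e" "head T e"] ef by auto
qed

locale G_graph =
  graph: wf_digraph T + verts: group_action G "verts T" \<alpha> + arcs: group_action G "arcs T" \<beta>
  for G :: "('g, 'm) monoid_scheme" and T :: "('v, 'e) pre_digraph"
    and \<alpha> :: "'g \<Rightarrow> 'v \<Rightarrow> 'v" and \<beta> :: "'g \<Rightarrow> 'e \<Rightarrow> 'e" +
  assumes tail_equivariant:
      "\<lbrakk>g \<in> carrier G; e \<in> arcs T\<rbrakk> \<Longrightarrow> tail T (\<beta> g e) = \<alpha> g (tail T e)"
    and head_equivariant: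
      "\<lbrakk>g \<in> carrier G; e \<in> arcs T\<rbrakk> \<Longrightarrow> head T (\<beta> g e) = \<alpha> g (head T e)"

locale G_tree = G_graph G T \<alpha> \<beta> + tree T
  for G :: "('g, 'm) monoid_scheme" and T :: "('v, 'e) pre_digraph"
    and \<alpha> :: "'g \<Rightarrow> 'v \<Rightarrow> 'v" and \<beta> :: "'g \<Rightarrow> 'e \<Rightarrow> 'e"

text \<open>
  \<open>W\<close> with the action \<open>\<alpha>\<close> is the vertex \<open>G\<close>-set of some \<open>G\<close>-tree. HOL cannot quantify over the
  type of edges; using pairs of vertices as edges loses no generality, because the edges of a tree
  are determined by their ends (\<open>tree.arc_to_ends_inj\<close>), so that they can be renamed to pairs.
  Vertices and edges have different types, which makes the two sets disjoint.
\<close>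

definition vertex_set_of_G_tree ::
  "('g, 'm) monoid_scheme \<Rightarrow> 'v set \<Rightarrow> ('g \<Rightarrow> 'v \<Rightarrow> 'v) \<Rightarrow> bool" where
  "vertex_set_of_G_tree G W \<alpha> \<longleftrightarrow>
    (\<exists>(T :: ('v, 'v \<times> 'v) pre_digraph) \<beta>. G_tree G T \<alpha> \<beta> \<and> verts T = W)"

end

(*
  Fix w0 in W and put c e x = (x w0) e. Since G is finitely generated and W is stable, each map c e
  on G changes along only finitely many edges of a Cayley graph, so the sets determined by finitely
  many of the c e form a G-invariant algebra of almost invariant subsets of G.

  Weighting the numbers of x with exactly one of x, x u in A (over all u in G) gives an "energy" that
  is strictly submodular on crossing sets and admits no infinite descent. The sets that are not
  determined by sets of smaller energy are therefore pairwise nested, and they generate the algebra.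
  Finitely many G-orbits of them determine all the c e, and these orbits form a G-tree VT.

  Every vertex stabilizer of VT fixes an element of W and every stabilizer of an element of W fixes a
  vertex of VT: for a finite group by correcting w0 on finitely many orbits, respectively by taking
  the centre of a finite set, and for an infinite group by passing to limits. This gives equivariant
  maps h: W -> VT and f: VT -> W. Choosing f v with h (f v) as close to v as possible, the flow that
  moves v towards h (f v) stops at the vertices with h (f v) = v. Collapsing VT along the flow leaves
  a tree on a subset of W, to which the rest of W is attached by pendant edges.
*)
theory Submission
  imports
    Defs
    "HOL-Library.Diagonal_Subsequence"
begin

section \<open>Indecomposable elements of an algebra of sets\<close>

text \<open>The edge boundary in a Cayley graph is submodular only in the weak sense, so sets
  minimizing it may still cross. Giving every \<open>u\<close> in G positive weight repairs this:
  for \<open>a\<close> in A - B and \<open>b\<close> in B - A the element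
  \<open>inv a \<otimes> b\<close> makes the inequality strict. The price is a real-valued function
  whose values need not be well ordered. Descent is excluded by compactness instead: from sets of
  bounded boundary, limits of translated subsequences are split off until the boundary is used up.
  Indecomposability involves no choice, so the family of indecomposable sets inherits every symmetry
  of the algebra and of the energy. The maps \<open>h\<close> and \<open>f\<close> need not be
  inverse to each other, which is why a flow is required. Its termination rests on the edges: a
  vertex that moves has its stabilizer inside that of an edge, and edge stabilizers are finite of
  bounded order, because a stabilizer acts freely on a finite boundary and only finitely many orbits
  of sets are taken.\<close>

definition agree :: "'x set set \<Rightarrow> 'x \<Rightarrow> 'x \<Rightarrow> bool" where
  "agree F x y \<longleftrightarrow> (\<forall>B\<in>F. x \<in> B \<longleftrightarrow> y \<in> B)"

lemma agreeD: "agree F x y \<Longrightarrow> B \<in> F \<Longrightarrow> x \<in> B \<longleftrightarrow> y \<in> B"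
  unfolding agree_def by (erule bspec)

text \<open>The Boolean algebra on \<open>X\<close> generated by the traces of \<open>Y\<close>: a
  set lies in it exactly when membership depends on finitely many members of \<open>Y\<close>. This
  pointwise form avoids Boolean terms and has a direct analogue for functions.\<close>

definition determined :: "'x set \<Rightarrow> 'x set set \<Rightarrow> 'x set set" where
  "determined X Y = {A. A \<subseteq> X \<and> (\<exists>F. finite F \<and> F \<subseteq> Y \<and>
     (\<forall>x\<in>X. \<forall>y\<in>X. agree F x y \<longrightarrow> (x \<in> A \<longleftrightarrow> y \<in> A)))}"

lemma determinedI:
  assumes "A \<subseteq> X" "finite F" "F \<subseteq> Y"
    and "\<And>x y. \<lbrakk>x \<in> X; y \<in> X; agree F x y\<rbrakk> \<Longrightarrow> x \<in> A \<longleftrightarrow> y \<in> A"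
  shows "A \<in> determined X Y"
proof -
  have *: "\<forall>x\<in>X. \<forall>y\<in>X. agree F x y \<longrightarrow> (x \<in> A \<longleftrightarrow> y \<in> A)"
    by (intro ballI impI, rule assms(4))
  show ?thesis unfolding determined_def
    by (rule CollectI, intro conjI exI[of _ F]) (fact assms(1) assms(2) assms(3) *)+
qed

lemma determinedE:
  assumes "A \<in> determined X Y"
  obtains F where "finite F" "F \<subseteq> Y"
    "\<And>x y. \<lbrakk>x \<in> X; y \<in> X; agree F x y\<rbrakk> \<Longrightarrow> x \<in> A \<longleftrightarrow> y \<in> A"
proof -
  from assms obtain F where F: "finite F" "F \<subseteq> Y"
    "\<forall>x\<in>X. \<forall>y\<in>X. agree F x y \<longrightarrow> (x \<in> A \<longleftrightarrow> y \<in> A)"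
    unfolding determined_def by (elim CollectE conjE exE)
  show thesis by (rule that[OF F(1,2)]) (rule F(3)[rule_format])
qed

lemma determined_subset: "A \<in> determined X Y \<Longrightarrow> A \<subseteq> X"
  unfolding determined_def by (elim CollectE conjE)

lemma determined_trans:
  assumes A: "A \<in> determined X Y" and Y: "\<And>B. B \<in> Y \<Longrightarrow> B \<in> determined X Z"
  shows "A \<in> determined X Z"
proof -
  obtain F where F: "finite F" "F \<subseteq> Y"
    "\<And>x y. \<lbrakk>x \<in> X; y \<in> X; agree F x y\<rbrakk> \<Longrightarrow> x \<in> A \<longleftrightarrow> y \<in> A"
    by (rule determinedE[OF A]) blast
  have "\<forall>B\<in>F. \<exists>K. finite K \<and> K \<subseteq> Z \<and> (\<forall>x\<in>X. \<forall>y\<in>X. agree K x y \<longrightarrow> (x \<in> B \<longleftrightarrow> y \<in> B))"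
  proof
    fix B assume "B \<in> F"
    then have "B \<in> determined X Z" using F(2) Y by blast
    then show "\<exists>K. finite K \<and> K \<subseteq> Z \<and> (\<forall>x\<in>X. \<forall>y\<in>X. agree K x y \<longrightarrow> (x \<in> B \<longleftrightarrow> y \<in> B))"
      unfolding determined_def by (elim CollectE conjE)
  qed
  then obtain K where K: "\<forall>B\<in>F. finite (K B) \<and> K B \<subseteq> Z \<and>
      (\<forall>x\<in>X. \<forall>y\<in>X. agree (K B) x y \<longrightarrow> (x \<in> B \<longleftrightarrow> y \<in> B))"
    by (rule bchoice[THEN exE])
  show ?thesis
  proof (rule determinedI[OF determined_subset[OF A]])
    show "finite (\<Union>B\<in>F. K B)" "(\<Union>B\<in>F. K B) \<subseteq> Z" using F(1) K by auto
    fix x y assume xy: "x \<in> X" "y \<in> X" and h: "agree (\<Union>B\<in>F. K B) x y"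
    have "x \<in> B \<longleftrightarrow> y \<in> B" if B: "B \<in> F" for B
    proof -
      have "agree (K B) x y" using h B unfolding agree_def by blast
      then show ?thesis using bspec[OF K B] xy by blast
    qed
    then have "agree F x y" unfolding agree_def by blast
    then show "x \<in> A \<longleftrightarrow> y \<in> A" using F(3) xy by blast
  qed
qed

lemma determined_compl:
  assumes "X - A \<in> determined X Y" "A \<subseteq> X"
  shows "A \<in> determined X Y"
proof -
  obtain F where F: "finite F" "F \<subseteq> Y"
    "\<And>x y. \<lbrakk>x \<in> X; y \<in> X; agree F x y\<rbrakk> \<Longrightarrow> x \<in> X - A \<longleftrightarrow> y \<in> X - A"
    by (rule determinedE[OF assms(1)]) blast
  show ?thesis by (rule determinedI[OF assms(2) F(1,2)]) (use F(3) in blast)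
qed

lemma determined_base: "A \<in> Y \<Longrightarrow> A \<subseteq> X \<Longrightarrow> A \<in> determined X Y"
  by (rule determinedI[of _ _ "{A}"]) (simp_all add: agree_def)

section \<open>Uncrossing with a strictly submodular function\<close>

locale submodular_algebra =
  fixes X :: "'x set" and \<A> :: "'x set set" and N :: "'x set \<Rightarrow> real"
  assumes sub: "A \<in> \<A> \<Longrightarrow> A \<subseteq> X"
    and compl: "A \<in> \<A> \<Longrightarrow> X - A \<in> \<A>"
    and inter: "A \<in> \<A> \<Longrightarrow> B \<in> \<A> \<Longrightarrow> A \<inter> B \<in> \<A>"
    and submodular: "\<lbrakk>A \<in> \<A>; B \<in> \<A>; \<not> A \<subseteq> B; \<not> B \<subseteq> A\<rbrakk> \<Longrightarrow> N (A \<inter> B) + N (A \<union> B) < N A + N B"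
    and N_compl: "A \<in> \<A> \<Longrightarrow> N (X - A) = N A"
    and no_descent: "(\<And>i::nat. F i \<in> \<A>) \<Longrightarrow> \<not> (\<forall>i. N (F (Suc i)) < N (F i))"
begin

text \<open>Irreducible generators for the filtration of the algebra by \<open>N\<close>. Nothing is
  chosen, so every symmetry of \<open>\<A>\<close> and \<open>N\<close> preserves the
  family.\<close>

definition indecomposable :: "'x set set" where
  "indecomposable = {A \<in> \<A>. A \<notin> determined X {B \<in> \<A>. N B < N A}}"

lemma determined_two:
  assumes A: "A \<in> \<A>" and B: "B \<in> \<A>"
    and N: "N (A \<inter> B) < r" "N (A - B) < r"
  shows "A \<in> determined X {C \<in> \<A>. N C < r}"
proof (rule determinedI[of _ _ "{A \<inter> B, A - B}"])
  have "A - B = A \<inter> (X - B)" using sub[OF A] by auto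
  then show "{A \<inter> B, A - B} \<subseteq> {C \<in> \<A>. N C < r}"
    using assms inter[OF A B] inter[OF A compl[OF B]] by auto
qed (use sub[OF A] in \<open>auto simp: agree_def\<close>)

text \<open>Suppose A and B cross. Each of A, B and their complements is the union of two of the
  four corners and, being indecomposable, has at least its own energy on one of them. Strict
  submodularity keeps both sums over opposite corners below N A + N B, and no distribution of the
  heavy corners survives.\<close>

lemma indecomposable_nested:
  assumes A: "A \<in> indecomposable" and B: "B \<in> indecomposable"
  shows "A \<subseteq> B \<or> B \<subseteq> A \<or> A \<inter> B = {} \<or> A \<union> B = X"
proof (rule ccontr)
  assume "\<not> ?thesis"
  then have n: "\<not> A \<subseteq> B" "\<not> B \<subseteq> A" "A \<inter> B \<noteq> {}" "A \<union> B \<noteq> X" by auto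
  have AA: "A \<in> \<A>" "A \<subseteq> X" and BB: "B \<in> \<A>" "B \<subseteq> X"
    using A B sub by (auto simp: indecomposable_def)
  let ?A = "X - A" and ?B = "X - B"
  have cA: "?A \<in> \<A>" and cB: "?B \<in> \<A>" using compl AA BB by auto
  have e1: "N (A \<inter> B) + N (?A - B) < N A + N B"
  proof -
    have eq: "A \<union> B = X - (?A - B)" "?A - B = ?A \<inter> ?B" using AA BB by auto
    then have "?A - B \<in> \<A>" using inter[OF cA cB] by simp
    then have "N (A \<union> B) = N (?A - B)" using N_compl eq(1) by simp
    then show ?thesis using submodular[OF AA(1) BB(1) n(1,2)] by simp
  qed
  have e2: "N (A - B) + N (B - A) < N A + N B"
  proof -
    have "A \<union> ?B = X - (B - A)" "A \<inter> ?B = A - B" and eq: "B - A = B \<inter> ?A"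
      using AA BB by auto
    moreover have "B - A \<in> \<A>" using inter[OF BB(1) cA] eq by simp
    moreover have "\<not> A \<subseteq> ?B" "\<not> ?B \<subseteq> A" using n AA BB by auto
    ultimately show ?thesis
      using submodular[OF AA(1) cB] N_compl[of "B - A"] N_compl[OF BB(1)] by simp
  qed
  have notA: "A \<notin> determined X {C \<in> \<A>. N C < N A}" and notB: "B \<notin> determined X {C \<in> \<A>. N C < N B}"
    using A B by (auto simp: indecomposable_def)
  note dc = determined_compl
  have 1: "\<not> (N (A \<inter> B) < N A \<and> N (A - B) < N A)" using determined_two[OF AA(1) BB(1)] notA by auto
  have 2: "\<not> (N (?A \<inter> B) < N A \<and> N (?A - B) < N A)"
    using determined_two[OF cA BB(1)] notA dc AA by auto
  have 3: "\<not> (N (B \<inter> A) < N B \<and> N (B - A) < N B)" using determined_two[OF BB(1) AA(1)] notB by auto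
  have 4: "\<not> (N (?B \<inter> A) < N B \<and> N (?B - A) < N B)"
    using determined_two[OF cB AA(1)] notB dc BB by auto
  have "?A \<inter> B = B - A" "?B \<inter> A = A - B" "?B - A = ?A - B" using AA BB by auto
  \<comment> \<open>If a corner heavy for A is opposite to one heavy for B, \<open>e1\<close> or
    \<open>e2\<close> fails. Otherwise A owns one opposite pair and B the other, whence N A < N B
    and N B < N A.\<close>
  then show False using 1 2 3 4 e1 e2 by (simp add: Int_commute) linarith
qed

lemma indecomposable_compl:
  assumes "A \<in> indecomposable"
  shows "X - A \<in> indecomposable"
proof -
  have A: "A \<in> \<A>" "A \<subseteq> X" using assms sub by (auto simp: indecomposable_def)
  show ?thesis using A(2) determined_compl assms compl[OF A(1)] N_compl[OF A(1)] by (auto simp: indecomposable_def)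
qed

lemma indecomposable_proper:
  assumes "A \<in> indecomposable"
  shows "A \<noteq> {}" "A \<noteq> X"
proof -
  have "{} \<in> determined X Y" "X \<in> determined X Y" for Y
    by (rule determinedI[of _ _ "{}"]; simp)+
  then show "A \<noteq> {}" "A \<noteq> X" using assms by (auto simp: indecomposable_def)
qed

lemma determined_indecomposable:
  assumes "A \<in> \<A>"
  shows "A \<in> determined X indecomposable"
proof -
  \<comment> \<open>Energies are real numbers, so the induction uses the relation restricted to
    \<open>\<A>\<close>, where \<open>no_descent\<close> excludes infinite descending
    chains.\<close>
  have "wf {(B, A). A \<in> \<A> \<and> B \<in> \<A> \<and> N B < N A}" (is "wf ?R")
  proof (rule ccontr)
    assume "\<not> wf ?R"
    then obtain f where f: "\<And>i. (f (Suc i), f i) \<in> ?R" by (auto simp: wf_iff_no_infinite_down_chain)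
    have "f i \<in> \<A>" for i using f[of i] by auto
    then show False using f no_descent[of f] by auto
  qed
  then show ?thesis using assms
  proof (induction A rule: wf_induct_rule)
    case (less A)
    show ?case
    proof (cases "A \<in> indecomposable")
      case True
      then show ?thesis using determined_base sub less.prems by blast
    next
      case False
      then have "A \<in> determined X {B \<in> \<A>. N B < N A}" using less.prems by (simp add: indecomposable_def)
      then show ?thesis
      proof (rule determined_trans)
        show "B \<in> determined X indecomposable" if "B \<in> {B \<in> \<A>. N B < N A}" for B
          using less that by simp
      qed
    qed
  qed
qed

end

section \<open>Almost invariant subsets of a finitely generated group\<close>

text \<open>Sequential compactness of the power set of a countable set, by the diagonal argument:
  the n-th refinement decides whether the n-th point lies in the sets.\<close>

lemma pointwise_convergent_subsequence:
  fixes F :: "nat \<Rightarrow> 'x set"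
  assumes "countable X"
  shows "\<exists>r L. strict_mono r \<and> L \<subseteq> X \<and> (\<forall>x\<in>X. \<forall>\<^sub>F j in sequentially. x \<in> F (r j) \<longleftrightarrow> x \<in> L)"
proof (cases "X = {}")
  case True
  then show ?thesis using strict_mono_id by blast
next
  case False
  define e where "e = from_nat_into X"
  have e: "\<exists>n. e n = x" if "x \<in> X" for x
    using from_nat_into_surj[OF assms that] by (auto simp: e_def)
  define P where "P = (\<lambda>n (s :: nat \<Rightarrow> nat). (\<forall>j. e n \<in> F (s j)) \<or> (\<forall>j. e n \<notin> F (s j)))"
  interpret subseqs P
  proof
    fix n and s :: "nat \<Rightarrow> nat"
    have "infinite {j. e n \<in> F (s j)} \<or> infinite {j. e n \<notin> F (s j)}"
    proof -
      have "{j. e n \<in> F (s j)} \<union> {j. e n \<notin> F (s j)} = (UNIV :: nat set)" by auto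
      then show ?thesis by (metis finite_UnI infinite_UNIV_nat)
    qed
    then obtain Q :: "nat set" where Q: "infinite Q" "Q = {j. e n \<in> F (s j)} \<or> Q = {j. e n \<notin> F (s j)}" by blast
    obtain r :: "nat \<Rightarrow> nat" where r: "strict_mono r" "\<And>j. r j \<in> Q" using infinite_enumerate[OF Q(1)] by auto
    then show "\<exists>r'. strict_mono r' \<and> P n (s \<circ> r')"
      using Q(2) by (intro exI[of _ r]) (auto simp: P_def)
  qed
  have "P n (s \<circ> r)" if "P n s" for n s r using that by (auto simp: P_def)
  then have *: "P k (diagseq \<circ> (+) (Suc k))" for k using diagseq_holds by blast
  define L where "L = {x \<in> X. \<forall>\<^sub>F j in sequentially. x \<in> F (diagseq j)}"
  have "\<forall>\<^sub>F j in sequentially. x \<in> F (diagseq j) \<longleftrightarrow> x \<in> L" if x: "x \<in> X" for x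
  proof -
    obtain k where k: "e k = x" using e[OF x] by blast
    have sh: "\<forall>\<^sub>F j in sequentially. R j" if "\<And>j. R (Suc k + j)" for R :: "nat \<Rightarrow> bool"
      using that unfolding eventually_sequentially by (metis le_Suc_ex)
    consider "\<forall>j. x \<in> F (diagseq (Suc k + j))" | "\<forall>j. x \<notin> F (diagseq (Suc k + j))"
      using *[of k] k by (auto simp: P_def)
    then show ?thesis
    proof cases
      case 1
      then have "\<forall>\<^sub>F j in sequentially. x \<in> F (diagseq j)" by (intro sh) auto
      then show ?thesis using x by (simp add: L_def)
    next
      case 2
      then have a: "\<forall>\<^sub>F j in sequentially. x \<notin> F (diagseq j)" by (intro sh) auto
      have "x \<notin> L"
      proof
        assume "x \<in> L"
        then have "\<forall>\<^sub>F j in sequentially. x \<in> F (diagseq j)" by (simp add: L_def)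
        from this a have "\<forall>\<^sub>F j in sequentially. False" by eventually_elim simp
        then show False by simp
      qed
      then show ?thesis using a by simp
    qed
  qed
  then show ?thesis using subseq_diagseq by (intro exI[of _ diagseq] exI[of _ L]) (auto simp: L_def)
qed

section \<open>Left translation and boundaries in the Cayley graph\<close>

definition (in monoid) lmul where "lmul g A = (\<lambda>x. g \<otimes> x) ` A"

context group
begin

lemma lmul_mult: "\<lbrakk>g \<in> carrier G; h \<in> carrier G; A \<subseteq> carrier G\<rbrakk> \<Longrightarrow> lmul (g \<otimes> h) A = lmul g (lmul h A)"
  by (auto simp: lmul_def image_image m_assoc subset_iff intro!: image_cong)

lemma lmul_one: "A \<subseteq> carrier G \<Longrightarrow> lmul \<one> A = A"
  by (force simp: lmul_def)

end

locale fg_group = group G for G (structure) +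
  fixes S
  assumes finite_S: "finite S" and S_sub: "S \<subseteq> carrier G" and gen: "generate G S = carrier G"
begin

text \<open>Coboundary of A along the edges from x to \<open>x \<otimes> u\<close>. Labels act on
  the right, so left translations commute with them and preserve the sizes of boundaries.\<close>

definition bdry where "bdry u A = {x \<in> carrier G. (x \<in> A) \<noteq> (x \<otimes> u \<in> A)}"

definition almost_inv where "almost_inv A \<longleftrightarrow> A \<subseteq> carrier G \<and> (\<forall>s\<in>S. finite (bdry s A))"

definition gbdry where "gbdry A = (\<Sum>s\<in>S. card (bdry s A))"

lemma lmul_iff:
  assumes "g \<in> carrier G" "A \<subseteq> carrier G" "x \<in> carrier G"
  shows "x \<in> lmul g A \<longleftrightarrow> inv g \<otimes> x \<in> A"
proof
  assume "x \<in> lmul g A"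
  then obtain a where "a \<in> A" "x = g \<otimes> a" by (auto simp: lmul_def)
  then show "inv g \<otimes> x \<in> A" using assms by (auto simp flip: m_assoc)
next
  assume "inv g \<otimes> x \<in> A"
  moreover have "x = g \<otimes> (inv g \<otimes> x)" using assms by (simp flip: m_assoc)
  ultimately show "x \<in> lmul g A" by (auto simp: lmul_def)
qed

lemma lmul_sub: "g \<in> carrier G \<Longrightarrow> A \<subseteq> carrier G \<Longrightarrow> lmul g A \<subseteq> carrier G"
  by (auto simp: lmul_def)

lemma bdry_sub: "bdry u A \<subseteq> carrier G" by (auto simp: bdry_def)

lemma bdry_one: "bdry \<one> A = {}" by (auto simp: bdry_def)

lemma bdry_lmul:
  assumes "g \<in> carrier G" "A \<subseteq> carrier G" "u \<in> carrier G"
  shows "bdry u (lmul g A) = lmul g (bdry u A)"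
proof (rule Set.set_eqI)
  fix x
  show "x \<in> bdry u (lmul g A) \<longleftrightarrow> x \<in> lmul g (bdry u A)"
  proof (cases "x \<in> carrier G")
    case True
    have "x \<in> bdry u (lmul g A) \<longleftrightarrow> (inv g \<otimes> x \<in> A) \<noteq> (inv g \<otimes> (x \<otimes> u) \<in> A)"
      using True assms by (simp add: bdry_def lmul_iff)
    also have "\<dots> \<longleftrightarrow> x \<in> lmul g (bdry u A)"
      using True assms bdry_sub by (simp add: lmul_iff) (simp add: bdry_def m_assoc)
    finally show ?thesis .
  next
    case False
    then show ?thesis using lmul_sub[OF assms(1) bdry_sub] bdry_sub by blast
  qed
qed

lemma inj_on_lmul: "g \<in> carrier G \<Longrightarrow> inj_on (\<lambda>x. g \<otimes> x) (carrier G)"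
  by (auto intro: inj_onI)

lemma card_lmul: "g \<in> carrier G \<Longrightarrow> A \<subseteq> carrier G \<Longrightarrow> card (lmul g A) = card A"
  unfolding lmul_def by (intro card_image inj_on_subset[OF inj_on_lmul])

lemma finite_lmul: "g \<in> carrier G \<Longrightarrow> A \<subseteq> carrier G \<Longrightarrow> finite (lmul g A) = finite A"
  unfolding lmul_def by (intro finite_image_iff inj_on_subset[OF inj_on_lmul])

lemma almost_inv_lmul:
  assumes "g \<in> carrier G" "almost_inv A"
  shows "almost_inv (lmul g A)"
  using assms S_sub bdry_sub
  by (auto simp: almost_inv_def bdry_lmul finite_lmul subset_iff dest: subsetD[OF lmul_sub])

lemma card_bdry_lmul:
  "\<lbrakk>g \<in> carrier G; A \<subseteq> carrier G; u \<in> carrier G\<rbrakk> \<Longrightarrow> card (bdry u (lmul g A)) = card (bdry u A)"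
  by (simp add: bdry_lmul card_lmul bdry_sub)

lemma gbdry_lmul: "\<lbrakk>g \<in> carrier G; A \<subseteq> carrier G\<rbrakk> \<Longrightarrow> gbdry (lmul g A) = gbdry A"
  using S_sub unfolding gbdry_def by (intro sum.cong) (auto intro: card_bdry_lmul)

lemma bdry_mult_sub:
  assumes "u \<in> carrier G" "v \<in> carrier G"
  shows "bdry (u \<otimes> v) A \<subseteq> bdry u A \<union> (\<lambda>x. x \<otimes> inv u) ` bdry v A"
proof
  fix x assume x: "x \<in> bdry (u \<otimes> v) A"
  then have xG: "x \<in> carrier G" by (simp add: bdry_def)
  have "x \<in> (\<lambda>x. x \<otimes> inv u) ` bdry v A" if "x \<notin> bdry u A"
  proof (rule image_eqI)
    show "x = (x \<otimes> u) \<otimes> inv u" using xG assms by (simp add: m_assoc)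
    show "x \<otimes> u \<in> bdry v A" using that x xG assms by (simp add: bdry_def m_assoc)
  qed
  then show "x \<in> bdry u A \<union> (\<lambda>x. x \<otimes> inv u) ` bdry v A" by blast
qed

lemma bdry_inv_sub:
  assumes "u \<in> carrier G"
  shows "bdry (inv u) A \<subseteq> (\<lambda>x. x \<otimes> u) ` bdry u A"
proof
  fix x assume x: "x \<in> bdry (inv u) A"
  then have xG: "x \<in> carrier G" by (simp add: bdry_def)
  show "x \<in> (\<lambda>x. x \<otimes> u) ` bdry u A"
  proof (rule image_eqI)
    show "x = (x \<otimes> inv u) \<otimes> u" using xG assms by (simp add: m_assoc)
    show "x \<otimes> inv u \<in> bdry u A" using x xG assms by (auto simp add: bdry_def m_assoc)
  qed
qed

text \<open>An edge labelled \<open>u\<close> is spanned by a path spelling \<open>u\<close> in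
  generators and their inverses, and a set separating its ends separates the ends of some step.
  \<open>L\<close> counts the steps; it depends on \<open>u\<close> alone, which makes the weights
  of the energy independent of A.\<close>

lemma bdry_bound:
  assumes "u \<in> carrier G"
  shows "\<exists>L. \<forall>A. almost_inv A \<longrightarrow> finite (bdry u A) \<and> card (bdry u A) \<le> L * gbdry A"
proof -
  have "u \<in> generate G S" using assms gen by simp
  then show ?thesis
  proof (induction rule: generate.induct)
    case one
    then show ?case by (simp add: bdry_one)
  next
    case (incl s)
    have "card (bdry s A) \<le> gbdry A" for A unfolding gbdry_def
      using finite_S incl by (intro member_le_sum) auto
    then show ?case using incl by (intro exI[of _ 1]) (auto simp: almost_inv_def)
  next
    case (inv s)
    have s: "s \<in> carrier G" using inv S_sub by auto
    have "finite (bdry (inv s) A) \<and> card (bdry (inv s) A) \<le> gbdry A" if "almost_inv A" for A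
    proof -
      have f: "finite (bdry s A)" using that inv by (auto simp: almost_inv_def)
      have "card (bdry s A) \<le> gbdry A" unfolding gbdry_def
        using finite_S inv by (intro member_le_sum) auto
      then show ?thesis using surj_card_le[OF f bdry_inv_sub[OF s]]
          finite_surj[OF f bdry_inv_sub[OF s]] by simp
    qed
    then show ?case by (intro exI[of _ 1]) auto
  next
    case (eng u v)
    have uv: "u \<in> carrier G" "v \<in> carrier G" using eng.hyps gen by auto
    obtain L M where L: "\<And>A. almost_inv A \<Longrightarrow> finite (bdry u A) \<and> card (bdry u A) \<le> L * gbdry A"
      and M: "\<And>A. almost_inv A \<Longrightarrow> finite (bdry v A) \<and> card (bdry v A) \<le> M * gbdry A"
      using eng.IH by auto
    have "finite (bdry (u \<otimes> v) A) \<and> card (bdry (u \<otimes> v) A) \<le> (L + M) * gbdry A" if A: "almost_inv A" for A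
    proof -
      let ?I = "(\<lambda>x. x \<otimes> inv u) ` bdry v A"
      have f: "finite (bdry u A \<union> ?I)" using L M A by auto
      have "card (bdry (u \<otimes> v) A) \<le> card (bdry u A \<union> ?I)" by (rule card_mono[OF f bdry_mult_sub[OF uv]])
      also have "\<dots> \<le> card (bdry u A) + card ?I" by (rule card_Un_le)
      also have "\<dots> \<le> card (bdry u A) + card (bdry v A)" using M A card_image_le by auto
      also have "\<dots> \<le> (L + M) * gbdry A" using L[OF A] M[OF A] by (simp add: add_mult_distrib)
      finally show ?thesis using finite_subset[OF bdry_mult_sub[OF uv] f] by simp
    qed
    then show ?case by blast
  qed
qed

lemma finite_bdry: "u \<in> carrier G \<Longrightarrow> almost_inv A \<Longrightarrow> finite (bdry u A)"
  using bdry_bound by blast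

text \<open>Every element is spelled by a finite word. Countability serves the diagonal argument and
  the enumeration of labels in the energy.\<close>

lemma countable_carrier: "countable (carrier G)"
proof -
  define T where "T = S \<union> m_inv G ` S"
  define ev where "ev = (\<lambda>l. foldr (\<otimes>) l \<one>)"
  have T: "T \<subseteq> carrier G" using S_sub by (auto simp: T_def)
  have cl: "ev l \<in> carrier G" if "set l \<subseteq> T" for l
    using that T by (induction l) (auto simp: ev_def)
  have app: "ev (l @ m) = ev l \<otimes> ev m" if "set l \<subseteq> T" "set m \<subseteq> T" for l m
    using that
  proof (induction l)
    case Nil
    then show ?case using cl by (simp add: ev_def)
  next
    case (Cons a l)
    then show ?case using cl[of l] cl[of m] T by (simp add: ev_def m_assoc subset_iff)
  qed
  have "\<exists>l. set l \<subseteq> T \<and> ev l = u" if "u \<in> generate G S" for u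
    using that
  proof (induction rule: generate.induct)
    case one
    show ?case by (intro exI[of _ "[]"]) (simp add: ev_def)
  next
    case (incl s)
    then show ?case using S_sub by (intro exI[of _ "[s]"]) (auto simp add: ev_def T_def)
  next
    case (inv s)
    then show ?case using S_sub by (intro exI[of _ "[inv s]"]) (auto simp add: ev_def T_def)
  next
    case (eng u v)
    then obtain l m where "set l \<subseteq> T" "ev l = u" "set m \<subseteq> T" "ev m = v" by blast
    then show ?case using app by (intro exI[of _ "l @ m"]) auto
  qed
  then have "carrier G \<subseteq> ev ` lists T" unfolding gen by (auto simp: lists_eq_set image_iff)
  moreover have "countable (lists T)" using finite_S by (auto simp: T_def intro: countable_finite)
  ultimately show ?thesis by (meson countable_image countable_subset)
qed

section \<open>Lower semicontinuity of boundary counts\<close>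

lemma bdry_symdiff: "bdry u ((A - B) \<union> (B - A)) = (bdry u A - bdry u B) \<union> (bdry u B - bdry u A)"
  by (auto simp: bdry_def)

lemma almost_inv_symdiff: "almost_inv A \<Longrightarrow> almost_inv B \<Longrightarrow> almost_inv ((A - B) \<union> (B - A))"
  by (auto simp: almost_inv_def bdry_symdiff)

lemma gbdry_zero: "almost_inv A \<Longrightarrow> gbdry A = 0 \<Longrightarrow> u \<in> carrier G \<Longrightarrow> card (bdry u A) = 0"
  using bdry_bound[of u] by fastforce

text \<open>
  The boundary count is lower semicontinuous along a subsequence: a translate of a subsequence
  converges pointwise to a set with nonempty boundary, and splitting off that limit leaves sets
  with smaller boundary.
\<close>

lemma bdry_lower_semicontinuous:
  fixes A :: "nat \<Rightarrow> 'a set"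
  assumes "\<And>i. almost_inv (A i)" "\<And>i. gbdry (A i) \<le> k"
  shows "\<exists>r i. strict_mono (r :: nat \<Rightarrow> nat) \<and> (\<forall>u\<in>carrier G.
    \<forall>\<^sub>F j in sequentially. card (bdry u (A i)) \<le> card (bdry u (A (r j))))"
  using assms
proof (induction k arbitrary: A rule: less_induct)
  case (less k A)
  show ?case
  proof (cases "\<exists>i. gbdry (A i) = 0")
    case True
    then obtain i where i: "gbdry (A i) = 0" by blast
    have "\<forall>\<^sub>F j in sequentially. card (bdry u (A i)) \<le> card (bdry u (A (id j)))" if "u \<in> carrier G" for u
      using gbdry_zero[OF less.prems(1) i that] by simp
    then show ?thesis using strict_mono_id by blast
  next
    case False
    have "\<exists>s x. s \<in> S \<and> x \<in> bdry s (A i)" for i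
    proof -
      have "gbdry (A i) \<noteq> 0" using False by simp
      then obtain s where "s \<in> S" "card (bdry s (A i)) \<noteq> 0"
        unfolding gbdry_def by (meson sum.neutral)
      then show ?thesis by (metis card.empty ex_in_conv)
    qed
    then obtain s x where sx: "\<And>i. s i \<in> S" "\<And>i. x i \<in> bdry (s i) (A i)" by metis
    have AG: "A i \<subseteq> carrier G" for i using less.prems(1) by (auto simp: almost_inv_def)
    have xG: "x i \<in> carrier G" for i using sx(2) bdry_sub by blast
    \<comment> \<open>Moving a boundary point to \<one> keeps the boundary from escaping to
      infinity. Translation changes no count, so the conclusion carries over to the original
      sets.\<close>
    define A' where "A' i = lmul (inv (x i)) (A i)" for i
    have A': "almost_inv (A' i)" "gbdry (A' i) \<le> k" "A' i \<subseteq> carrier G" for i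
      using less.prems AG xG almost_inv_lmul gbdry_lmul lmul_sub by (auto simp: A'_def)
    have cA': "card (bdry u (A' i)) = card (bdry u (A i))" if "u \<in> carrier G" for i u
      unfolding A'_def using AG xG that by (simp add: card_bdry_lmul)
    have one: "\<one> \<in> bdry (s i) (A' i)" for i
    proof -
      have "s i \<in> carrier G" using sx S_sub by blast
      then have "bdry (s i) (A' i) = lmul (inv (x i)) (bdry (s i) (A i))"
        unfolding A'_def using AG xG by (simp add: bdry_lmul)
      moreover have "inv (x i) \<otimes> x i = \<one>" using xG by simp
      ultimately show ?thesis using sx(2) unfolding lmul_def by (metis image_eqI)
    qed
    \<comment> \<open>There are finitely many labels, so along a subsequence the boundary edge at
      \<one> carries a constant label \<open>t\<close> and survives in the limit.\<close>
    have "\<exists>t\<in>S. infinite {i. s i = t}"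
    proof (rule ccontr)
      assume "\<not> ?thesis"
      then have "finite (\<Union>t\<in>S. {i. s i = t})" using finite_S by blast
      moreover have "(\<Union>t\<in>S. {i. s i = t}) = UNIV" using sx by auto
      ultimately show False by simp
    qed
    then obtain t where t: "t \<in> S" "infinite {i. s i = t}" by blast
    obtain r0 :: "nat \<Rightarrow> nat" where r0: "strict_mono r0" "\<And>j. s (r0 j) = t"
      using infinite_enumerate[OF t(2)] by auto
    obtain r1 L where r1: "strict_mono (r1 :: nat \<Rightarrow> nat)" and L: "L \<subseteq> carrier G"
      and lim: "\<And>x. x \<in> carrier G \<Longrightarrow> \<forall>\<^sub>F j in sequentially. x \<in> A' (r0 (r1 j)) \<longleftrightarrow> x \<in> L"
      using pointwise_convergent_subsequence[OF countable_carrier, of "\<lambda>j. A' (r0 j)"] by blast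
    define D where "D j = A' (r0 (r1 j))" for j
    have D: "almost_inv (D j)" "gbdry (D j) \<le> k" for j using A' by (auto simp: D_def)
    have limb: "\<forall>\<^sub>F j in sequentially. x \<in> bdry u (D j) \<longleftrightarrow> x \<in> bdry u L"
      if "x \<in> carrier G" "u \<in> carrier G" for x u
    proof -
      have "x \<otimes> u \<in> carrier G" using that by simp
      from lim[OF that(1)] lim[OF this] show ?thesis
        by eventually_elim (simp add: bdry_def D_def)
    qed
    have limf: "\<forall>\<^sub>F j in sequentially. F \<subseteq> bdry u (D j)"
      if "finite F" "F \<subseteq> bdry u L" "u \<in> carrier G" for F u
    proof -
      have "\<forall>\<^sub>F j in sequentially. \<forall>x\<in>F. x \<in> bdry u (D j) \<longleftrightarrow> x \<in> bdry u L"
      proof (intro eventually_ball_finite[OF that(1)] ballI)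
        fix x assume "x \<in> F"
        then have "x \<in> carrier G" using that(2) bdry_sub by blast
        then show "\<forall>\<^sub>F j in sequentially. x \<in> bdry u (D j) \<longleftrightarrow> x \<in> bdry u L"
          by (rule limb[OF _ that(3)])
      qed
      then show ?thesis by eventually_elim (use that in auto)
    qed
    \<comment> \<open>A finite part of \<open>bdry u L\<close> appears in some \<open>D j\<close>,
      and \<open>Suc k\<close> points there would exceed the bound \<open>k\<close>.\<close>
    have "finite (bdry u L)" if u: "u \<in> S" for u
    proof (rule ccontr)
      assume "infinite (bdry u L)"
      then obtain F where F: "finite F" "F \<subseteq> bdry u L" "card F = Suc k"
        using infinite_arbitrarily_large by blast
      have uG: "u \<in> carrier G" using u S_sub by blast
      obtain j where j: "F \<subseteq> bdry u (D j)"
        using limf[OF F(1,2) uG] eventually_happens' sequentially_bot by blast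
      have "card F \<le> card (bdry u (D j))" using j finite_bdry[OF uG D(1)] by (intro card_mono)
      also have "\<dots> \<le> gbdry (D j)" unfolding gbdry_def using finite_S u by (intro member_le_sum) auto
      also have "\<dots> \<le> k" by (rule D)
      finally show False using F by simp
    qed
    then have Li: "almost_inv L" using L by (simp add: almost_inv_def)
    have oneL: "\<one> \<in> bdry t L"
    proof -
      have "t \<in> carrier G" using t S_sub by blast
      then obtain j where "\<one> \<in> bdry t (D j) \<longleftrightarrow> \<one> \<in> bdry t L"
        using eventually_happens'[OF sequentially_bot limb[of \<one> t]] by blast
      then show ?thesis using one[of "r0 (r1 j)"] r0(2) by (simp add: D_def)
    qed
    \<comment> \<open>The coboundary is linear modulo 2. Hence, once \<open>bdry u L\<close> lies
      inside \<open>bdry u (D j)\<close>, the counts of \<open>L\<close> and \<open>B j\<close> add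
      up to that of \<open>D j\<close>. As \<open>L\<close> has nonempty boundary, the induction
      hypothesis applies to a tail of \<open>B\<close>.\<close>
    define B where "B j = (D j - L) \<union> (L - D j)" for j
    have evB: "\<forall>\<^sub>F j in sequentially. card (bdry u (D j)) = card (bdry u L) + card (bdry u (B j))"
      if u: "u \<in> carrier G" for u
    proof -
      have f: "finite (bdry u L)" using finite_bdry u Li by blast
      have "\<forall>\<^sub>F j in sequentially. bdry u L \<subseteq> bdry u (D j)" using limf[OF f] u by blast
      then show ?thesis
      proof eventually_elim
        case (elim j)
        then have "bdry u (B j) = bdry u (D j) - bdry u L" by (auto simp: B_def bdry_symdiff)
        then show ?case using card_Diff_subset[OF f elim] card_mono[OF finite_bdry[OF u D(1)] elim]
          by simp
      qed
    qed
    have "\<forall>\<^sub>F j in sequentially. \<forall>u\<in>S. card (bdry u (D j)) = card (bdry u L) + card (bdry u (B j))"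
      using finite_S S_sub evB by (intro eventually_ball_finite) auto
    then obtain J where J: "\<And>j u. j \<ge> J \<Longrightarrow> u \<in> S \<Longrightarrow> card (bdry u (D j)) = card (bdry u L) + card (bdry u (B j))"
      unfolding eventually_sequentially by blast
    have gL: "gbdry L > 0"
    proof -
      have "card (bdry t L) > 0" using oneL finite_bdry Li t S_sub by (auto simp: card_gt_0_iff)
      moreover have "card (bdry t L) \<le> gbdry L" unfolding gbdry_def
        using finite_S t by (intro member_le_sum) auto
      ultimately show ?thesis by simp
    qed
    have gB: "gbdry (B (J + j)) < k" for j
    proof -
      have "gbdry (D (J + j)) = gbdry L + gbdry (B (J + j))"
        unfolding gbdry_def sum.distrib[symmetric] by (intro sum.cong) (auto intro: J)
      then show ?thesis using gL D(2)[of "J + j"] by simp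
    qed
    have Bi: "almost_inv (B j)" for j unfolding B_def using D Li by (intro almost_inv_symdiff)
    have "k - 1 < k" using gB[of 0] by simp
    then obtain r2 i where r2: "strict_mono (r2 :: nat \<Rightarrow> nat)" and
      i: "\<And>u. u \<in> carrier G \<Longrightarrow>
        \<forall>\<^sub>F j in sequentially. card (bdry u (B (J + i))) \<le> card (bdry u (B (J + r2 j)))"
      using less.IH[of "k - 1" "\<lambda>j. B (J + j)"] Bi gB by (metis Suc_diff_1 less_Suc_eq_le not_less_zero neq0_conv)
    let ?r = "\<lambda>j. J + r2 j"
    have mr: "strict_mono ?r" using r2 by (simp add: strict_mono_def)
    have "\<forall>\<^sub>F j in sequentially. card (bdry u (A (r0 (r1 (J + i))))) \<le> card (bdry u (A (r0 (r1 (?r j)))))"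
      if u: "u \<in> carrier G" for u
    proof -
      have "\<forall>\<^sub>F j in sequentially. card (bdry u (D (?r j))) = card (bdry u L) + card (bdry u (B (?r j)))"
        using evB[OF u] mr by (rule eventually_subseq[rotated])
      \<comment> \<open>The threshold in \<open>evB\<close> depends on \<open>u\<close>, so the
        equality serves for the moving index. At the fixed index \<open>J + i\<close> subadditivity
        gives an inequality in the right direction.\<close>
      with i[OF u] have "\<forall>\<^sub>F j in sequentially. card (bdry u (D (J + i))) \<le> card (bdry u (D (?r j)))"
      proof eventually_elim
        case (elim j)
        have "D (J + i) = (B (J + i) - L) \<union> (L - B (J + i))" by (auto simp: B_def)
        then have "bdry u (D (J + i)) \<subseteq> bdry u L \<union> bdry u (B (J + i))" by (auto simp: bdry_symdiff)
        then have "card (bdry u (D (J + i))) \<le> card (bdry u L \<union> bdry u (B (J + i)))"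
          using finite_bdry[OF u] Li Bi by (intro card_mono) auto
        also have "\<dots> \<le> card (bdry u L) + card (bdry u (B (J + i)))" by (rule card_Un_le)
        finally show ?case using elim by simp
      qed
      then show ?thesis using cA'[OF u] by (simp add: D_def)
    qed
    moreover have "strict_mono (\<lambda>j. r0 (r1 (?r j)))"
      using r0(1) r1 mr by (simp add: strict_mono_def)
    ultimately show ?thesis by (intro exI[of _ "\<lambda>j. r0 (r1 (?r j))"] exI[of _ "r0 (r1 (J + i))"]) blast
  qed
qed

section \<open>The energy of an almost invariant set\<close>

definition blen where
  "blen u = (SOME L. \<forall>A. almost_inv A \<longrightarrow> finite (bdry u A) \<and> card (bdry u A) \<le> L * gbdry A)"

text \<open>Division by \<open>1 + blen u\<close> brings each count below \<open>gbdry A\<close>, so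
  the series is dominated by a geometric one; the summand 1 excludes division by zero. For a finite
  carrier the enumeration repeats elements, which only alters weights: every group element still has
  a positive one.\<close>

definition wbdry :: "nat \<Rightarrow> 'a set \<Rightarrow> real" where
  "wbdry i A = (1 / 2) ^ i * (real (card (bdry (from_nat_into (carrier G) i) A)) /
     (1 + real (blen (from_nat_into (carrier G) i))))"

definition energy :: "'a set \<Rightarrow> real" where "energy A = (\<Sum>i. wbdry i A)"

lemma blen: "u \<in> carrier G \<Longrightarrow> almost_inv A \<Longrightarrow> card (bdry u A) \<le> blen u * gbdry A"
  using someI_ex[OF bdry_bound[of u], folded blen_def] by blast

lemma enum_mem: "from_nat_into (carrier G) i \<in> carrier G"
  using one_closed by (intro from_nat_into) auto

lemma wbdry_nonneg: "0 \<le> wbdry i A" by (simp add: wbdry_def)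

lemma wbdry_le:
  assumes "almost_inv A"
  shows "wbdry i A \<le> (1 / 2) ^ i * real (gbdry A)"
proof -
  let ?u = "from_nat_into (carrier G) i"
  have "real (card (bdry ?u A)) \<le> real (blen ?u) * real (gbdry A)"
    using blen[OF enum_mem assms] by (metis of_nat_le_iff of_nat_mult)
  also have "\<dots> \<le> (1 + real (blen ?u)) * real (gbdry A)" by (intro mult_right_mono) auto
  finally have "real (card (bdry ?u A)) / (1 + real (blen ?u)) \<le> real (gbdry A)"
    by (simp add: divide_le_eq mult.commute)
  then show ?thesis unfolding wbdry_def by (intro mult_left_mono) auto
qed

lemma summable_wbdry:
  assumes "almost_inv A"
  shows "summable (\<lambda>i. wbdry i A)"
proof (rule summable_comparison_test')
  show "summable (\<lambda>i. (1 / 2 :: real) ^ i * real (gbdry A))" by (intro summable_mult2 summable_geometric) auto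
  show "norm (wbdry i A) \<le> (1 / 2) ^ i * real (gbdry A)" if "i \<ge> 0" for i
    using wbdry_le[OF assms] wbdry_nonneg by simp
qed

lemma energy_compl: "A \<subseteq> carrier G \<Longrightarrow> energy (carrier G - A) = energy A"
proof -
  have "bdry u (carrier G - A) = bdry u A" if "u \<in> carrier G" for u
    using that by (auto simp: bdry_def)
  then show ?thesis using enum_mem by (simp add: energy_def wbdry_def)
qed

lemma energy_lmul: "\<lbrakk>g \<in> carrier G; A \<subseteq> carrier G\<rbrakk> \<Longrightarrow> energy (lmul g A) = energy A"
  using enum_mem by (simp add: energy_def wbdry_def card_bdry_lmul)

lemma almost_inv_Int_Un:
  assumes "almost_inv A" "almost_inv B"
  shows "almost_inv (A \<inter> B)" "almost_inv (A \<union> B)"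
proof -
  have "bdry u (A \<inter> B) \<subseteq> bdry u A \<union> bdry u B" "bdry u (A \<union> B) \<subseteq> bdry u A \<union> bdry u B" for u
    by (auto simp: bdry_def)
  then have "finite (bdry u (A \<inter> B))" "finite (bdry u (A \<union> B))"
    if "finite (bdry u A)" "finite (bdry u B)" for u
    using that by (meson finite_UnI finite_subset)+
  then show "almost_inv (A \<inter> B)" "almost_inv (A \<union> B)"
    using assms by (auto simp: almost_inv_def dest: finite_subset)
qed

text \<open>Edge by edge: what the meet or the join cuts is cut by A or by B, and what both cut is
  cut by A and by B. An edge from A - B to B - A is cut by A and B but by neither the meet nor the
  join, which gives strictness.\<close>

lemma card_bdry_submodular:
  assumes A: "almost_inv A" and B: "almost_inv B" and u: "u \<in> carrier G"
  shows "card (bdry u (A \<inter> B)) + card (bdry u (A \<union> B)) \<le> card (bdry u A) + card (bdry u B)"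
    and "\<lbrakk>x \<in> A - B; x \<otimes> u \<in> B - A\<rbrakk> \<Longrightarrow>
      card (bdry u (A \<inter> B)) + card (bdry u (A \<union> B)) < card (bdry u A) + card (bdry u B)"
proof -
  let ?P = "bdry u (A \<inter> B)" and ?Q = "bdry u (A \<union> B)" and ?a = "bdry u A" and ?b = "bdry u B"
  have f: "finite ?a" "finite ?b" "finite ?P" "finite ?Q"
    using finite_bdry[OF u] A B almost_inv_Int_Un[OF A B] by auto
  have e: "card ?P + card ?Q = card (?P \<union> ?Q) + card (?P \<inter> ?Q)"
    "card ?a + card ?b = card (?a \<union> ?b) + card (?a \<inter> ?b)"
    using card_Un_Int f by blast+
  have s: "?P \<union> ?Q \<subseteq> ?a \<union> ?b" "?P \<inter> ?Q \<subseteq> ?a \<inter> ?b" by (auto simp: bdry_def)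
  have c: "card (?P \<union> ?Q) \<le> card (?a \<union> ?b)" "card (?P \<inter> ?Q) \<le> card (?a \<inter> ?b)"
    using s f by (auto intro: card_mono)
  show "card ?P + card ?Q \<le> card ?a + card ?b" using e c by simp
  assume x: "x \<in> A - B" "x \<otimes> u \<in> B - A"
  then have "x \<in> carrier G" using A by (auto simp: almost_inv_def)
  then have "x \<in> (?a \<union> ?b) - (?P \<union> ?Q)" using x by (auto simp: bdry_def)
  then have "card (?P \<union> ?Q) < card (?a \<union> ?b)" using s f by (intro psubset_card_mono) auto
  then show "card ?P + card ?Q < card ?a + card ?b" using e c by simp
qed

lemma energy_submodular:
  assumes A: "almost_inv A" and B: "almost_inv B" and n: "\<not> A \<subseteq> B" "\<not> B \<subseteq> A"
  shows "energy (A \<inter> B) + energy (A \<union> B) < energy A + energy B"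
proof -
  obtain a b where ab: "a \<in> A - B" "b \<in> B - A" using n by blast
  have abG: "a \<in> carrier G" "b \<in> carrier G" using ab A B by (auto simp: almost_inv_def)
  \<comment> \<open>This element labels the edge from \<open>a\<close> to \<open>b\<close>, so its
    term in the series is strict.\<close>
  have "inv a \<otimes> b \<in> carrier G" using abG by simp
  then obtain k where k: "from_nat_into (carrier G) k = inv a \<otimes> b"
    using from_nat_into_surj[OF countable_carrier] by blast
  have ak: "a \<otimes> from_nat_into (carrier G) k = b" using k abG by (simp flip: m_assoc)
  let ?d = "\<lambda>i. (wbdry i A + wbdry i B) - (wbdry i (A \<inter> B) + wbdry i (A \<union> B))"
  let ?n = "\<lambda>i C. real (card (bdry (from_nat_into (carrier G) i) C))"
  have d: "?d i = (1 / 2) ^ i * ((?n i A + ?n i B - (?n i (A \<inter> B) + ?n i (A \<union> B))) /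
      (1 + real (blen (from_nat_into (carrier G) i))))" for i
    by (simp add: wbdry_def add_divide_distrib diff_divide_distrib algebra_simps)
  have "?n i (A \<inter> B) + ?n i (A \<union> B) \<le> ?n i A + ?n i B" for i
    using card_bdry_submodular(1)[OF A B enum_mem] by (metis of_nat_add of_nat_le_iff)
  then have "0 \<le> ?d i" for i unfolding d by simp
  moreover have "?n k (A \<inter> B) + ?n k (A \<union> B) < ?n k A + ?n k B"
    using card_bdry_submodular(2)[OF A B enum_mem, of a k] ab ak by (metis of_nat_add of_nat_less_iff)
  then have "0 < ?d k" unfolding d by (simp add: add_pos_nonneg)
  moreover have sm: "summable (\<lambda>i. wbdry i A)" "summable (\<lambda>i. wbdry i B)"
    "summable (\<lambda>i. wbdry i (A \<inter> B))" "summable (\<lambda>i. wbdry i (A \<union> B))"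
    using summable_wbdry A B almost_inv_Int_Un[OF A B] by auto
  then have "summable ?d" by (intro summable_diff summable_add)
  ultimately have "0 < (\<Sum>i. ?d i)" by (rule suminf_pos2[rotated 1]) 
  also have "(\<Sum>i. ?d i) = energy A + energy B - (energy (A \<inter> B) + energy (A \<union> B))"
    unfolding energy_def using sm by (simp add: suminf_diff suminf_add summable_add)
  finally show ?thesis by simp
qed

text \<open>Bounded energy bounds the counts for the generators, hence \<open>gbdry\<close>.
  Semicontinuity then yields an index \<open>i\<close> whose counts are eventually at most those
  along a subsequence, and summation gives \<open>A i\<close> at most the energy of
  \<open>A (Suc i)\<close>.\<close>

lemma energy_no_descent:
  assumes A: "\<And>i::nat. almost_inv (A i)"
  shows "\<not> (\<forall>i. energy (A (Suc i)) < energy (A i))"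
proof
  assume d: "\<forall>i. energy (A (Suc i)) < energy (A i)"
  have anti: "energy (A j) \<le> energy (A i)" if "i \<le> j" for i j
    using that by (induction rule: dec_induct) (use d in \<open>auto intro: order_trans less_imp_le\<close>)
  have we: "wbdry k B \<le> energy B" if "almost_inv B" for k B
    using sum_le_suminf[OF summable_wbdry[OF that], of "{k}"] wbdry_nonneg by (simp add: energy_def)
  have "\<exists>k. \<forall>i. card (bdry s (A i)) \<le> k" if "s \<in> S" for s
  proof -
    have sG: "s \<in> carrier G" using that S_sub by blast
    then obtain m where m: "from_nat_into (carrier G) m = s"
      using from_nat_into_surj[OF countable_carrier] by blast
    let ?c = "(1 / 2) ^ m / (1 + real (blen s))"
    have c: "?c > 0" by (simp add: add_pos_nonneg)
    have "?c * real (card (bdry s (A i))) \<le> energy (A 0)" for i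
      using we[OF A[of i], of m] anti[of 0 i] by (simp add: wbdry_def m)
    then have "real (card (bdry s (A i))) \<le> energy (A 0) / ?c" for i
      using c by (subst pos_le_divide_eq) (auto simp: mult.commute)
    then have "card (bdry s (A i)) \<le> nat \<lceil>energy (A 0) / ?c\<rceil>" for i
      by (meson le_nat_floor nat_ceiling_le_eq of_nat_le_iff real_nat_ceiling_ge order_trans)
    then show ?thesis by blast
  qed
  then obtain K where K: "\<And>s i. s \<in> S \<Longrightarrow> card (bdry s (A i)) \<le> K s" by metis
  have "gbdry (A i) \<le> sum K S" for i unfolding gbdry_def by (intro sum_mono K)
  then obtain r i where r: "strict_mono (r :: nat \<Rightarrow> nat)" and i': "\<forall>u\<in>carrier G.
    \<forall>\<^sub>F j in sequentially. card (bdry u (A i)) \<le> card (bdry u (A (r j)))"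
    using bdry_lower_semicontinuous[of A "sum K S"] A by auto
  note i = bspec[OF i']
  have "energy (A i) \<le> energy (A (Suc i))"
    unfolding energy_def[of "A i"]
  proof (rule suminf_le_const[OF summable_wbdry[OF A]])
    \<comment> \<open>The threshold in semicontinuity depends on the label, so a single
      \<open>j\<close> serves finitely many terms; bounding partial sums is enough for the
      series.\<close>
    fix n
    have "\<forall>\<^sub>F j in sequentially. \<forall>m\<in>{..<n}. wbdry m (A i) \<le> wbdry m (A (r j))"
    proof (intro eventually_ball_finite ballI)
      fix m
      show "\<forall>\<^sub>F j in sequentially. wbdry m (A i) \<le> wbdry m (A (r j))"
        using i[OF enum_mem[of m]] by eventually_elim (auto simp: wbdry_def intro!: mult_left_mono divide_right_mono)
    qed auto
    moreover have "\<forall>\<^sub>F j in sequentially. j \<ge> Suc i" by (rule eventually_ge_at_top)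
    ultimately have "\<forall>\<^sub>F j in sequentially. (\<forall>m\<in>{..<n}. wbdry m (A i) \<le> wbdry m (A (r j))) \<and> j \<ge> Suc i"
      by (rule eventually_conj)
    then obtain j where j: "\<And>m. m < n \<Longrightarrow> wbdry m (A i) \<le> wbdry m (A (r j))" "Suc i \<le> j"
      using eventually_happens'[OF sequentially_bot] by blast
    have "(\<Sum>m<n. wbdry m (A i)) \<le> (\<Sum>m<n. wbdry m (A (r j)))" using j by (intro sum_mono) auto
    also have "\<dots> \<le> energy (A (r j))" unfolding energy_def
      using wbdry_nonneg by (intro sum_le_suminf summable_wbdry A) auto
    also have "\<dots> \<le> energy (A (Suc i))"
      using anti j(2) seq_suble[OF r, of j] by (meson order_trans)
    finally show "(\<Sum>m<n. wbdry m (A i)) \<le> energy (A (Suc i))" .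
  qed
  then show False using spec[OF d, of i] by linarith
qed

end

section \<open>The tree of a nested family of sets\<close>

definition sd :: "'a set \<Rightarrow> 'a set \<Rightarrow> 'a set" where "sd v w = (v - w) \<union> (w - v)"

lemma sd_trans: "sd u w \<subseteq> sd u v \<union> sd v w" by (auto simp: sd_def)

lemma finite_sd_trans: "finite (sd u v) \<Longrightarrow> finite (sd v w) \<Longrightarrow> finite (sd u w)"
  by (rule finite_subset[OF sd_trans]) auto

lemma sd_commute: "sd v w = sd w v" by (auto simp: sd_def)

locale tree_set =
  fixes X :: "'x set" and \<E> :: "'x set set"
  assumes sub: "A \<in> \<E> \<Longrightarrow> A \<subseteq> X"
    and ne: "A \<in> \<E> \<Longrightarrow> A \<noteq> {}"
    and compl: "A \<in> \<E> \<Longrightarrow> X - A \<in> \<E>"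
    and nested: "A \<in> \<E> \<Longrightarrow> B \<in> \<E> \<Longrightarrow> A \<subseteq> B \<or> B \<subseteq> A \<or> A \<inter> B = {} \<or> A \<union> B = X"
    and finite_sep: "x \<in> X \<Longrightarrow> y \<in> X \<Longrightarrow> finite {A \<in> \<E>. x \<in> A \<and> y \<notin> A}"
    and X_ne: "X \<noteq> {}"
begin

lemma sub_compl: "A \<in> \<E> \<Longrightarrow> X - (X - A) = A" using sub by blast

text \<open>
  Vertices are up-sets. The pair \<open>{A, X - A}\<close> has a midpoint \<open>up A = up (X - A)\<close>, which is joined
  to \<open>insert A (up A)\<close> and to \<open>insert (X - A) (up A)\<close>: subdividing edges in this way allows for
  group elements that exchange \<open>A\<close> and \<open>X - A\<close>.
\<close>

definition up where "up A = {B \<in> \<E>. A \<subset> B \<or> X - A \<subset> B}"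

text \<open>Ordinary vertices pick exactly one of A and X - A for every A. The last clause admits in
  addition only the midpoints, at which a single pair is undecided.\<close>

definition orientation where
  "orientation v \<longleftrightarrow> v \<subseteq> \<E> \<and> (\<forall>A\<in>v. \<forall>B\<in>\<E>. A \<subseteq> B \<longrightarrow> B \<in> v) \<and> (\<forall>A\<in>v. X - A \<notin> v) \<and>
    (\<forall>A\<in>\<E>. A \<notin> v \<and> X - A \<notin> v \<longrightarrow> v = up A)"

definition principal where "principal x = {A \<in> \<E>. x \<in> A}"

text \<open>The finiteness condition singles out the orientations at finite distance from the
  principal ones, distance being the size of \<open>sd\<close>; this makes the graph
  connected.\<close>

definition VT where "VT = {v. orientation v \<and> (\<forall>x\<in>X. finite (sd v (principal x)))}"

lemma orientationD:
  assumes "orientation v"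
  shows "A \<in> v \<Longrightarrow> A \<in> \<E>" "A \<in> v \<Longrightarrow> B \<in> \<E> \<Longrightarrow> A \<subseteq> B \<Longrightarrow> B \<in> v" "A \<in> v \<Longrightarrow> X - A \<notin> v"
    "A \<in> \<E> \<Longrightarrow> A \<notin> v \<Longrightarrow> X - A \<notin> v \<Longrightarrow> v = up A"
  using assms unfolding orientation_def by blast+

lemma VT_orientation: "v \<in> VT \<Longrightarrow> orientation v" by (simp add: VT_def)

lemma up_compl: "A \<in> \<E> \<Longrightarrow> up (X - A) = up A" unfolding up_def by (auto simp: sub_compl)

lemma not_mem_up: "A \<in> \<E> \<Longrightarrow> A \<notin> up A" "A \<in> \<E> \<Longrightarrow> X - A \<notin> up A"
proof -
  show *: "A \<notin> up A" if "A \<in> \<E>" for A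
    using ne[OF compl[OF that]] sub[OF that] unfolding up_def by blast
  show "A \<in> \<E> \<Longrightarrow> X - A \<notin> up A" using *[OF compl] up_compl by simp
qed

text \<open>Any other pair is nested with {A, X - A}, so one of its members properly contains A or X
  - A.\<close>

lemma up_undecided:
  assumes A: "A \<in> \<E>" and B: "B \<in> \<E>" "B \<notin> up A" "X - B \<notin> up A"
  shows "B = A \<or> B = X - A"
proof -
  have n: "\<not> A \<subset> B" "\<not> X - A \<subset> B" "\<not> A \<subset> X - B" "\<not> X - A \<subset> X - B"
    using B compl[OF B(1)] unfolding up_def by auto
  show ?thesis using nested[OF A B(1)] n sub[OF A] sub[OF B(1)] by blast
qed

lemma up_consistent:
  assumes A: "A \<in> \<E>" and B: "B \<in> up A"
  shows "X - B \<notin> up A"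
proof
  assume "X - B \<in> up A"
  then have "A \<subset> X - B \<or> X - A \<subset> X - B" by (simp add: up_def)
  moreover have "A \<subset> B \<or> X - A \<subset> B" "B \<subseteq> X" using B sub by (auto simp: up_def)
  moreover have "A \<subseteq> X" "A \<noteq> {}" "X - A \<noteq> {}" using ne[OF A] ne[OF compl[OF A]] sub[OF A] by blast+
  ultimately show False by blast
qed

lemma orientation_up:
  assumes A: "A \<in> \<E>"
  shows "orientation (up A)"
  unfolding orientation_def
proof (intro conjI ballI impI)
  show "up A \<subseteq> \<E>" by (auto simp: up_def)
  show "C \<in> up A" if "B \<in> up A" "C \<in> \<E>" "B \<subseteq> C" for B C using that unfolding up_def by blast
  show "X - B \<notin> up A" if "B \<in> up A" for B using up_consistent[OF A that] .
  show "up A = up B" if "B \<in> \<E>" "B \<notin> up A \<and> X - B \<notin> up A" for B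
    using up_undecided[OF A that(1)] that(2) up_compl[OF A] by metis
qed

lemma orientation_insert_up:
  assumes A: "A \<in> \<E>"
  shows "orientation (insert A (up A))"
  unfolding orientation_def
proof (intro conjI ballI impI)
  show "insert A (up A) \<subseteq> \<E>" using A by (auto simp: up_def)
  show "C \<in> insert A (up A)" if "B \<in> insert A (up A)" "C \<in> \<E>" "B \<subseteq> C" for B C
    using that unfolding up_def by blast
  show "X - B \<notin> insert A (up A)" if B: "B \<in> insert A (up A)" for B
  proof -
    have BE: "B \<in> \<E>" using A B by (auto simp: up_def)
    have "X - A \<noteq> A" using ne[OF A] by blast
    moreover have "B \<noteq> X - A" if "B \<in> up A" using not_mem_up(2)[OF A] that by blast
    moreover have "B = X - A" if "X - B = A" using sub_compl[OF BE] that by blast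
    ultimately show ?thesis using B up_consistent[OF A] not_mem_up(2)[OF A] by blast
  qed
  show "insert A (up A) = up B" if "B \<in> \<E>" "B \<notin> insert A (up A) \<and> X - B \<notin> insert A (up A)" for B
    using up_undecided[OF A that(1)] that(2) sub_compl[OF A] by (metis insertCI)
qed

lemma finite_sd_principal: "x \<in> X \<Longrightarrow> y \<in> X \<Longrightarrow> finite (sd (principal x) (principal y))"
proof -
  have "sd (principal x) (principal y) = {A \<in> \<E>. x \<in> A \<and> y \<notin> A} \<union> {A \<in> \<E>. y \<in> A \<and> x \<notin> A}"
    by (auto simp: sd_def principal_def)
  then show "x \<in> X \<Longrightarrow> y \<in> X \<Longrightarrow> finite (sd (principal x) (principal y))" using finite_sep by auto
qed

lemma VT_I:
  assumes "orientation v" "x \<in> X" "finite (sd v (principal x))"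
  shows "v \<in> VT"
  using assms finite_sd_trans[OF assms(3) finite_sd_principal[OF assms(2)]] by (simp add: VT_def)

lemma finite_sd_VT:
  assumes "v \<in> VT" "w \<in> VT"
  shows "finite (sd v w)"
proof -
  obtain x where "x \<in> X" using X_ne by blast
  then have "finite (sd v (principal x))" "finite (sd w (principal x))" using assms by (auto simp: VT_def)
  then show ?thesis using finite_sd_trans[of v "principal x" w] by (simp add: sd_commute)
qed

lemma up_VT:
  assumes A: "A \<in> \<E>"
  shows "up A \<in> VT" "insert A (up A) \<in> VT"
proof -
  obtain x where x: "x \<in> A" using ne[OF A] by blast
  obtain y where y: "y \<in> X - A" using ne[OF compl[OF A]] by blast
  have xX: "x \<in> X" and yX: "y \<in> X" using x y sub[OF A] by auto
  \<comment> \<open>With x in A and y outside, a set on which \<open>up A\<close> and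
    \<open>principal x\<close> disagree either is one of A, X - A or separates x from y.\<close>
  have "sd (up A) (principal x) \<subseteq> {A, X - A} \<union> {B \<in> \<E>. x \<in> B \<and> y \<notin> B} \<union> {B \<in> \<E>. y \<in> B \<and> x \<notin> B}"
  proof
    fix B assume "B \<in> sd (up A) (principal x)"
    then consider "B \<in> up A" "x \<notin> B" | "B \<in> \<E>" "B \<notin> up A" "x \<in> B"
      by (auto simp: sd_def principal_def up_def)
    then show "B \<in> {A, X - A} \<union> {B \<in> \<E>. x \<in> B \<and> y \<notin> B} \<union> {B \<in> \<E>. y \<in> B \<and> x \<notin> B}"
    proof cases
      case 1
      then show ?thesis using x y by (auto simp: up_def)
    next
      case 2
      then have "\<not> A \<subset> B" "\<not> X - A \<subset> B" by (auto simp: up_def)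
      then show ?thesis using nested[OF A 2(1)] 2 x y sub[OF A] sub[OF 2(1)] by auto
    qed
  qed
  then have f: "finite (sd (up A) (principal x))"
    by (rule finite_subset) (use finite_sep xX yX in auto)
  then show "up A \<in> VT" using VT_I[OF orientation_up[OF A] xX] by blast
  have "sd (insert A (up A)) (principal x) \<subseteq> insert A (sd (up A) (principal x))" by (auto simp: sd_def)
  then have "finite (sd (insert A (up A)) (principal x))" using f by (meson finite_insert finite_subset)
  then show "insert A (up A) \<in> VT" using VT_I[OF orientation_insert_up[OF A] xX] by blast
qed

section \<open>Adjacency and geodesics in the tree\<close>

definition nb where
  "nb A v v' \<longleftrightarrow> A \<in> \<E> \<and> (v = up A \<and> v' = insert A (up A) \<or> v = insert A (up A) \<and> v' = up A)"

lemma nb_VT: "nb A v v' \<Longrightarrow> v \<in> VT \<and> v' \<in> VT" using up_VT by (auto simp: nb_def)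

lemma nb_sd: "nb A v v' \<Longrightarrow> sd v v' = {A}" using not_mem_up by (auto simp: nb_def sd_def)

text \<open>Crossing a half-edge changes the status of a single A (\<open>nb_sd\<close>), so
  shrinking \<open>sd v t\<close> means crossing an edge that separates v from t: this is the first
  step of the geodesic.\<close>

definition towards where
  "towards v t v' \<longleftrightarrow> (\<exists>A. nb A v v') \<and> sd v' t \<subset> sd v t"

lemma nb_towards_iff:
  assumes "nb A v v'"
  shows "sd v' t \<subset> sd v t \<longleftrightarrow> A \<in> sd v t" "A \<in> sd v t \<Longrightarrow> sd v' t = sd v t - {A}"
proof -
  have "B \<in> sd v v' \<longleftrightarrow> B = A" for B using nb_sd[OF assms] by simp
  then have e: "B \<in> sd v' t \<longleftrightarrow> (B \<in> sd v t \<longleftrightarrow> B \<noteq> A)" for B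
    unfolding sd_def by (cases "B = A") (blast+)
  show *: "A \<in> sd v t \<Longrightarrow> sd v' t = sd v t - {A}" by (rule Set.set_eqI) (simp add: e, blast)
  show "sd v' t \<subset> sd v t \<longleftrightarrow> A \<in> sd v t"
  proof
    assume "A \<in> sd v t"
    then show "sd v' t \<subset> sd v t" using * by auto
  next
    assume "sd v' t \<subset> sd v t"
    then show "A \<in> sd v t" using e[of A] by auto
  qed
qed

lemma towards_ex:
  assumes v: "v \<in> VT" and t: "t \<in> VT" and vt: "v \<noteq> t"
  shows "\<exists>v'. towards v t v'"
proof (cases "\<exists>C\<in>\<E>. C \<notin> v \<and> X - C \<notin> v")
  case True
  then obtain C where C: "C \<in> \<E>" "C \<notin> v" "X - C \<notin> v" by blast
  have vC: "v = up C" using orientationD(4)[OF VT_orientation[OF v] C] .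
  have "C \<in> t \<or> X - C \<in> t" using orientationD(4)[OF VT_orientation[OF t] C(1)] vC vt by blast
  then obtain D where D: "D \<in> \<E>" "v = up D" "D \<in> t"
    using C compl vC up_compl by blast
  have nb: "nb D v (insert D (up D))" using D by (simp add: nb_def)
  have "D \<in> sd v t" using D not_mem_up by (auto simp: sd_def)
  then show ?thesis using nb nb_towards_iff[OF nb] unfolding towards_def by blast
next
  case False
  note ov = orientationD[OF VT_orientation[OF v]] and ot = orientationD[OF VT_orientation[OF t]]
  \<comment> \<open>v decides every pair, so containment of v in t would force equality.\<close>
  have "v - t \<noteq> {}"
  proof
    assume "v - t = {}"
    then obtain A where A: "A \<in> t" "A \<notin> v" using vt by blast
    then have "X - A \<in> v" using False ot(1) by blast
    then show False using A ot(3) \<open>v - t = {}\<close> by blast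
  qed
  moreover have "finite (v - t)" using finite_sd_VT[OF v t] by (simp add: sd_def)
  ultimately obtain A where A: "A \<in> v - t" and min: "\<forall>B\<in>v - t. B \<subseteq> A \<longrightarrow> A = B"
    using finite_has_minimal[of "v - t"] by blast
  have AE: "A \<in> \<E>" using A ov(1) by blast
  have minv: "B = A" if "B \<in> v" "B \<subseteq> A" for B
  proof -
    have "B \<notin> t" using ot(2)[of B A] that A AE by blast
    then show ?thesis using min that by blast
  qed
  have "v = insert A (up A)"
  proof (rule Set.set_eqI)
    fix B
    show "B \<in> v \<longleftrightarrow> B \<in> insert A (up A)"
    proof
      assume B: "B \<in> v"
      have BE: "B \<in> \<E>" using B ov(1) by blast
      have "X - A \<notin> v" using ov(3) A by blast
      moreover have "X - A \<in> v" if "B \<subseteq> X - A" using ov(2)[OF B compl[OF AE]] that by blast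
      ultimately have nB: "\<not> B \<subseteq> X - A" by blast
      then have "A \<subseteq> B \<or> B \<subseteq> A \<or> X - A \<subset> B" using nested[OF AE BE] sub[OF BE] by blast
      then show "B \<in> insert A (up A)" using minv[OF B] BE by (auto simp: up_def)
    next
      assume B: "B \<in> insert A (up A)"
      show "B \<in> v"
      proof (cases "B = A \<or> A \<subset> B")
        case True
        then show ?thesis using B ov(2)[of A B] A by (auto simp: up_def)
      next
        case nAB: False
        then have BE: "B \<in> \<E>" and s: "X - A \<subset> B" using B by (auto simp: up_def)
        show ?thesis
        proof (rule ccontr)
          assume "B \<notin> v"
          then have "X - B \<in> v" using False BE by blast
          moreover have "X - B \<subset> A" using s sub[OF AE] sub[OF BE] by blast
          ultimately show False using minv by blast
        qed
      qed
    qed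
  qed
  then have nb: "nb A v (up A)" using AE by (simp add: nb_def)
  have "A \<in> sd v t" using A by (simp add: sd_def)
  then show ?thesis using nb nb_towards_iff[OF nb] unfolding towards_def by blast
qed

text \<open>At a midpoint two different candidates are complementary, and t holds at most one of
  them. At another vertex, two different removable sets A and B satisfy X - A \<subset> B; t lacks
  both, so t is \<open>up A\<close>, which contains B.\<close>

lemma towards_unique:
  assumes t: "t \<in> VT" and 1: "towards v t v1" and 2: "towards v t v2"
  shows "v1 = v2"
proof -
  note ot = orientationD[OF VT_orientation[OF t]]
  obtain A B where A: "nb A v v1" "A \<in> sd v t" and B: "nb B v v2" "B \<in> sd v t"
    using 1 2 nb_towards_iff(1) unfolding towards_def by blast
  have AE: "A \<in> \<E>" and BE: "B \<in> \<E>" using A B by (auto simp: nb_def)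
  have compl_dec: "C \<in> insert D (up D) \<or> X - C \<in> insert D (up D)" if "D \<in> \<E>" "C \<in> \<E>" for C D
    using up_undecided[OF that] sub_compl that by blast
  have mixed: False if "v = up C" "v = insert D (up D)" "C \<in> \<E>" "D \<in> \<E>" for C D
    using compl_dec[OF that(4,3)] not_mem_up[OF that(3)] that(1,2) by metis
  have "A = B"
  proof (cases "v = up A")
    case vA: True
    then have vB: "v = up B" using B mixed AE BE by (auto simp: nb_def)
    have "A \<in> t" "B \<in> t" using vA vB A(2) B(2) not_mem_up AE BE by (auto simp: sd_def)
    moreover have "B = A \<or> B = X - A" using up_undecided[OF AE BE] not_mem_up[OF BE] vA vB by simp
    ultimately show ?thesis using ot(3) by blast
  next
    case False
    then have vA: "v = insert A (up A)" using A by (auto simp: nb_def)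
    then have vB: "v = insert B (up B)" using B mixed AE BE by (auto simp: nb_def)
    have nt: "A \<notin> t" "B \<notin> t" using vA vB A(2) B(2) by (auto simp: sd_def)
    show ?thesis
    proof (rule ccontr)
      assume "A \<noteq> B"
      then have ups: "A \<in> up B" "B \<in> up A" using vA vB by auto
      then have "X - A \<subset> B"
        using ne[OF compl[OF AE]] sub[OF AE] sub[OF BE] ne[OF AE] ne[OF BE] unfolding up_def by blast
      then have "X - A \<notin> t" using ot(2)[of "X - A" B] BE nt by blast
      then have "t = up A" using ot(4)[OF AE] nt by blast
      then show False using ups nt by blast
    qed
  qed
  then show ?thesis using A B not_mem_up AE by (auto simp: nb_def)
qed

text \<open>Connectedness as an induction principle: an abstract \<open>R\<close> in place of paths
  allows an application to the images of the vertices in another graph.\<close>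

lemma VT_connected:
  assumes v: "v \<in> VT" and t: "t \<in> VT"
    and R: "\<And>u. u \<in> VT \<Longrightarrow> R u u" "\<And>u v w. R u v \<Longrightarrow> R v w \<Longrightarrow> R u w" "\<And>u v. R u v \<Longrightarrow> R v u"
      "\<And>A. A \<in> \<E> \<Longrightarrow> R (up A) (insert A (up A))"
  shows "R v t"
  using v
proof (induction "card (sd v t)" arbitrary: v rule: less_induct)
  case less
  show ?case
  proof (cases "v = t")
    case True
    then show ?thesis using R(1)[OF t] by simp
  next
    case False
    then obtain v' A where v': "nb A v v'" "sd v' t \<subset> sd v t"
      using towards_ex[OF less.prems t] unfolding towards_def by blast
    have "card (sd v' t) < card (sd v t)"
      by (rule psubset_card_mono[OF finite_sd_VT[OF less.prems t] v'(2)])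
    then have 1: "R v' t" using less.hyps nb_VT[OF v'(1)] by blast
    have "R v v'" using v'(1) R(4)[of A] R(3)[OF R(4)[of A]] unfolding nb_def by blast
    then show ?thesis using 1 by (rule R(2))
  qed
qed

text \<open>
  The number of members of \<open>\<E>\<close> between a point and \<open>A\<close>, counted with sign; summed over a finite set
  \<open>H\<close> of points it is strictly monotone in \<open>A\<close>, so its sign is an orientation, the centre of \<open>H\<close>.
\<close>

definition depth :: "'x \<Rightarrow> 'x set \<Rightarrow> int" where
  "depth x A = int (card {B \<in> \<E>. x \<in> B \<and> B \<subseteq> A}) - int (card {B \<in> \<E>. x \<in> B \<and> B \<subseteq> X - A})"

lemma finite_below:
  assumes x: "x \<in> X" and A: "A \<in> \<E>"
  shows "finite {B \<in> \<E>. x \<in> B \<and> B \<subseteq> A}"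
proof -
  obtain y where y: "y \<in> X - A" using ne[OF compl[OF A]] by blast
  have "{B \<in> \<E>. x \<in> B \<and> B \<subseteq> A} \<subseteq> {B \<in> \<E>. x \<in> B \<and> y \<notin> B}" using y by blast
  then show ?thesis using finite_sep[OF x, of y] y by (auto intro: finite_subset)
qed

lemma depth_compl: "A \<in> \<E> \<Longrightarrow> depth x (X - A) = - depth x A"
  by (simp add: depth_def sub_compl)

text \<open>Strictness is witnessed by B itself if x lies in B, and otherwise by X - A, which
  contains x and is counted below X - A but not below X - B.\<close>

lemma depth_less:
  assumes x: "x \<in> X" and A: "A \<in> \<E>" and B: "B \<in> \<E>" and s: "A \<subset> B"
  shows "depth x A < depth x B"
proof -
  let ?f = "\<lambda>A. {C \<in> \<E>. x \<in> C \<and> C \<subseteq> A}"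
  have f: "finite (?f B)" "finite (?f (X - A))" using finite_below x A B compl by auto
  have m: "?f A \<subseteq> ?f B" "?f (X - B) \<subseteq> ?f (X - A)" using s by auto
  have c: "card (?f A) \<le> card (?f B)" "card (?f (X - B)) \<le> card (?f (X - A))"
    using m f by (auto intro: card_mono)
  show ?thesis
  proof (cases "x \<in> B")
    case True
    then have "?f A \<subset> ?f B" using m(1) s B by blast
    then have "card (?f A) < card (?f B)" using f by (intro psubset_card_mono)
    then show ?thesis using c by (simp add: depth_def)
  next
    case False
    have "X - A \<in> ?f (X - A)" using False s x compl[OF A] by auto
    moreover have "X - A \<notin> ?f (X - B)" using s sub[OF B] by auto
    ultimately have "?f (X - B) \<noteq> ?f (X - A)" by (metis (no_types))
    then have "?f (X - B) \<subset> ?f (X - A)" using m(2) by (intro psubsetI)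
    then have "card (?f (X - B)) < card (?f (X - A))" using f by (intro psubset_card_mono)
    then show ?thesis using c by (simp add: depth_def)
  qed
qed

lemma depth_pos:
  assumes x: "x \<in> A" and A: "A \<in> \<E>"
  shows "depth x A > 0"
proof -
  have xX: "x \<in> X" using x sub[OF A] by blast
  have e: "{B \<in> \<E>. x \<in> B \<and> B \<subseteq> X - A} = {}" using x by blast
  have "card {B \<in> \<E>. x \<in> B \<and> B \<subseteq> A} > 0"
    using finite_below[OF xX A] x A by (auto simp: card_gt_0_iff)
  then show ?thesis unfolding depth_def e by simp
qed

definition centre where "centre H = {A \<in> \<E>. (\<Sum>x\<in>H. depth x A) > 0}"

lemma centre_VT:
  assumes H: "finite H" "H \<noteq> {}" "H \<subseteq> X"
  shows "centre H \<in> VT"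
proof -
  define \<sigma> where "\<sigma> A = (\<Sum>x\<in>H. depth x A)" for A
  have odd: "\<sigma> (X - A) = - \<sigma> A" if "A \<in> \<E>" for A
    using that by (simp add: \<sigma>_def depth_compl sum_negf)
  have mono: "\<sigma> A < \<sigma> B" if "A \<in> \<E>" "B \<in> \<E>" "A \<subset> B" for A B
    unfolding \<sigma>_def using H that by (intro sum_strict_mono) (auto intro: depth_less)
  have pos: "\<sigma> A > 0" if "A \<in> \<E>" "H \<subseteq> A" for A
    unfolding \<sigma>_def using H that by (intro sum_pos) (auto intro: depth_pos)
  have c: "A \<in> centre H \<longleftrightarrow> A \<in> \<E> \<and> \<sigma> A > 0" for A by (simp add: centre_def \<sigma>_def)
  obtain x where x: "x \<in> H" using H by blast
  have "orientation (centre H)"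
    unfolding orientation_def
  proof (intro conjI ballI impI)
    show "centre H \<subseteq> \<E>" by (auto simp: centre_def)
    show "B \<in> centre H" if "A \<in> centre H" "B \<in> \<E>" "A \<subseteq> B" for A B
    proof -
      have "A \<in> \<E>" "A = B \<or> A \<subset> B" using that by (auto simp: c)
      then have "\<sigma> A \<le> \<sigma> B" using mono[of A B] that(2) by (metis less_imp_le order_refl)
      then show ?thesis using that by (simp add: c)
    qed
    show "X - A \<notin> centre H" if "A \<in> centre H" for A
    proof -
      have "\<sigma> (X - A) = - \<sigma> A" "\<sigma> A > 0" using that odd[of A] by (simp_all add: c)
      then show ?thesis by (simp add: c)
    qed
    fix A assume A: "A \<in> \<E>" and "A \<notin> centre H \<and> X - A \<notin> centre H"
    then have "\<not> \<sigma> A > 0" "\<not> \<sigma> (X - A) > 0" using A compl[OF A] by (simp_all add: c)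
    \<comment> \<open>The value 0 makes the centre the midpoint of {A, X - A}: strict monotonicity
      gives a positive sum to every set properly above A or X - A, and nestedness leaves no further
      positive sets.\<close>
    then have 0: "\<sigma> A = 0" "\<sigma> (X - A) = 0" using odd[OF A] by simp_all
    show "centre H = up A"
    proof (rule Set.set_eqI)
      fix B
      show "B \<in> centre H \<longleftrightarrow> B \<in> up A"
      proof
        assume B: "B \<in> centre H"
        then have BE: "B \<in> \<E>" and Bp: "\<sigma> B > 0" by (auto simp: c)
        have "B \<noteq> A" "B \<noteq> X - A" "\<not> B \<subset> A" "\<not> B \<subset> X - A"
          using Bp 0 mono[OF BE A] mono[OF BE compl[OF A]] by auto
        then show "B \<in> up A" using nested[OF A BE] BE sub[OF A] sub[OF BE] unfolding up_def by blast
      next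
        assume "B \<in> up A"
        then show "B \<in> centre H" using mono[OF A, of B] mono[OF compl[OF A], of B] 0 by (auto simp: up_def c)
      qed
    qed
  qed
  \<comment> \<open>If all of H lies on one side of A, \<open>pos\<close> fixes the sign in
    accordance with \<open>principal x\<close>. A disagreement therefore separates x from another
    point of H.\<close>
  moreover have "finite (sd (centre H) (principal x))"
  proof (rule finite_subset)
    show "finite (\<Union>y\<in>H. {A \<in> \<E>. x \<in> A \<and> y \<notin> A} \<union> {A \<in> \<E>. y \<in> A \<and> x \<notin> A})"
      using H x finite_sep by (intro finite_UN_I) auto
    show "sd (centre H) (principal x) \<subseteq> (\<Union>y\<in>H. {A \<in> \<E>. x \<in> A \<and> y \<notin> A} \<union> {A \<in> \<E>. y \<in> A \<and> x \<notin> A})"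
    proof
      fix A assume "A \<in> sd (centre H) (principal x)"
      then consider "A \<in> \<E>" "\<sigma> A > 0" "x \<notin> A" | "A \<in> \<E>" "\<not> \<sigma> A > 0" "x \<in> A"
        by (auto simp: sd_def principal_def c)
      then show "A \<in> (\<Union>y\<in>H. {A \<in> \<E>. x \<in> A \<and> y \<notin> A} \<union> {A \<in> \<E>. y \<in> A \<and> x \<notin> A})"
      proof cases
        case 1
        then have "\<not> \<sigma> (X - A) > 0" using odd[OF 1(1)] by simp
        then have "\<not> H \<subseteq> X - A" using pos[OF compl[OF 1(1)]] by blast
        then show ?thesis using 1 H by auto
      next
        case 2
        then have "\<not> H \<subseteq> A" using pos by blast
        then show ?thesis using 2 by auto
      qed
    qed
  qed
  ultimately show ?thesis using VT_I x H by blast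
qed

end

section \<open>Automorphisms of a nested family\<close>

locale tree_set_auto = tree_set +
  fixes p :: "'a \<Rightarrow> 'a"
  assumes bij: "bij_betw p X X" and image: "image p ` \<E> = \<E>"
begin

lemma p_inj: "inj_on p X" using bij by (rule bij_betw_imp_inj_on)

lemma image_mem: "A \<in> \<E> \<Longrightarrow> p ` A \<in> \<E>" using image by blast

lemma image_compl: "A \<subseteq> X \<Longrightarrow> p ` (X - A) = X - p ` A"
  using inj_on_image_set_diff[OF p_inj, of X A] bij by (simp add: bij_betw_def)

lemma image_subset_iff:
  assumes "A \<subseteq> X" "B \<subseteq> X"
  shows "p ` A \<subseteq> p ` B \<longleftrightarrow> A \<subseteq> B"
proof
  assume *: "p ` A \<subseteq> p ` B"
  show "A \<subseteq> B"
  proof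
    fix x assume x: "x \<in> A"
    then have "p x \<in> p ` B" using * by blast
    then show "x \<in> B" using inj_on_image_mem_iff[OF p_inj] x assms by blast
  qed
qed (rule image_mono)

lemma image_psubset: "A \<subseteq> X \<Longrightarrow> B \<subseteq> X \<Longrightarrow> p ` A \<subset> p ` B \<longleftrightarrow> A \<subset> B"
  using image_subset_iff by (simp add: psubset_eq inj_on_image_eq_iff[OF p_inj])

lemma image_inj: "inj_on (image p) \<E>"
proof (rule inj_onI)
  fix A B assume "A \<in> \<E>" "B \<in> \<E>" "p ` A = p ` B"
  then show "A = B" using inj_on_image_eq_iff[OF p_inj sub sub] by blast
qed

lemma image_Collect:
  assumes "\<And>B. B \<in> \<E> \<Longrightarrow> Q (p ` B) \<longleftrightarrow> P B"
  shows "image p ` {B \<in> \<E>. P B} = {B \<in> \<E>. Q B}"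
proof (intro equalityI subsetI)
  fix C assume "C \<in> {B \<in> \<E>. Q B}"
  then have "C \<in> \<E>" "Q C" by auto
  then obtain B where "B \<in> \<E>" "C = p ` B" using image by blast
  then show "C \<in> image p ` {B \<in> \<E>. P B}" using assms \<open>Q C\<close> by blast
qed (use assms image_mem in auto)

lemma image_up: "A \<in> \<E> \<Longrightarrow> image p ` up A = up (p ` A)"
  unfolding up_def
  by (rule image_Collect) (simp add: image_psubset sub flip: image_compl)

lemma p_mem: "x \<in> X \<Longrightarrow> p x \<in> X" using bij by (auto simp: bij_betw_def)

lemma p_mem_iff: "x \<in> X \<Longrightarrow> A \<subseteq> X \<Longrightarrow> p x \<in> p ` A \<longleftrightarrow> x \<in> A"
  using p_inj by (meson inj_on_image_mem_iff)

lemma image_principal: "x \<in> X \<Longrightarrow> image p ` principal x = principal (p x)"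
  unfolding principal_def by (rule image_Collect) (simp add: p_mem_iff sub)

lemma sd_image: "v \<subseteq> \<E> \<Longrightarrow> w \<subseteq> \<E> \<Longrightarrow> sd (image p ` v) (image p ` w) = image p ` sd v w"
  using inj_on_image_set_diff[OF image_inj, of v w] inj_on_image_set_diff[OF image_inj, of w v]
  by (simp add: sd_def image_Un subset_iff)

lemma image_orientation:
  assumes v: "orientation v"
  shows "orientation (image p ` v)"
proof -
  note o = orientationD[OF v]
  have vE: "v \<subseteq> \<E>" using o(1) by blast
  have mem: "p ` A \<in> image p ` v \<longleftrightarrow> A \<in> v" if "A \<in> \<E>" for A
    using inj_on_image_mem_iff[OF image_inj that vE] .
  have all: "\<forall>A\<in>\<E>. P A" if "\<And>A. A \<in> \<E> \<Longrightarrow> P (p ` A)" for P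
  proof
    fix B assume "B \<in> \<E>"
    then obtain A where "A \<in> \<E>" "B = p ` A" using image by blast
    then show "P B" using that by simp
  qed
  have s: "p ` A \<subseteq> p ` B \<longleftrightarrow> A \<subseteq> B" if "A \<in> \<E>" "B \<in> \<E>" for A B
    using image_subset_iff[OF sub sub] that by simp
  show ?thesis
    unfolding orientation_def
  proof (intro conjI)
    show "image p ` v \<subseteq> \<E>" using vE image_mem by blast
    have "\<forall>B\<in>\<E>. p ` A \<subseteq> B \<longrightarrow> B \<in> image p ` v" if A: "A \<in> v" for A
    proof (rule all, rule impI)
      fix B assume B: "B \<in> \<E>" "p ` A \<subseteq> p ` B"
      then have "A \<subseteq> B" using s vE A by blast
      then have "B \<in> v" using o(2) B A by blast
      then show "p ` B \<in> image p ` v" by blast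
    qed
    then show "\<forall>A\<in>image p ` v. \<forall>B\<in>\<E>. A \<subseteq> B \<longrightarrow> B \<in> image p ` v"
      by auto
    have "X - p ` A \<notin> image p ` v" if "A \<in> v" for A
    proof -
      have "A \<in> \<E>" using that vE by blast
      then show ?thesis using o(3)[OF that] mem[OF compl] image_compl[OF sub] by simp
    qed
    then show "\<forall>A\<in>image p ` v. X - A \<notin> image p ` v"
      by auto
    have "p ` A \<notin> image p ` v \<and> X - p ` A \<notin> image p ` v \<longrightarrow> image p ` v = up (p ` A)" if "A \<in> \<E>" for A
      using o(4)[OF that] image_up[OF that] mem[OF that] mem[OF compl[OF that]] image_compl[OF sub[OF that]]
      by metis
    then show "\<forall>A\<in>\<E>. A \<notin> image p ` v \<and> X - A \<notin> image p ` v \<longrightarrow> image p ` v = up A"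
      by (rule all)
  qed
qed

lemma image_VT:
  assumes "v \<in> VT"
  shows "image p ` v \<in> VT"
proof -
  obtain x where x: "x \<in> X" using X_ne by blast
  have o: "orientation v" "finite (sd v (principal x))" using assms x by (auto simp: VT_def)
  have "sd (image p ` v) (principal (p x)) = image p ` sd v (principal x)"
    using sd_image[of v "principal x"] orientationD(1)[OF o(1)] image_principal[OF x] by (auto simp: principal_def)
  then show ?thesis using VT_I[OF image_orientation[OF o(1)] p_mem[OF x]] o(2) by simp
qed

lemma image_nb:
  assumes "nb A v v'"
  shows "nb (p ` A) (image p ` v) (image p ` v')"
  using assms image_up image_mem unfolding nb_def by auto

lemma image_towards:
  assumes "towards v t v'" "t \<in> VT"
  shows "towards (image p ` v) (image p ` t) (image p ` v')"
proof -
  obtain A where A: "nb A v v'" "sd v' t \<subset> sd v t" using assms by (auto simp: towards_def)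
  have s: "v \<subseteq> \<E>" "v' \<subseteq> \<E>" "t \<subseteq> \<E>"
    using nb_VT[OF A(1)] assms(2) VT_orientation orientationD(1) by blast+
  have "sd v t \<subseteq> \<E>" using s by (auto simp: sd_def)
  then have "image p ` sd v' t \<subset> image p ` sd v t"
    using A(2) image_inj by (intro image_strict_mono) (auto intro: inj_on_subset)
  then show ?thesis using image_nb[OF A(1)] s by (auto simp: towards_def sd_image)
qed

lemma depth_image:
  assumes x: "x \<in> X" and A: "A \<in> \<E>"
  shows "depth (p x) (p ` A) = depth x A"
proof -
  have c: "card {B \<in> \<E>. p x \<in> B \<and> B \<subseteq> p ` A} = card {B \<in> \<E>. x \<in> B \<and> B \<subseteq> A}" if "A \<subseteq> X" for A
  proof -
    have "image p ` {B \<in> \<E>. x \<in> B \<and> B \<subseteq> A} = {B \<in> \<E>. p x \<in> B \<and> B \<subseteq> p ` A}"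
      using that x sub image_subset_iff
      by (intro image_Collect) (simp add: p_mem_iff)
    then show ?thesis using card_image[of "image p" "{B \<in> \<E>. x \<in> B \<and> B \<subseteq> A}"] image_inj
      by (metis (no_types, lifting) inj_on_subset mem_Collect_eq subsetI)
  qed
  show ?thesis unfolding depth_def
    using c[OF sub[OF A]] c[of "X - A"] image_compl[OF sub[OF A]] by simp
qed

lemma image_centre:
  assumes "H \<subseteq> X"
  shows "image p ` centre H = centre (p ` H)"
  unfolding centre_def
proof (rule image_Collect)
  fix B assume B: "B \<in> \<E>"
  have "(\<Sum>x\<in>p ` H. depth x (p ` B)) = (\<Sum>x\<in>H. depth (p x) (p ` B))"
    using p_inj assms by (subst sum.reindex) (auto intro: inj_on_subset)
  also have "\<dots> = (\<Sum>x\<in>H. depth x B)" using depth_image B assms by (intro sum.cong) auto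
  finally show "(0 < (\<Sum>x\<in>p ` H. depth x (p ` B))) = (0 < (\<Sum>x\<in>H. depth x B))" by simp
qed

end

section \<open>Equivariant choice and a criterion for trees\<close>

text \<open>\<open>group_action\<close> requires extensional permutations. Without that demand
  \<open>lmul\<close> and its images on families of sets can be used as they stand;
  \<open>group_action_restrict\<close> leads back.\<close>

definition acts where
  "acts G X a \<longleftrightarrow> (\<forall>g\<in>carrier G. \<forall>x\<in>X. a g x \<in> X) \<and> (\<forall>x\<in>X. a \<one>\<^bsub>G\<^esub> x = x) \<and>
    (\<forall>g\<in>carrier G. \<forall>h\<in>carrier G. \<forall>x\<in>X. a (g \<otimes>\<^bsub>G\<^esub> h) x = a g (a h x))"

lemma actsD:
  assumes "acts G X a"
  shows "g \<in> carrier G \<Longrightarrow> x \<in> X \<Longrightarrow> a g x \<in> X" "x \<in> X \<Longrightarrow> a \<one>\<^bsub>G\<^esub> x = x"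
    "g \<in> carrier G \<Longrightarrow> h \<in> carrier G \<Longrightarrow> x \<in> X \<Longrightarrow> a (g \<otimes>\<^bsub>G\<^esub> h) x = a g (a h x)"
  using assms by (auto simp: acts_def)

lemma acts_of_group_action:
  assumes "group_action G X a"
  shows "acts G X a"
proof -
  interpret group_action G X a by fact
  show ?thesis unfolding acts_def
  proof (intro conjI ballI)
    show "a \<one>\<^bsub>G\<^esub> x = x" if "x \<in> X" for x using that by (simp flip: id_eq_one)
  qed (use element_image composition_rule in blast)+
qed

context group
begin

lemma acts_inv:
  assumes "acts G X a" "g \<in> carrier G" "x \<in> X"
  shows "a (inv g) (a g x) = x" "a g (a (inv g) x) = x"
  using actsD(3)[OF assms(1), of "inv g" g x] actsD(3)[OF assms(1), of g "inv g" x]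
    actsD(2)[OF assms(1)] assms(2,3) by auto

lemma group_action_restrict:
  assumes a: "acts G X a"
  shows "group_action G X (\<lambda>g. restrict (a g) X)"
proof -
  have bij: "restrict (a g) X \<in> Bij X" if g: "g \<in> carrier G" for g
  proof -
    have "bij_betw (a g) X X"
      using actsD(1)[OF a] acts_inv[OF a] g by (intro bij_betwI[where g = "a (inv g)"]) auto
    then show ?thesis by (simp add: Bij_def)
  qed
  have "(\<lambda>g. restrict (a g) X) \<in> hom G (BijGroup X)"
  proof (rule homI)
    show "restrict (a g) X \<in> carrier (BijGroup X)" if "g \<in> carrier G" for g
      using bij that by (simp add: BijGroup_def)
    show "restrict (a (g \<otimes> h)) X = restrict (a g) X \<otimes>\<^bsub>BijGroup X\<^esub> restrict (a h) X"
      if "g \<in> carrier G" "h \<in> carrier G" for g h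
    proof
      fix x
      show "restrict (a (g \<otimes> h)) X x = (restrict (a g) X \<otimes>\<^bsub>BijGroup X\<^esub> restrict (a h) X) x"
        using that bij actsD[OF a] by (auto simp: BijGroup_def compose_def)
    qed
  qed
  then show ?thesis
    by (intro group_action.intro group_hom.intro group_hom_axioms.intro is_group group_BijGroup)
qed

lemma stabilizer_act:
  assumes a: "acts G X a" and g: "g \<in> carrier G" and x: "x \<in> X" and k: "k \<in> carrier G"
  shows "k \<in> stabilizer G a (a g x) \<longleftrightarrow> inv g \<otimes> k \<otimes> g \<in> stabilizer G a x"
proof -
  have gx: "a g x \<in> X" "a k (a g x) \<in> X" using actsD(1)[OF a] g x k by auto
  have "a (inv g \<otimes> k \<otimes> g) x = a (inv g) (a k (a g x))"
    using actsD(3)[OF a] g k x gx by (simp add: m_assoc)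
  moreover have "a (inv g) (a k (a g x)) = x \<longleftrightarrow> a k (a g x) = a g x"
    using acts_inv[OF a g] gx x by metis
  ultimately show ?thesis using g k by (simp add: stabilizer_def)
qed

lemma stabilizer_act_mono:
  assumes a: "acts G X a" and b: "acts G Y b" and g: "g \<in> carrier G" and x: "x \<in> X" and y: "y \<in> Y"
    and s: "stabilizer G a x \<subseteq> stabilizer G b y"
  shows "stabilizer G a (a g x) \<subseteq> stabilizer G b (b g y)"
proof
  fix k assume k: "k \<in> stabilizer G a (a g x)"
  then have "k \<in> carrier G" by (simp add: stabilizer_def)
  then show "k \<in> stabilizer G b (b g y)"
    using k stabilizer_act[OF a g x] stabilizer_act[OF b g y] s by blast
qed

text \<open>Values are chosen on orbit representatives and transported; the inclusion of stabilizers
  is exactly what makes the transport well defined. \<open>P\<close> carries an invariant property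
  of the chosen values along.\<close>

lemma equivariant_choice:
  assumes a: "acts G X a" and b: "acts G Y b"
    and ex: "\<And>x. x \<in> X \<Longrightarrow> \<exists>y\<in>Y. P x y \<and> stabilizer G a x \<subseteq> stabilizer G b y"
    and P: "\<And>g x y. \<lbrakk>g \<in> carrier G; x \<in> X; y \<in> Y; stabilizer G a x \<subseteq> stabilizer G b y; P x y\<rbrakk>
      \<Longrightarrow> P (a g x) (b g y)"
  shows "\<exists>f. \<forall>x\<in>X. f x \<in> Y \<and> P x (f x) \<and> (\<forall>g\<in>carrier G. f (a g x) = b g (f x))"
proof -
  define orb where "orb x = {a g x |g. g \<in> carrier G}" for x
  define rep where "rep x = (SOME r. r \<in> orb x)" for x
  have rep: "rep x \<in> orb x" if "x \<in> X" for x
    unfolding rep_def by (rule someI[of _ "a \<one> x"]) (auto simp: orb_def)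
  have orb_act: "orb (a g x) = orb x" if g: "g \<in> carrier G" and x: "x \<in> X" for g x
  proof (intro equalityI subsetI)
    fix y assume "y \<in> orb (a g x)"
    then obtain k where "k \<in> carrier G" "y = a k (a g x)" by (auto simp: orb_def)
    then show "y \<in> orb x" using actsD(3)[OF a, of k g x] g x
      unfolding orb_def by (intro CollectI exI[of _ "k \<otimes> g"]) auto
  next
    fix y assume "y \<in> orb x"
    then obtain k where k: "k \<in> carrier G" "y = a k x" by (auto simp: orb_def)
    then have "y = a (k \<otimes> inv g) (a g x)"
      using actsD[OF a] acts_inv[OF a] g x by simp
    then show "y \<in> orb (a g x)" unfolding orb_def using g k(1) by auto
  qed
  have rep_act: "rep (a g x) = rep x" if "g \<in> carrier G" "x \<in> X" for g x
    using orb_act[OF that] by (simp add: rep_def)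
  have repX: "rep x \<in> X" if "x \<in> X" for x using rep[OF that] actsD(1)[OF a] that by (auto simp: orb_def)
  have tr: "\<exists>k. k \<in> carrier G \<and> a k (rep x) = x" if x: "x \<in> X" for x
  proof -
    obtain g where g: "g \<in> carrier G" "rep x = a g x" using rep[OF x] by (auto simp: orb_def)
    then have "a (inv g) (rep x) = x" using acts_inv[OF a] x by simp
    then show ?thesis using g by blast
  qed
  define k where "k x = (SOME k. k \<in> carrier G \<and> a k (rep x) = x)" for x
  have k: "k x \<in> carrier G" "a (k x) (rep x) = x" if "x \<in> X" for x
    using someI_ex[OF tr[OF that]] by (auto simp: k_def)
  have "\<forall>x\<in>X. \<exists>y. y \<in> Y \<and> P x y \<and> stabilizer G a x \<subseteq> stabilizer G b y" using ex by blast
  then obtain c where c: "\<forall>x\<in>X. c x \<in> Y \<and> P x (c x) \<and> stabilizer G a x \<subseteq> stabilizer G b (c x)"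
    by (rule bchoice[THEN exE])
  define f where "f x = b (k x) (c (rep x))" for x
  have wd: "b g (c (rep x)) = b h (c (rep x))"
    if gh: "g \<in> carrier G" "h \<in> carrier G" "a g (rep x) = a h (rep x)" and x: "x \<in> X" for g h x
  proof -
    have cY: "c (rep x) \<in> Y" and st: "stabilizer G a (rep x) \<subseteq> stabilizer G b (c (rep x))"
      using c repX[OF x] by auto
    have "a (inv h \<otimes> g) (rep x) = rep x"
      using actsD(3)[OF a, of "inv h" g "rep x"] acts_inv[OF a, of h "rep x"] gh repX[OF x] by simp
    then have "inv h \<otimes> g \<in> stabilizer G a (rep x)" using gh by (simp add: stabilizer_def)
    then have "inv h \<otimes> g \<in> stabilizer G b (c (rep x))" using st by blast
    then have e: "b (inv h \<otimes> g) (c (rep x)) = c (rep x)" by (simp add: stabilizer_def)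
    have "b g (c (rep x)) = b (h \<otimes> (inv h \<otimes> g)) (c (rep x))" using gh by (simp flip: m_assoc)
    also have "\<dots> = b h (c (rep x))"
      using actsD(3)[OF b, of h "inv h \<otimes> g"] gh cY e by simp
    finally show ?thesis .
  qed
  have "f x \<in> Y \<and> P x (f x) \<and> (\<forall>g\<in>carrier G. f (a g x) = b g (f x))" if x: "x \<in> X" for x
  proof (intro conjI ballI)
    note cr = bspec[OF c repX[OF x]]
    show "f x \<in> Y" using cr k[OF x] actsD(1)[OF b] by (simp add: f_def)
    show "P x (f x)" using P[of "k x" "rep x" "c (rep x)"] cr k[OF x] repX[OF x] by (simp add: f_def)
    fix g assume g: "g \<in> carrier G"
    have gx: "a g x \<in> X" using actsD(1)[OF a] g x by simp
    have "a (k (a g x)) (rep x) = a (g \<otimes> k x) (rep x)"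
      using k[OF gx] k[OF x] rep_act[OF g x] actsD(3)[OF a g _ repX[OF x], of "k x"] by simp
    then have "b (k (a g x)) (c (rep x)) = b (g \<otimes> k x) (c (rep x))"
      by (rule wd[OF k(1)[OF gx] m_closed[OF g k(1)[OF x]] _ x])
    then show "f (a g x) = b g (f x)"
      using rep_act[OF g x] actsD(3)[OF b g] k[OF x] cr by (simp add: f_def)
  qed
  then show ?thesis by (intro exI[of _ f] ballI)
qed

end

section \<open>Walks, bridges and uniqueness of reduced paths\<close>

definition opp :: "'e \<times> bool \<Rightarrow> 'e \<times> bool" where "opp x = (fst x, \<not> snd x)"

lemma reduced_iff: "reduced p \<longleftrightarrow> successively (\<lambda>x y. y \<noteq> opp x) p"
proof -
  have "(\<lambda>(e, b) (f, c). \<not> (f = e \<and> c \<noteq> b)) = (\<lambda>x y :: 'a \<times> bool. y \<noteq> opp x)"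
    by (auto simp: fun_eq_iff opp_def)
  then show ?thesis by (simp add: reduced_def)
qed

lemma opp_opp [simp]: "opp (opp x) = x" by (simp add: opp_def)

lemma not_successively_split:
  "\<not> successively P xs \<Longrightarrow> \<exists>as x y bs. xs = as @ x # y # bs \<and> \<not> P x y"
proof (induction xs rule: induct_list012)
  case (3 x y zs)
  show ?case
  proof (cases "P x y")
    case True
    then have "\<not> successively P (y # zs)" using "3.prems" by simp
    then obtain as u v bs where "y # zs = as @ u # v # bs" "\<not> P u v" using "3.IH"(2) by blast
    then show ?thesis by (intro exI[of _ "x # as"]) auto
  next
    case False
    then show ?thesis by (intro exI[of _ "[]"]) auto
  qed
qed auto

context wf_digraph
begin

abbreviation walk where "walk \<equiv> pre_digraph.awalk (either_way G)"

lemma either_way_simps: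
  "verts (either_way G) = verts G" "arcs (either_way G) = arcs G \<times> UNIV"
  "tail (either_way G) x = (if snd x then tail G (fst x) else head G (fst x))"
  "head (either_way G) x = (if snd x then head G (fst x) else tail G (fst x))"
  by (auto simp: either_way_def split: prod.split)

lemma wf_either_way: "wf_digraph (either_way G)"
  by unfold_locales (auto simp: either_way_simps)

lemma walk_Nil: "walk u [] v \<longleftrightarrow> u = v \<and> u \<in> verts G"
  by (auto simp: pre_digraph.awalk_def pre_digraph.cas.simps either_way_simps)

lemma walk_Cons: "walk u (x # p) v \<longleftrightarrow> fst x \<in> arcs G \<and> u = tail (either_way G) x \<and> walk (head (either_way G) x) p v"
  using wf_digraph.awalk_Cons_iff[OF wf_either_way, of u x p v]
  by (auto simp: either_way_simps mem_Times_iff)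

lemma walk_append: "walk u (p @ q) v \<longleftrightarrow> (\<exists>w. walk u p w \<and> walk w q v)"
proof (induction p arbitrary: u)
  case Nil
  have "u \<in> verts G" if "walk u q v" using that by (simp add: pre_digraph.awalk_def either_way_simps)
  then show ?case by (auto simp: walk_Nil)
qed (auto simp: walk_Cons)

lemma ends_opp: "tail (either_way G) (opp x) = head (either_way G) x"
  "head (either_way G) (opp x) = tail (either_way G) x"
  by (auto simp: either_way_simps opp_def)

lemma walk_rev: "walk u p v \<Longrightarrow> walk v (map opp (rev p)) u"
proof (induction p arbitrary: u)
  case (Cons x p)
  then have h: "fst x \<in> arcs G" "u = tail (either_way G) x" "walk v (map opp (rev p)) (head (either_way G) x)"
    by (auto simp: walk_Cons)
  have "walk (head (either_way G) x) [opp x] u"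
    using h by (auto simp: walk_Cons walk_Nil ends_opp either_way_simps opp_def)
  then show ?case using h by (auto simp: walk_append)
qed (simp add: walk_Nil)

text \<open>A shortest walk is reduced, since a backtracking pair could be cut out.\<close>

lemma reduced_walk_exists:
  assumes "walk u p v"
  shows "\<exists>q. walk u q v \<and> reduced q"
proof -
  obtain q where q: "walk u q v" and min: "\<And>r. walk u r v \<Longrightarrow> length q \<le> length r"
    using ex_has_least_nat[of "\<lambda>p. walk u p v" p length] assms by blast
  have "reduced q"
  proof (rule ccontr)
    assume "\<not> reduced q"
    then obtain as x bs where e: "q = as @ x # opp x # bs"
      unfolding reduced_iff using not_successively_split by blast
    have "walk u (as @ bs) v" using q unfolding e walk_append walk_Cons ends_opp by blast
    then show False using min[of "as @ bs"] e by simp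
  qed
  then show ?thesis using q by blast
qed

lemma walk_same_side:
  assumes "walk u p v" and "\<And>x. x \<in> set p \<Longrightarrow> tail G (fst x) \<in> P \<longleftrightarrow> head G (fst x) \<in> P"
  shows "u \<in> P \<longleftrightarrow> v \<in> P"
  using assms
proof (induction p arbitrary: u)
  case (Cons x p)
  have "tail G (fst x) \<in> P \<longleftrightarrow> head G (fst x) \<in> P" using Cons.prems(2) by simp
  moreover have "head (either_way G) x \<in> P \<longleftrightarrow> v \<in> P"
    using Cons.IH[of "head (either_way G) x"] Cons.prems by (simp add: walk_Cons)
  moreover have "u = tail (either_way G) x" using Cons.prems by (simp add: walk_Cons)
  ultimately show ?case by (simp add: either_way_simps split: if_splits)
qed (simp add: walk_Nil)

text \<open>Acyclicity by certificates: each arc has a set of vertices whose border no other arc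
  crosses. For the collapsed tree these sets are explicit.\<close>

definition bridges where
  "bridges \<longleftrightarrow> (\<forall>e\<in>arcs G. \<exists>P. (tail G e \<in> P) \<noteq> (head G e \<in> P) \<and>
     (\<forall>f\<in>arcs G. f \<noteq> e \<longrightarrow> (tail G f \<in> P \<longleftrightarrow> head G f \<in> P)))"

text \<open>A closed walk starting with x must cross the cut of its arc again. Up to that moment it
  stays on one side, so the next crossing is \<open>opp x\<close> and the part in between is a
  shorter closed reduced walk, hence empty. But x followed by \<open>opp x\<close> is not
  reduced.\<close>

lemma no_reduced_cycle:
  assumes "bridges" "walk u p u" "reduced p"
  shows "p = []"
  using assms(2,3)
proof (induction "length p" arbitrary: p u rule: less_induct)
  case less
  show ?case
  proof (cases p)
    case (Cons x q)
    have x: "fst x \<in> arcs G" "u = tail (either_way G) x" and wq: "walk (head (either_way G) x) q u"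
      using less.prems Cons by (auto simp: walk_Cons)
    obtain P where P: "(tail G (fst x) \<in> P) \<noteq> (head G (fst x) \<in> P)"
      "\<And>f. f \<in> arcs G \<Longrightarrow> f \<noteq> fst x \<Longrightarrow> (tail G f \<in> P \<longleftrightarrow> head G f \<in> P)"
      using assms(1) x(1) unfolding bridges_def by metis
    have arcs: "fst y \<in> arcs G" if "y \<in> set q" for y
      using wq that by (auto simp: pre_digraph.awalk_def either_way_simps)
    have ends: "(tail (either_way G) x \<in> P) \<noteq> (head (either_way G) x \<in> P)"
      using P(1) by (auto simp: either_way_simps)
    have "\<exists>y\<in>set q. fst y = fst x"
    proof (rule ccontr)
      assume "\<not> ?thesis"
      then have "head (either_way G) x \<in> P \<longleftrightarrow> u \<in> P"
        using arcs P(2) by (intro walk_same_side[OF wq]) auto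
      then show False using ends x by simp
    qed
    then obtain q1 y q2 where q: "q = q1 @ y # q2" "fst y = fst x" "\<forall>z\<in>set q1. fst z \<noteq> fst x"
      using split_list_first_prop[of q "\<lambda>y. fst y = fst x"] by blast
    have w1: "walk (head (either_way G) x) q1 (tail (either_way G) y)"
      using wq unfolding q(1) walk_append walk_Cons by blast
    have "head (either_way G) x \<in> P \<longleftrightarrow> tail (either_way G) y \<in> P"
      using arcs P(2) q by (intro walk_same_side[OF w1]) auto
    then have y: "y = opp x"
      using ends q(2) by (cases x; cases y) (auto simp: either_way_simps opp_def split: if_splits)
    then have "walk (head (either_way G) x) q1 (head (either_way G) x)" using w1 by (simp add: ends_opp)
    moreover have "reduced q1"
      using less.prems(2) Cons q(1) unfolding reduced_iff by (auto simp: successively_Cons successively_append_iff)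
    ultimately have "q1 = []" using less.hyps[of q1] Cons q(1) by simp
    then have False using less.prems(2) Cons q(1) y unfolding reduced_iff by simp
    then show ?thesis ..
  qed simp
qed

lemma reduced_walk_unique:
  assumes "bridges"
  shows "walk u p v \<Longrightarrow> reduced p \<Longrightarrow> walk u q v \<Longrightarrow> reduced q \<Longrightarrow> p = q"
proof (induction p arbitrary: u q)
  case Nil
  then have "walk v q v" by (simp add: walk_Nil)
  then show ?case using no_reduced_cycle[OF assms, of v q] Nil.prems(4) by simp
next
  case (Cons x p)
  show ?case
  proof (cases q)
    case Nil
    then have "u = v" using Cons.prems by (simp add: walk_Nil)
    then show ?thesis using no_reduced_cycle[OF assms, of u "x # p"] Cons.prems by simp
  next
    case q: (Cons y q')
    show ?thesis
    proof (cases "x = y")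
      case True
      have "reduced p" "reduced q'" using Cons.prems q unfolding reduced_iff by (auto simp: successively_Cons)
      then show ?thesis using Cons.IH[of "head (either_way G) x" q'] Cons.prems q True by (simp add: walk_Cons)
    next
      case False
      \<comment> \<open>The first steps differ, so going back along one path and out along the other
        creates no backtracking and gives a reduced closed walk.\<close>
      let ?r = "map opp (rev (x # p)) @ q"
      have "walk v ?r v" using walk_rev[OF Cons.prems(1)] Cons.prems(3) unfolding walk_append by blast
      moreover have "reduced ?r"
      proof -
        have "successively (\<lambda>a b. b \<noteq> opp a) (map opp (rev (x # p)))"
          using Cons.prems(2) unfolding reduced_iff successively_map successively_rev
          by (rule successively_mono) auto
        then show ?thesis using Cons.prems(4) False q unfolding reduced_iff
          by (simp add: successively_append_iff)
      qed
      ultimately have "?r = []" using no_reduced_cycle[OF assms] by blast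
      then show ?thesis by simp
    qed
  qed
qed

lemma tree_of_bridges:
  assumes "bridges" "verts G \<noteq> {}" "\<And>u v. u \<in> verts G \<Longrightarrow> v \<in> verts G \<Longrightarrow> \<exists>p. walk u p v"
  shows "tree G"
proof unfold_locales
  show "verts G \<noteq> {}" by fact
  fix u v assume "u \<in> verts G" "v \<in> verts G"
  then obtain p where "walk u p v" using assms(3) by blast
  then obtain q where "walk u q v" "reduced q" using reduced_walk_exists by blast
  then show "\<exists>!p. reduced_path G u p v"
    unfolding reduced_path_def using reduced_walk_unique[OF assms(1)] by blast
qed

end

section \<open>Collapsing the tree onto the given vertex set\<close>

text \<open>The interface between the nested family and the collapse. \<open>W_fix\<close> and
  \<open>vert_fix\<close> are what \<open>equivariant_choice\<close> needs in the two directions;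
  \<open>K\<close> bounds edge stabilizers uniformly and makes the flow terminate.\<close>

locale retraction_data = group G + tree_set "carrier G" \<E>
  for G :: "('g, 'm) monoid_scheme" (structure) and \<E> :: "'g set set" +
  fixes W :: "'w set" and a :: "'g \<Rightarrow> 'w \<Rightarrow> 'w" and K :: nat
  assumes lmul_mem: "\<lbrakk>g \<in> carrier G; A \<in> \<E>\<rbrakk> \<Longrightarrow> lmul g A \<in> \<E>"
    and acts_W: "acts G W a"
    and W_ne: "W \<noteq> {}"
    and stab_bound: "A \<in> \<E> \<Longrightarrow> finite (stabilizer G lmul A) \<and> card (stabilizer G lmul A) \<le> K"
    and vert_fix: "v \<in> VT \<Longrightarrow> \<exists>w\<in>W. stabilizer G (\<lambda>g. image (lmul g)) v \<subseteq> stabilizer G a w"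
    and W_fix: "w \<in> W \<Longrightarrow> \<exists>v\<in>VT. stabilizer G a w \<subseteq> stabilizer G (\<lambda>g. image (lmul g)) v"
begin

abbreviation move where "move g \<equiv> image (lmul g)"

abbreviation stab where "stab \<equiv> stabilizer G move"

lemma auto_lmul: "g \<in> carrier G \<Longrightarrow> tree_set_auto (carrier G) \<E> (\<lambda>x. g \<otimes> x)"
proof unfold_locales
  assume g: "g \<in> carrier G"
  show "bij_betw (\<lambda>x. g \<otimes> x) (carrier G) (carrier G)"
    using g by (intro bij_betwI[where g = "\<lambda>x. inv g \<otimes> x"]) (auto simp flip: m_assoc)
  show "image (\<lambda>x. g \<otimes> x) ` \<E> = \<E>"
  proof
    show "image (\<lambda>x. g \<otimes> x) ` \<E> \<subseteq> \<E>" using lmul_mem[OF g] by (auto simp: lmul_def)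
    show "\<E> \<subseteq> image (\<lambda>x. g \<otimes> x) ` \<E>"
    proof
      fix A assume A: "A \<in> \<E>"
      have "A = lmul g (lmul (inv g) A)" using lmul_mult[of g "inv g" A] lmul_one sub[OF A] g by simp
      then show "A \<in> image (\<lambda>x. g \<otimes> x) ` \<E>" using lmul_mem[OF inv_closed[OF g] A] by (auto simp: lmul_def)
    qed
  qed
qed

lemma move_eq: "move g v = image (image (\<lambda>x. g \<otimes> x)) v" by (simp add: lmul_def)

lemma VT_sub: "v \<in> VT \<Longrightarrow> v \<subseteq> \<E>" using VT_orientation orientationD(1) by blast

lemma acts_VT: "acts G VT move"
  unfolding acts_def
proof (intro conjI ballI)
  fix g v assume gv: "g \<in> carrier G" "v \<in> VT"
  interpret tree_set_auto "carrier G" \<E> "\<lambda>x. g \<otimes> x" by (rule auto_lmul[OF gv(1)])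
  show "move g v \<in> VT" using image_VT[OF gv(2)] by (simp add: move_eq)
next
  fix v assume v: "v \<in> VT"
  have "lmul \<one> A = A" if "A \<in> v" for A using lmul_one sub VT_sub[OF v] that by blast
  then show "move \<one> v = v" by simp
next
  fix g h v assume g: "g \<in> carrier G" and h: "h \<in> carrier G" and v: "v \<in> VT"
  have "lmul (g \<otimes> h) A = lmul g (lmul h A)" if "A \<in> v" for A
    using lmul_mult[OF g h] sub VT_sub[OF v] that by blast
  then show "move (g \<otimes> h) v = move g (move h v)" by (simp add: image_image)
qed

lemma move_up: "\<lbrakk>g \<in> carrier G; A \<in> \<E>\<rbrakk> \<Longrightarrow> move g (up A) = up (lmul g A)"
  using tree_set_auto.image_up[OF auto_lmul] by (simp add: lmul_def)

lemma move_towards: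
  "\<lbrakk>g \<in> carrier G; towards v t v'; t \<in> VT\<rbrakk> \<Longrightarrow> towards (move g v) (move g t) (move g v')"
  using tree_set_auto.image_towards[OF auto_lmul] by (simp add: lmul_def)

definition dst where "dst v t = card (sd v t)"

lemma dst_move: "\<lbrakk>g \<in> carrier G; v \<in> VT; t \<in> VT\<rbrakk> \<Longrightarrow> dst (move g v) (move g t) = dst v t"
proof -
  assume g: "g \<in> carrier G" and v: "v \<in> VT" and t: "t \<in> VT"
  interpret tree_set_auto "carrier G" \<E> "\<lambda>x. g \<otimes> x" by (rule auto_lmul[OF g])
  have "sd v t \<subseteq> \<E>" using VT_sub v t by (auto simp: sd_def)
  then have "card (image (image (\<lambda>x. g \<otimes> x)) (sd v t)) = card (sd v t)"
    using image_inj by (intro card_image) (auto intro: inj_on_subset)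
  then show ?thesis unfolding dst_def move_eq using sd_image[OF VT_sub[OF v] VT_sub[OF t]] by simp
qed

lemma towards_dst: "\<lbrakk>v \<in> VT; t \<in> VT; towards v t v'\<rbrakk> \<Longrightarrow> dst v' t < dst v t"
  unfolding dst_def towards_def by (auto intro: psubset_card_mono finite_sd_VT)

section \<open>Equivariant maps between VT and W\<close>

lemma ex_equivariant_to_VT:
  "\<exists>h. \<forall>w\<in>W. h w \<in> VT \<and> True \<and> (\<forall>g\<in>carrier G. h (a g w) = move g (h w))"
  by (rule equivariant_choice[OF acts_W acts_VT]) (use W_fix in auto)

definition h where
  "h = (SOME h. \<forall>w\<in>W. h w \<in> VT \<and> True \<and> (\<forall>g\<in>carrier G. h (a g w) = move g (h w)))"

lemma h: "w \<in> W \<Longrightarrow> h w \<in> VT" "\<lbrakk>w \<in> W; g \<in> carrier G\<rbrakk> \<Longrightarrow> h (a g w) = move g (h w)"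
  using someI_ex[OF ex_equivariant_to_VT, folded h_def] by simp_all

text \<open>Only elements fixed by \<open>stab v\<close> compete, being the possible values at v of
  an equivariant map. Minimality shortens the distance whenever a flow step leaves the stabilizer
  unchanged.\<close>

definition nearest where
  "nearest v w \<longleftrightarrow> (\<forall>w'\<in>W. stab v \<subseteq> stabilizer G a w' \<longrightarrow> dst v (h w) \<le> dst v (h w'))"

lemma ex_equivariant_to_W:
  "\<exists>f. \<forall>v\<in>VT. f v \<in> W \<and> (stab v \<subseteq> stabilizer G a (f v) \<and> nearest v (f v)) \<and>
    (\<forall>g\<in>carrier G. f (move g v) = a g (f v))"
proof (rule equivariant_choice[OF acts_VT acts_W])
  fix v assume v: "v \<in> VT"
  then obtain w where "w \<in> W \<and> stab v \<subseteq> stabilizer G a w" using vert_fix by blast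
  then obtain w' where "w' \<in> W \<and> stab v \<subseteq> stabilizer G a w'"
    "\<forall>y. y \<in> W \<and> stab v \<subseteq> stabilizer G a y \<longrightarrow> dst v (h w') \<le> dst v (h y)"
    using ex_has_least_nat[of "\<lambda>w. w \<in> W \<and> stab v \<subseteq> stabilizer G a w" w "\<lambda>w. dst v (h w)"] by blast
  then show "\<exists>y\<in>W. (stab v \<subseteq> stabilizer G a y \<and> nearest v y) \<and> stab v \<subseteq> stabilizer G a y"
    unfolding nearest_def by blast
next
  fix g v w assume g: "g \<in> carrier G" and v: "v \<in> VT" and w: "w \<in> W"
    and s: "stab v \<subseteq> stabilizer G a w" and n: "stab v \<subseteq> stabilizer G a w \<and> nearest v w"
  have gv: "move g v \<in> VT" using actsD(1)[OF acts_VT g v] .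
  have "nearest (move g v) (a g w)"
    unfolding nearest_def
  proof (intro ballI impI)
    fix w' assume w': "w' \<in> W" and s': "stab (move g v) \<subseteq> stabilizer G a w'"
    have gw': "a (inv g) w' \<in> W" using actsD(1)[OF acts_W] g w' by simp
    have "stab (move (inv g) (move g v)) \<subseteq> stabilizer G a (a (inv g) w')"
      by (rule stabilizer_act_mono[OF acts_VT acts_W _ gv w' s']) (use g in simp)
    then have "stab v \<subseteq> stabilizer G a (a (inv g) w')" using acts_inv(1)[OF acts_VT g v] by simp
    then have "dst v (h w) \<le> dst v (h (a (inv g) w'))" using n gw' by (simp add: nearest_def)
    moreover have "dst (move g v) (h (a g w)) = dst v (h w)"
      using dst_move[OF g v h(1)[OF w]] h(2)[OF w g] by simp
    moreover have "dst (move g v) (h w') = dst v (h (a (inv g) w'))"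
      using dst_move[OF g v h(1)[OF gw']] h(2)[OF gw' g] acts_inv(2)[OF acts_W g w'] by simp
    ultimately show "dst (move g v) (h (a g w)) \<le> dst (move g v) (h w')" by simp
  qed
  then show "stab (move g v) \<subseteq> stabilizer G a (a g w) \<and> nearest (move g v) (a g w)"
    using stabilizer_act_mono[OF acts_VT acts_W g v w s] by blast
qed

definition f where
  "f = (SOME f. \<forall>v\<in>VT. f v \<in> W \<and> (stab v \<subseteq> stabilizer G a (f v) \<and> nearest v (f v)) \<and>
    (\<forall>g\<in>carrier G. f (move g v) = a g (f v)))"

lemma f: "v \<in> VT \<Longrightarrow> f v \<in> W" "v \<in> VT \<Longrightarrow> stab v \<subseteq> stabilizer G a (f v)" "v \<in> VT \<Longrightarrow> nearest v (f v)"
  "\<lbrakk>v \<in> VT; g \<in> carrier G\<rbrakk> \<Longrightarrow> f (move g v) = a g (f v)"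
  using someI_ex[OF ex_equivariant_to_W, folded f_def] by simp_all

section \<open>The flow on VT\<close>

definition root where "root v \<longleftrightarrow> h (f v) = v"

text \<open>One step along the geodesic to \<open>h (f v)\<close>. Uniqueness of that step makes the
  flow equivariant, so stabilizers can only grow along it.\<close>

definition nxt where "nxt v = (if root v then v else (THE v'. towards v (h (f v)) v'))"

lemma nxt_towards:
  assumes v: "v \<in> VT" and r: "\<not> root v"
  shows "towards v (h (f v)) (nxt v)"
proof -
  have t: "h (f v) \<in> VT" using f(1)[OF v] h(1) by blast
  have "\<exists>!v'. towards v (h (f v)) v'"
    using towards_ex[OF v t] towards_unique[OF t] r by (metis root_def)
  then show ?thesis unfolding nxt_def using r by (simp add: theI')
qed

lemma nxt_nb: "\<lbrakk>v \<in> VT; \<not> root v\<rbrakk> \<Longrightarrow> \<exists>A. nb A v (nxt v)"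
  using nxt_towards by (auto simp: towards_def)

lemma nxt_VT: "v \<in> VT \<Longrightarrow> nxt v \<in> VT"
  by (cases "root v") (simp add: nxt_def, use nxt_nb nb_VT in blast)

lemma nxt_root: "root v \<Longrightarrow> nxt v = v" by (simp add: nxt_def)

lemma root_move:
  assumes v: "v \<in> VT" and g: "g \<in> carrier G"
  shows "root (move g v) \<longleftrightarrow> root v"
proof -
  have "h (f (move g v)) = move g (h (f v))" using f[OF v] h g by simp
  moreover have "h (f v) \<in> VT" using f(1)[OF v] h by simp
  ultimately show ?thesis unfolding root_def
    using acts_inv(1)[OF acts_VT g] v by metis
qed

lemma nxt_move:
  assumes v: "v \<in> VT" and g: "g \<in> carrier G"
  shows "nxt (move g v) = move g (nxt v)"
proof (cases "root v")
  case True
  then show ?thesis using root_move[OF v g] by (simp add: nxt_root)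
next
  case False
  have t: "h (f v) \<in> VT" using f(1)[OF v] h(1) by blast
  have gv: "move g v \<in> VT" using actsD(1)[OF acts_VT g v] .
  have e: "h (f (move g v)) = move g (h (f v))" using f[OF v] h g by simp
  have "towards (move g v) (move g (h (f v))) (move g (nxt v))"
    using move_towards[OF g nxt_towards[OF v False] t] .
  moreover have "towards (move g v) (move g (h (f v))) (nxt (move g v))"
    using nxt_towards[OF gv] root_move[OF v g] False e by simp
  moreover have "move g (h (f v)) \<in> VT" using actsD(1)[OF acts_VT g t] .
  ultimately show ?thesis using towards_unique by blast
qed

lemma stab_nxt:
  assumes v: "v \<in> VT"
  shows "stab v \<subseteq> stab (nxt v)"
proof
  fix g assume "g \<in> stab v"
  then have g: "g \<in> carrier G" "move g v = v" by (simp_all add: stabilizer_def)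
  then have "move g (nxt v) = nxt v" using nxt_move[OF v g(1)] by simp
  then show "g \<in> stab (nxt v)" using g(1) by (simp add: stabilizer_def)
qed

text \<open>The stabilizer of a moving vertex fixes the next vertex too, hence the set A in which
  the two differ.\<close>

lemma stab_nonroot:
  assumes v: "v \<in> VT" and r: "\<not> root v"
  shows "finite (stab v)" "card (stab v) \<le> K"
proof -
  obtain A where A: "nb A v (nxt v)" using nxt_nb[OF v r] by blast
  have AE: "A \<in> \<E>" using A by (simp add: nb_def)
  have "stab v \<subseteq> stabilizer G lmul A"
  proof
    fix g assume g: "g \<in> stab v"
    then have gG: "g \<in> carrier G" "move g v = v" "move g (nxt v) = nxt v"
      using stab_nxt[OF v] by (auto simp: stabilizer_def)
    interpret tree_set_auto "carrier G" \<E> "\<lambda>x. g \<otimes> x" by (rule auto_lmul[OF gG(1)])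
    have "sd (move g v) (move g (nxt v)) = move g (sd v (nxt v))"
      unfolding move_eq by (rule sd_image[OF VT_sub[OF v] VT_sub[OF nxt_VT[OF v]]])
    then have "{A} = {lmul g A}" using gG nb_sd[OF A] by simp
    then show "g \<in> stabilizer G lmul A" using gG(1) by (simp add: stabilizer_def)
  qed
  then show "finite (stab v)" "card (stab v) \<le> K"
    using stab_bound[OF AE] by (auto intro: finite_subset order_trans[OF card_mono])
qed

text \<open>
  Along the flow stabilizers grow, and as long as they do not grow the distance to \<open>h (f v)\<close> drops.
\<close>

lemma reaches_root:
  assumes "v \<in> VT"
  shows "\<exists>k. root ((nxt ^^ k) v)"
  using assms
proof (induction v rule: wf_induct_rule[OF wf_inv_image[OF wf_lex_prod[OF wf_less_than wf_less_than],
      of "\<lambda>v. (K - card (stab v), dst v (h (f v)))"]])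
  case (1 v)
  show ?case
  \<comment> \<open>A root at \<open>nxt v\<close> is split off because the bound on the stabilizer
    of \<open>nxt v\<close> comes from its being a nonroot.\<close>
  proof (cases "root v \<or> root (nxt v)")
    case True
    then have "root ((nxt ^^ 0) v) \<or> root ((nxt ^^ 1) v)" by simp
    then show ?thesis by blast
  next
    case False
    let ?v = "nxt v"
    have v': "?v \<in> VT" using nxt_VT "1.prems" .
    note fin = stab_nonroot[OF v'] and tw = nxt_towards[OF "1.prems"]
    have t: "h (f v) \<in> VT" using f(1)[OF "1.prems"] h(1) by blast
    have "(?v, v) \<in> inv_image (less_than <*lex*> less_than) (\<lambda>v. (K - card (stab v), dst v (h (f v))))"
    proof (cases "stab ?v = stab v")
      case True
      have "stab ?v \<subseteq> stabilizer G a (f v)" using f(2)[OF "1.prems"] True by simp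
      then have "dst ?v (h (f ?v)) \<le> dst ?v (h (f v))"
        using f(3)[OF v'] f(1)[OF "1.prems"] by (simp add: nearest_def)
      also have "\<dots> < dst v (h (f v))" using towards_dst[OF "1.prems" t tw] False by simp
      finally show ?thesis using True by simp
    next
      case False': False
      then have "stab v \<subset> stab ?v" using stab_nxt[OF "1.prems"] by blast
      then have "card (stab v) < card (stab ?v)" using fin(1) False by (intro psubset_card_mono) auto
      then show ?thesis using fin(2) False by auto
    qed
    then obtain k where "root ((nxt ^^ k) ?v)" using "1.IH" v' by blast
    then have "root ((nxt ^^ Suc k) v)" by (simp add: funpow_swap1)
    then show ?thesis by blast
  qed
qed

definition L where "L v = (nxt ^^ (LEAST k. root ((nxt ^^ k) v))) v"

lemma root_L: "v \<in> VT \<Longrightarrow> root (L v)"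
  unfolding L_def using reaches_root by (auto intro: LeastI_ex)

lemma iter_VT: "v \<in> VT \<Longrightarrow> (nxt ^^ k) v \<in> VT" by (induction k) (auto intro: nxt_VT)

lemma L_VT: "v \<in> VT \<Longrightarrow> L v \<in> VT" unfolding L_def by (rule iter_VT)

lemma L_root: "root v \<Longrightarrow> L v = v"
  by (simp add: L_def Least_eq_0)

lemma L_nxt: "v \<in> VT \<Longrightarrow> L (nxt v) = L v"
proof (cases "root v")
  case True
  then show ?thesis by (simp add: nxt_root)
next
  case False
  assume v: "v \<in> VT"
  obtain k where k: "root ((nxt ^^ k) v)" using reaches_root[OF v] by blast
  have "(LEAST k. root ((nxt ^^ k) v)) = Suc (LEAST k. root ((nxt ^^ Suc k) v))"
    using Least_Suc[of "\<lambda>k. root ((nxt ^^ k) v)" k] k False by simp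
  then show ?thesis by (simp add: L_def funpow_swap1)
qed

lemma iter_move: "\<lbrakk>v \<in> VT; g \<in> carrier G\<rbrakk> \<Longrightarrow> (nxt ^^ k) (move g v) = move g ((nxt ^^ k) v)"
  by (induction k) (simp_all add: nxt_move iter_VT)

lemma L_move: "\<lbrakk>v \<in> VT; g \<in> carrier G\<rbrakk> \<Longrightarrow> L (move g v) = move g (L v)"
  unfolding L_def by (simp add: iter_move root_move iter_VT)

section \<open>Surviving edges and the collapsed tree\<close>

definition kept where "kept = {A \<in> \<E>. L (up A) \<noteq> L (insert A (up A))}"

text \<open>A flow step crosses an edge whose two ends have the same limit, so it never crosses a
  kept edge.\<close>

lemma kept_mem_nxt:
  assumes B: "B \<in> kept" and v: "v \<in> VT"
  shows "B \<in> nxt v \<longleftrightarrow> B \<in> v"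
proof (cases "root v")
  case True
  then show ?thesis by (simp add: nxt_root)
next
  case False
  obtain A where A: "nb A v (nxt v)" using nxt_nb[OF v False] by blast
  then have "L (up A) = L (insert A (up A))" using L_nxt[OF v] by (auto simp: nb_def)
  then have "B \<noteq> A" using B by (auto simp: kept_def)
  then have "B \<notin> sd v (nxt v)" using nb_sd[OF A] by simp
  then show ?thesis by (auto simp: sd_def)
qed

lemma kept_mem_L:
  assumes B: "B \<in> kept" and v: "v \<in> VT"
  shows "B \<in> L v \<longleftrightarrow> B \<in> v"
proof -
  have "B \<in> (nxt ^^ k) v \<longleftrightarrow> B \<in> v" for k
    by (induction k) (simp_all add: kept_mem_nxt[OF B] iter_VT[OF v])
  then show ?thesis unfolding L_def by blast
qed

text \<open>On roots \<open>f\<close> is injective with left inverse \<open>h\<close>. The roots are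
  thus copied into W, and the image of \<open>r\<close> is the set of w with
  \<open>f (h w) = w\<close>.\<close>

definition r where "r v = f (L v)"

lemma r_W: "v \<in> VT \<Longrightarrow> r v \<in> W" unfolding r_def by (intro f L_VT)

lemma h_r: "v \<in> VT \<Longrightarrow> h (r v) = L v" using root_L by (simp add: r_def root_def)

lemma f_h_r: "v \<in> VT \<Longrightarrow> f (h (r v)) = r v" by (simp add: h_r) (simp add: r_def)

lemma r_h: "w \<in> W \<Longrightarrow> f (h w) = w \<Longrightarrow> r (h w) = w"
  by (simp add: r_def L_root root_def)

lemma r_move: "\<lbrakk>v \<in> VT; g \<in> carrier G\<rbrakk> \<Longrightarrow> r (move g v) = a g (r v)"
  by (simp add: r_def L_move f(4) L_VT)

lemma kept_mem_h_r: "\<lbrakk>B \<in> kept; v \<in> VT\<rbrakk> \<Longrightarrow> B \<in> h (r v) \<longleftrightarrow> B \<in> v"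
  by (simp add: h_r kept_mem_L)

text \<open>Arcs from kept edges start at the image of a midpoint, so their direction is respected
  even by elements exchanging A and its complement. Elements of W outside the image of
  \<open>r\<close> become leaves.\<close>

definition T :: "('w, 'w \<times> 'w) pre_digraph" where
  "T = \<lparr>verts = W, arcs = (\<lambda>A. (r (up A), r (insert A (up A)))) ` kept \<union>
      (\<lambda>w. (w, r (h w))) ` {w \<in> W. f (h w) \<noteq> w}, tail = fst, head = snd\<rparr>"

lemma T_simps: "verts T = W" "tail T = fst" "head T = snd" by (simp_all add: T_def)

lemma arcs_T_cases:
  assumes "e \<in> arcs T"
  obtains A where "A \<in> kept" "e = (r (up A), r (insert A (up A)))"
  | w where "w \<in> W" "f (h w) \<noteq> w" "e = (w, r (h w))"
  using assms by (auto simp: T_def)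

lemma kept_E: "A \<in> kept \<Longrightarrow> A \<in> \<E>" by (simp add: kept_def)

lemma arcs_T_sub: "arcs T \<subseteq> W \<times> W"
  by (auto elim!: arcs_T_cases intro!: r_W up_VT h dest: kept_E)

sublocale T: wf_digraph T
  using arcs_T_sub by unfold_locales (auto simp: T_simps)

text \<open>For a kept A the cut consists of the w with A in \<open>h w\<close>: passing from v to
  \<open>h (r v)\<close> preserves membership of A, so only the arc of A crosses. A pendant vertex
  lies outside the image of \<open>r\<close> and is cut off alone.\<close>

lemma bridges_T: "T.bridges"
  unfolding T.bridges_def
proof
  fix e assume "e \<in> arcs T"
  then show "\<exists>P. (tail T e \<in> P) \<noteq> (head T e \<in> P) \<and>
      (\<forall>e'\<in>arcs T. e' \<noteq> e \<longrightarrow> (tail T e' \<in> P) = (head T e' \<in> P))"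
  proof (cases rule: arcs_T_cases)
    case (1 A)
    note AE = kept_E[OF 1(1)] and mem = kept_mem_h_r[OF 1(1)]
    show ?thesis
    proof (intro exI[of _ "{w. A \<in> h w}"] conjI ballI impI)
      show "(tail T e \<in> {w. A \<in> h w}) \<noteq> (head T e \<in> {w. A \<in> h w})"
        using mem[OF up_VT(1)[OF AE]] mem[OF up_VT(2)[OF AE]] not_mem_up[OF AE] 1 by (simp add: T_simps)
      fix e' assume "e' \<in> arcs T" "e' \<noteq> e"
      then show "(tail T e' \<in> {w. A \<in> h w}) = (head T e' \<in> {w. A \<in> h w})"
      proof (cases rule: arcs_T_cases)
        case (1 B)
        then have "B \<noteq> A" using \<open>e' \<noteq> e\<close> \<open>e = _\<close> by blast
        then show ?thesis
          using mem[OF up_VT(1)[OF kept_E[OF 1(1)]]] mem[OF up_VT(2)[OF kept_E[OF 1(1)]]] 1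
          by (simp add: T_simps)
      next
        case (2 w)
        then show ?thesis using mem[OF h(1)] by (simp add: T_simps)
      qed
    qed
  next
    case (2 w)
    have hr: "r v \<noteq> w" if "v \<in> VT" for v using f_h_r[OF that] 2(2) by auto
    show ?thesis
    proof (intro exI[of _ "{w}"] conjI ballI impI)
      show "(tail T e \<in> {w}) \<noteq> (head T e \<in> {w})" using hr[OF h(1)] 2 by (simp add: T_simps)
      fix e' assume "e' \<in> arcs T" "e' \<noteq> e"
      then show "(tail T e' \<in> {w}) = (head T e' \<in> {w})"
      proof (cases rule: arcs_T_cases)
        case (1 B)
        then show ?thesis using hr up_VT kept_E by (simp add: T_simps)
      next
        case (2 w')
        then have "w' \<noteq> w" using \<open>e' \<noteq> e\<close> \<open>e = _\<close> by blast
        then show ?thesis using hr[OF h(1)] 2 by (simp add: T_simps)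
      qed
    qed
  qed
qed

lemma connected_T:
  assumes "u \<in> W" "w \<in> W"
  shows "\<exists>p. T.walk u p w"
proof -
  define R where "R u w \<longleftrightarrow> (\<exists>p. T.walk u p w)" for u w
  have R: "u \<in> W \<Longrightarrow> R u u" "R u v \<Longrightarrow> R v w \<Longrightarrow> R u w" "R u v \<Longrightarrow> R v u" for u v w
    unfolding R_def using T.walk_Nil[of u u] T.walk_append T.walk_rev by (auto simp: T_simps) blast+
  have arc: "R u w" if "(u, w) \<in> arcs T" for u w
  proof -
    have "T.walk u [((u, w), True)] w"
      using that arcs_T_sub by (auto simp: T.walk_Cons T.walk_Nil T.either_way_simps T_simps)
    then show ?thesis unfolding R_def by blast
  qed
  have VT_R: "R (r v) (r t)" if "v \<in> VT" "t \<in> VT" for v t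
  proof (rule VT_connected[OF that, of "\<lambda>v t. R (r v) (r t)"])
    show "R (r (up A)) (r (insert A (up A)))" if "A \<in> \<E>" for A
    proof (cases "A \<in> kept")
      case True
      then show ?thesis by (intro arc) (auto simp: T_def)
    next
      case False
      then have "r (up A) = r (insert A (up A))" using that by (simp add: kept_def r_def)
      then show ?thesis using R(1) r_W up_VT(1)[OF that] by metis
    qed
    show "R (r u) (r u)" if "u \<in> VT" for u using R(1) r_W[OF that] .
    show "R (r u) (r w)" if "R (r u) (r v)" "R (r v) (r w)" for u v w using R(2) that .
    show "R (r v) (r u)" if "R (r u) (r v)" for u v using R(3) that .
  qed
  have "R w (r (h w))" if "w \<in> W" for w
  proof (cases "f (h w) = w")
    case True
    then show ?thesis using r_h that R(1) by simp
  next
    case False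
    then show ?thesis using that by (intro arc) (auto simp: T_def)
  qed
  then have "R u (r (h u))" "R (r (h w)) w" using assms R(3) by simp_all
  then have "R u w" using R(2) VT_R[OF h(1)[OF assms(1)] h(1)[OF assms(2)]] by metis
  then show ?thesis by (simp add: R_def)
qed

lemma vertex_set: "vertex_set_of_G_tree G W (\<lambda>g. restrict (a g) W)"
proof -
  define b where "b g = (\<lambda>(x, y). (a g x, a g y))" for g
  have b_arcs: "b g e \<in> arcs T" if g: "g \<in> carrier G" and e: "e \<in> arcs T" for g e
    using e
  proof (cases rule: arcs_T_cases)
    case (1 A)
    have AE: "A \<in> \<E>" using kept_E[OF 1(1)] .
    note VT = up_VT[OF AE]
    have m: "move g (up A) = up (lmul g A)" "move g (insert A (up A)) = insert (lmul g A) (up (lmul g A))"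
      using move_up[OF g AE] by simp_all
    have "L (up (lmul g A)) \<noteq> L (insert (lmul g A) (up (lmul g A)))"
    proof
      assume "L (up (lmul g A)) = L (insert (lmul g A) (up (lmul g A)))"
      then have "move g (L (up A)) = move g (L (insert A (up A)))"
        using L_move[OF VT(1) g] L_move[OF VT(2) g] m by simp
      then have "L (up A) = L (insert A (up A))"
        using acts_inv(1)[OF acts_VT g] L_VT VT by metis
      then show False using 1(1) by (simp add: kept_def)
    qed
    then have "lmul g A \<in> kept" using lmul_mem[OF g AE] by (simp add: kept_def)
    moreover have "b g e = (r (up (lmul g A)), r (insert (lmul g A) (up (lmul g A))))"
      using r_move[OF VT(1) g] r_move[OF VT(2) g] m 1(2) by (simp add: b_def)
    ultimately show ?thesis by (auto simp: T_def)
  next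
    case (2 w)
    have gw: "a g w \<in> W" using actsD(1)[OF acts_W g 2(1)] .
    have hg: "h (a g w) = move g (h w)" using h(2)[OF 2(1) g] .
    have hw: "h w \<in> VT" using h(1)[OF 2(1)] .
    have "f (h (a g w)) \<noteq> a g w"
    proof
      assume "f (h (a g w)) = a g w"
      then have "a g (f (h w)) = a g w" using hg f(4)[OF hw g] by simp
      then show False using acts_inv(1)[OF acts_W g] f(1)[OF hw] 2 by metis
    qed
    moreover have "b g e = (a g w, r (h (a g w)))" using 2(3) hg r_move[OF hw g] by (simp add: b_def)
    ultimately show ?thesis using gw by (auto simp: T_def)
  qed
  have acts_arcs: "acts G (arcs T) b"
    unfolding acts_def using b_arcs arcs_T_sub actsD(2,3)[OF acts_W] by (auto simp: b_def)
  have "tree T"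
    using T.tree_of_bridges[OF bridges_T] W_ne connected_T by (simp add: T_simps)
  moreover have "G_graph G T (\<lambda>g. restrict (a g) W) (\<lambda>g. restrict (b g) (arcs T))"
  proof (intro G_graph.intro G_graph_axioms.intro T.wf_digraph_axioms)
    show "group_action G (verts T) (\<lambda>g. restrict (a g) W)"
      using group_action_restrict[OF acts_W] by (simp add: T_simps)
    show "group_action G (arcs T) (\<lambda>g. restrict (b g) (arcs T))"
      by (rule group_action_restrict[OF acts_arcs])
    fix g e assume "g \<in> carrier G" "e \<in> arcs T"
    moreover have "fst e \<in> W" "snd e \<in> W" using arcs_T_sub \<open>e \<in> arcs T\<close> by auto
    ultimately show "tail T (restrict (b g) (arcs T) e) = restrict (a g) W (tail T e)"
      "head T (restrict (b g) (arcs T) e) = restrict (a g) W (head T e)"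
      by (auto simp: T_simps b_def split: prod.split)
  qed
  ultimately have "G_tree G T (\<lambda>g. restrict (a g) W) (\<lambda>g. restrict (b g) (arcs T))"
    by (simp add: G_tree_def)
  then show ?thesis unfolding vertex_set_of_G_tree_def using T_simps(1) by blast
qed

end

section \<open>Almost equality classes\<close>

text \<open>The elements carrying x to a given point form a coset of the stabilizer or the empty
  set.\<close>

lemma (in group) finite_transporter:
  assumes a: "acts G X a" and x: "x \<in> X" and f: "finite (stabilizer G a x)" and D: "finite D"
  shows "finite {g \<in> carrier G. a g x \<in> D}"
proof -
  have "finite {g \<in> carrier G. a g x = d}" for d
  proof (cases "\<exists>k\<in>carrier G. a k x = d")
    case True
    then obtain k where k: "k \<in> carrier G" "a k x = d" by blast
    have "{g \<in> carrier G. a g x = d} \<subseteq> (\<lambda>s. k \<otimes> s) ` stabilizer G a x"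
    proof
      fix g assume "g \<in> {g \<in> carrier G. a g x = d}"
      then have g: "g \<in> carrier G" "a g x = d" by auto
      have "a (inv k \<otimes> g) x = x"
        using actsD(3)[OF a, of "inv k" g x] acts_inv(1)[OF a k(1) x] g k x by simp
      then have "inv k \<otimes> g \<in> stabilizer G a x" using g k by (simp add: stabilizer_def)
      moreover have "g = k \<otimes> (inv k \<otimes> g)" using g k by (simp flip: m_assoc)
      ultimately show "g \<in> (\<lambda>s. k \<otimes> s) ` stabilizer G a x" by blast
    qed
    then show ?thesis using f by (auto intro: finite_subset)
  next
    case False
    then have "{g \<in> carrier G. a g x = d} = {}" by auto
    then show ?thesis by (simp only: finite.emptyI)
  qed
  then have "finite (\<Union>d\<in>D. {g \<in> carrier G. a g x = d})" using D by blast
  then show ?thesis by (rule rev_finite_subset) auto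
qed

lemma (in group) finite_transporter_inv:
  assumes "acts G X a" "x \<in> X" "finite (stabilizer G a x)" "finite D"
  shows "finite {g \<in> carrier G. a (inv g) x \<in> D}"
proof -
  have "{g \<in> carrier G. a (inv g) x \<in> D} \<subseteq> m_inv G ` {g \<in> carrier G. a g x \<in> D}"
  proof
    fix g assume "g \<in> {g \<in> carrier G. a (inv g) x \<in> D}"
    then show "g \<in> m_inv G ` {g \<in> carrier G. a g x \<in> D}" by (intro image_eqI[of _ _ "inv g"]) auto
  qed
  then show ?thesis using finite_transporter[OF assms] by (auto intro: finite_subset)
qed

locale almost_stable = fg_group G S for G :: "('g, 'm) monoid_scheme" (structure) and S +
  fixes E :: "'e set" and \<phi> and Z :: "'z set" and \<psi> and w0
  assumes acts_E: "acts G E \<phi>" and acts_Z: "acts G Z \<psi>"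
    and acts_maps: "acts G (E \<rightarrow>\<^sub>E Z) (maps_action G E \<phi> Z \<psi>)"
    and finite_stab: "e \<in> E \<Longrightarrow> finite (stabilizer G \<phi> e)"
    and stab_fix: "e \<in> E \<Longrightarrow> \<exists>z\<in>Z. stabilizer G \<phi> e \<subseteq> stabilizer G \<psi> z"
    and w0: "w0 \<in> E \<rightarrow>\<^sub>E Z"
    and w0_stable: "g \<in> carrier G \<Longrightarrow> finite {e \<in> E. w0 e \<noteq> maps_action G E \<phi> Z \<psi> g w0 e}"
begin

abbreviation M where "M \<equiv> maps_action G E \<phi> Z \<psi>"

definition df where "df v w = {e \<in> E. v e \<noteq> w e}"

definition W where "W = {w \<in> E \<rightarrow>\<^sub>E Z. finite (df w0 w)}"

lemma M_apply: "\<lbrakk>w \<in> E \<rightarrow>\<^sub>E Z; e \<in> E\<rbrakk> \<Longrightarrow> M g w e = \<psi> g (w (\<phi> (inv g) e))"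
  by (simp add: maps_action_def)

lemma M_in: "\<lbrakk>g \<in> carrier G; w \<in> E \<rightarrow>\<^sub>E Z\<rbrakk> \<Longrightarrow> M g w \<in> E \<rightarrow>\<^sub>E Z"
  using actsD(1)[OF acts_maps] .

lemma E_in: "\<lbrakk>g \<in> carrier G; e \<in> E\<rbrakk> \<Longrightarrow> \<phi> g e \<in> E" using actsD(1)[OF acts_E] .

lemma psi_inj: "\<lbrakk>g \<in> carrier G; y \<in> Z; z \<in> Z; \<psi> g y = \<psi> g z\<rbrakk> \<Longrightarrow> y = z"
  using acts_inv(1)[OF acts_Z] by metis

lemma val_in: "w \<in> E \<rightarrow>\<^sub>E Z \<Longrightarrow> e \<in> E \<Longrightarrow> w e \<in> Z" by auto

lemma M_neq_iff:
  assumes "g \<in> carrier G" "v \<in> E \<rightarrow>\<^sub>E Z" "w \<in> E \<rightarrow>\<^sub>E Z" "e \<in> E"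
  shows "M g v e \<noteq> M g w e \<longleftrightarrow> \<phi> (inv g) e \<in> df v w"
proof -
  have e: "\<phi> (inv g) e \<in> E" using assms E_in by simp
  show ?thesis
    using psi_inj[OF assms(1) val_in[OF assms(2) e] val_in[OF assms(3) e]] assms e
    by (auto simp: M_apply df_def)
qed

lemma df_trans: "df u w \<subseteq> df u v \<union> df v w" by (auto simp: df_def)

lemma df_E: "df u v \<subseteq> E" by (auto simp: df_def)

lemma W_maps: "w \<in> W \<Longrightarrow> w \<in> E \<rightarrow>\<^sub>E Z" by (simp add: W_def)

lemma w0_W: "w0 \<in> W" using w0 by (simp add: W_def df_def)

lemma df_M:
  assumes "g \<in> carrier G" "v \<in> E \<rightarrow>\<^sub>E Z" "w \<in> E \<rightarrow>\<^sub>E Z"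
  shows "df (M g v) (M g w) \<subseteq> \<phi> g ` df v w"
proof
  fix e assume e: "e \<in> df (M g v) (M g w)"
  then have eE: "e \<in> E" by (simp add: df_def)
  then have "\<phi> (inv g) e \<in> df v w" using e M_neq_iff[OF assms eE] by (simp add: df_def)
  moreover have "e = \<phi> g (\<phi> (inv g) e)" using acts_inv(2)[OF acts_E assms(1) eE] by simp
  ultimately show "e \<in> \<phi> g ` df v w" by blast
qed

lemma M_W:
  assumes g: "g \<in> carrier G" and w: "w \<in> W"
  shows "M g w \<in> W"
proof -
  have "finite (df (M g w0) (M g w))"
    using df_M[OF g w0 W_maps[OF w]] w by (auto simp: W_def intro: finite_subset)
  moreover have "finite (df w0 (M g w0))" using w0_stable[OF g] by (simp add: df_def)
  ultimately have "finite (df w0 (M g w))"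
    using df_trans[of w0 "M g w" "M g w0"] by (meson finite_UnI finite_subset)
  then show ?thesis using M_in[OF g W_maps[OF w]] by (simp add: W_def)
qed

lemma acts_W: "acts G W M"
  using M_W actsD(2,3)[OF acts_maps] W_maps unfolding acts_def by blast

section \<open>The orbit of \<open>w0\<close> as a family of functions on G\<close>

definition c where "c e x = M x w0 e"

lemma c_in: "\<lbrakk>e \<in> E; x \<in> carrier G\<rbrakk> \<Longrightarrow> c e x \<in> Z"
  unfolding c_def using M_in[OF _ w0] by (intro val_in)

lemma c_one: "c e \<one> = w0 e" unfolding c_def using actsD(2)[OF acts_maps w0] by simp

lemma c_mult:
  assumes "g \<in> carrier G" "x \<in> carrier G" "e \<in> E"
  shows "c e (g \<otimes> x) = \<psi> g (c (\<phi> (inv g) e) x)"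
  unfolding c_def using actsD(3)[OF acts_maps assms(1,2) w0] M_apply[OF M_in[OF assms(2) w0] assms(3), of g]
  by simp

lemma c_move:
  assumes "g \<in> carrier G" "x \<in> carrier G" "e \<in> E"
  shows "c (\<phi> g e) x = \<psi> g (c e (inv g \<otimes> x))"
  using c_mult[of g "inv g \<otimes> x" "\<phi> g e"] assms acts_inv(1)[OF acts_E, of g e] E_in
  by (simp flip: m_assoc)

lemma c_right_neq:
  assumes "u \<in> carrier G" "x \<in> carrier G" "e \<in> E"
  shows "c e x \<noteq> c e (x \<otimes> u) \<longleftrightarrow> \<phi> (inv x) e \<in> df w0 (M u w0)"
  unfolding c_def using actsD(3)[OF acts_maps assms(2,1) w0]
    M_neq_iff[OF assms(2) w0 M_in[OF assms(1) w0] assms(3)] by simp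

text \<open>Translated back by x, a change of \<open>c e\<close> from x to
  \<open>x \<otimes> u\<close> says that \<open>\<phi> (inv x) e\<close> lies in the finite set
  where w0 and its translate by u differ. Quasifreeness leaves finitely many such x.\<close>

lemma finite_c_bdry:
  assumes "u \<in> carrier G" "e \<in> E"
  shows "finite {x \<in> carrier G. c e x \<noteq> c e (x \<otimes> u)}"
proof -
  have "finite {x \<in> carrier G. \<phi> (inv x) e \<in> df w0 (M u w0)}"
    using w0_stable[OF assms(1)]
    by (intro finite_transporter_inv[OF acts_E assms(2) finite_stab[OF assms(2)]]) (simp add: df_def)
  then show ?thesis by (rule rev_finite_subset) (use c_right_neq assms in auto)
qed

definition D0 where "D0 = (\<Union>s\<in>S. df w0 (M s w0))"

lemma D0: "finite D0" "D0 \<subseteq> E"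
  using finite_S w0_stable S_sub df_E by (auto simp: D0_def df_def)

text \<open>No edge of the Cayley graph changes \<open>c e\<close> if the orbit of e misses
  \<open>D0\<close>. Hence only finitely many orbits in E carry nonconstant functions.\<close>

lemma c_constant:
  assumes e: "e \<in> E" and n: "\<And>x. x \<in> carrier G \<Longrightarrow> \<phi> (inv x) e \<notin> D0" and x: "x \<in> carrier G"
  shows "c e x = c e \<one>"
proof -
  have step: "c e (x \<otimes> s) = c e x" if "s \<in> S" "x \<in> carrier G" for s x
    using c_right_neq[of s x e] n[OF that(2)] that S_sub e by (auto simp: D0_def)
  have "\<forall>x\<in>carrier G. c e (x \<otimes> u) = c e x" if "u \<in> generate G S" for u
    using that
  proof (induction rule: generate.induct)
    case (inv s)
    have "c e (x \<otimes> inv s) = c e x" if x: "x \<in> carrier G" for x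
      using step[OF inv, of "x \<otimes> inv s"] x inv S_sub by (auto simp: m_assoc)
    then show ?case by blast
  next
    case (eng u v)
    then have "u \<in> carrier G" "v \<in> carrier G" using gen by auto
    then show ?case using eng.IH by (metis m_assoc m_closed)
  qed (auto simp: step)
  then have "c e (\<one> \<otimes> x) = c e \<one>" using x gen by blast
  then show ?thesis using x by simp
qed

text \<open>Changes occur along finitely many edges of the Cayley graph, so a value other than that
  at \<one> is taken at an end of such an edge. This leaves finitely many level sets even if Z is
  infinite.\<close>

lemma finite_c_image:
  assumes e: "e \<in> E"
  shows "finite (c e ` carrier G)"
proof -
  define B where "B = (\<Union>s\<in>S. {x \<in> carrier G. c e x \<noteq> c e (x \<otimes> s)})"
  define I where "I = c e ` B \<union> (\<Union>s\<in>S. (\<lambda>x. c e (x \<otimes> s)) ` B)"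
  have "finite B" using finite_S finite_c_bdry[OF _ e] S_sub by (auto simp: B_def)
  then have fI: "finite I" using finite_S by (simp add: I_def)
  have "\<forall>x\<in>carrier G. c e (x \<otimes> u) \<in> insert (c e x) I" if "u \<in> generate G S" for u
    using that
  proof (induction rule: generate.induct)
    case (incl s)
    have "c e (x \<otimes> s) \<in> insert (c e x) I" if x: "x \<in> carrier G" for x
      using x incl by (cases "x \<in> B") (auto simp: I_def B_def)
    then show ?case by blast
  next
    case (inv s)
    have "c e (x \<otimes> inv s) \<in> insert (c e x) I" if x: "x \<in> carrier G" for x
    proof (cases "x \<otimes> inv s \<in> B")
      case False
      have s: "s \<in> carrier G" using inv S_sub by blast
      have "x \<otimes> inv s \<otimes> s = x" using x s by (simp add: m_assoc)
      then have "c e (x \<otimes> inv s) = c e x" using False inv x s by (auto simp: B_def)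
      then show ?thesis by simp
    qed (simp add: I_def)
    then show ?case by blast
  next
    case (eng u v)
    have uv: "u \<in> carrier G" "v \<in> carrier G" using eng.hyps gen by auto
    have "c e (x \<otimes> (u \<otimes> v)) \<in> insert (c e x) I" if x: "x \<in> carrier G" for x
    proof -
      have "c e (x \<otimes> u \<otimes> v) \<in> insert (c e (x \<otimes> u)) I" "c e (x \<otimes> u) \<in> insert (c e x) I"
        using eng.IH uv x by auto
      then show ?thesis using uv x by (auto simp: m_assoc)
    qed
    then show ?case by blast
  qed auto
  then have "c e (\<one> \<otimes> x) \<in> insert (c e \<one>) I" if "x \<in> carrier G" for x using that gen by blast
  then have "c e ` carrier G \<subseteq> insert (c e \<one>) I" by auto
  then show ?thesis using fI by (auto intro: finite_subset)
qed

section \<open>The algebra determined by the functions \<open>c e\<close>\<close>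

definition cagree where "cagree F x y \<longleftrightarrow> (\<forall>e\<in>F. c e x = c e y)"

definition cset where
  "cset F A \<longleftrightarrow> finite F \<and> F \<subseteq> E \<and> A \<subseteq> carrier G \<and>
    (\<forall>x\<in>carrier G. \<forall>y\<in>carrier G. cagree F x y \<longrightarrow> (x \<in> A \<longleftrightarrow> y \<in> A))"

definition \<A> where "\<A> = {A. \<exists>F. cset F A}"

lemma csetD: "\<lbrakk>cset F A; x \<in> carrier G; y \<in> carrier G; cagree F x y\<rbrakk> \<Longrightarrow> x \<in> A \<longleftrightarrow> y \<in> A"
  by (simp add: cset_def)

lemma \<A>_sub: "A \<in> \<A> \<Longrightarrow> A \<subseteq> carrier G" by (auto simp: \<A>_def cset_def)

lemma \<A>_compl: "A \<in> \<A> \<Longrightarrow> carrier G - A \<in> \<A>"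
proof -
  assume "A \<in> \<A>"
  then obtain F where F: "cset F A" by (auto simp: \<A>_def)
  have "cset F (carrier G - A)" using F csetD[OF F] unfolding cset_def by blast
  then show ?thesis by (auto simp: \<A>_def)
qed

lemma \<A>_inter: "A \<in> \<A> \<Longrightarrow> B \<in> \<A> \<Longrightarrow> A \<inter> B \<in> \<A>"
proof -
  assume "A \<in> \<A>" "B \<in> \<A>"
  then obtain F K where F: "cset F A" and K: "cset K B" by (auto simp: \<A>_def)
  have ag: "cagree F x y" "cagree K x y" if "cagree (F \<union> K) x y" for x y
    using that by (auto simp: cagree_def)
  have "cset (F \<union> K) (A \<inter> B)"
    unfolding cset_def
  proof (intro conjI ballI impI)
    fix x y assume xy: "x \<in> carrier G" "y \<in> carrier G" "cagree (F \<union> K) x y"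
    show "x \<in> A \<inter> B \<longleftrightarrow> y \<in> A \<inter> B"
      using csetD[OF F xy(1,2) ag(1)[OF xy(3)]] csetD[OF K xy(1,2) ag(2)[OF xy(3)]] by simp
  qed (use F K in \<open>auto simp: cset_def\<close>)
  then show ?thesis by (auto simp: \<A>_def)
qed

lemma cset_lmul:
  assumes g: "g \<in> carrier G" and F: "cset F A"
  shows "cset (\<phi> g ` F) (lmul g A)"
  unfolding cset_def
proof (intro conjI ballI impI)
  have FE: "F \<subseteq> E" "finite F" and AG: "A \<subseteq> carrier G" using F by (auto simp: cset_def)
  show "finite (\<phi> g ` F)" "\<phi> g ` F \<subseteq> E" "lmul g A \<subseteq> carrier G"
    using FE E_in[OF g] lmul_sub[OF g AG] by auto
  fix x y assume xy: "x \<in> carrier G" "y \<in> carrier G" "cagree (\<phi> g ` F) x y"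
  have "c e (inv g \<otimes> x) = c e (inv g \<otimes> y)" if "e \<in> F" for e
  proof -
    have e: "e \<in> E" using that FE by blast
    have "c (\<phi> g e) x = c (\<phi> g e) y" using xy(3) that by (simp add: cagree_def)
    then show ?thesis
      using c_move[OF g _ e] xy g psi_inj[OF g] c_in[OF e] by simp
  qed
  then have "cagree F (inv g \<otimes> x) (inv g \<otimes> y)" by (simp add: cagree_def)
  then have "inv g \<otimes> x \<in> A \<longleftrightarrow> inv g \<otimes> y \<in> A" using csetD[OF F] xy g by simp
  then show "x \<in> lmul g A \<longleftrightarrow> y \<in> lmul g A" using lmul_iff[OF g AG] xy by simp
qed

lemma \<A>_lmul: "g \<in> carrier G \<Longrightarrow> A \<in> \<A> \<Longrightarrow> lmul g A \<in> \<A>"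
  unfolding \<A>_def using cset_lmul by blast

lemma \<A>_almost_inv:
  assumes "A \<in> \<A>"
  shows "almost_inv A"
proof -
  obtain F where F: "cset F A" using assms by (auto simp: \<A>_def)
  have "finite (bdry s A)" if "s \<in> S" for s
  proof (rule finite_subset)
    have s: "s \<in> carrier G" using that S_sub by blast
    show "bdry s A \<subseteq> (\<Union>e\<in>F. {x \<in> carrier G. c e x \<noteq> c e (x \<otimes> s)})"
    proof
      fix x assume x: "x \<in> bdry s A"
      then have xG: "x \<in> carrier G" "x \<otimes> s \<in> carrier G" using s by (auto simp: bdry_def)
      have "\<not> cagree F x (x \<otimes> s)" using csetD[OF F xG] x by (auto simp: bdry_def)
      then show "x \<in> (\<Union>e\<in>F. {x \<in> carrier G. c e x \<noteq> c e (x \<otimes> s)})" using xG by (auto simp: cagree_def)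
    qed
    show "finite (\<Union>e\<in>F. {x \<in> carrier G. c e x \<noteq> c e (x \<otimes> s)})"
      using F finite_c_bdry[OF s] by (auto simp: cset_def)
  qed
  then show ?thesis using \<A>_sub[OF assms] by (simp add: almost_inv_def)
qed

sublocale submodular_algebra "carrier G" \<A> energy
proof
  show "energy (A \<inter> B) + energy (A \<union> B) < energy A + energy B"
    if "A \<in> \<A>" "B \<in> \<A>" "\<not> A \<subseteq> B" "\<not> B \<subseteq> A" for A B
    using energy_submodular \<A>_almost_inv that by blast
  show "\<not> (\<forall>i. energy (F (Suc i)) < energy (F i))" if "\<And>i. F i \<in> \<A>" for F :: "nat \<Rightarrow> 'g set"
    using energy_no_descent \<A>_almost_inv that by blast
qed (use \<A>_sub \<A>_compl \<A>_inter energy_compl in auto)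

lemma determined_lmul:
  assumes g: "g \<in> carrier G" and A: "A \<in> determined (carrier G) Y" and Y: "\<And>B. B \<in> Y \<Longrightarrow> B \<subseteq> carrier G"
  shows "lmul g A \<in> determined (carrier G) (lmul g ` Y)"
proof -
  obtain F where F: "finite F" "F \<subseteq> Y"
    "\<And>x y. \<lbrakk>x \<in> carrier G; y \<in> carrier G; agree F x y\<rbrakk> \<Longrightarrow> x \<in> A \<longleftrightarrow> y \<in> A"
    by (rule determinedE[OF A]) blast
  have AG: "A \<subseteq> carrier G" by (rule determined_subset[OF A])
  show ?thesis
  proof (rule determinedI)
    show "lmul g A \<subseteq> carrier G" by (rule lmul_sub[OF g AG])
    show "finite (lmul g ` F)" "lmul g ` F \<subseteq> lmul g ` Y" using F(1,2) by auto
    fix x y assume xy: "x \<in> carrier G" "y \<in> carrier G" and ag: "agree (lmul g ` F) x y"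
    have "inv g \<otimes> x \<in> B \<longleftrightarrow> inv g \<otimes> y \<in> B" if "B \<in> F" for B
    proof -
      have "x \<in> lmul g B \<longleftrightarrow> y \<in> lmul g B" using agreeD[OF ag] that by blast
      moreover have "B \<subseteq> carrier G" using that F(2) Y by blast
      ultimately show ?thesis using lmul_iff[OF g] xy by simp
    qed
    then have "agree F (inv g \<otimes> x) (inv g \<otimes> y)" by (simp add: agree_def)
    then have "inv g \<otimes> x \<in> A \<longleftrightarrow> inv g \<otimes> y \<in> A" using F(3) xy g by simp
    then show "x \<in> lmul g A \<longleftrightarrow> y \<in> lmul g A" using lmul_iff[OF g AG] xy by simp
  qed
qed

lemma indecomposable_\<A>: "A \<in> indecomposable \<Longrightarrow> A \<in> \<A>" by (simp add: indecomposable_def)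

lemma lmul_inv: "\<lbrakk>g \<in> carrier G; A \<subseteq> carrier G\<rbrakk> \<Longrightarrow> lmul (inv g) (lmul g A) = A"
  using lmul_mult[of "inv g" g A] lmul_one by simp

text \<open>Translation preserves \<open>\<A>\<close> and the energy, so a decomposition of the
  translate could be translated back.\<close>

lemma indecomposable_lmul:
  assumes g: "g \<in> carrier G" and A: "A \<in> indecomposable"
  shows "lmul g A \<in> indecomposable"
proof (rule ccontr)
  have AA: "A \<in> \<A>" "A \<subseteq> carrier G" using A indecomposable_\<A> sub by auto
  let ?Y = "{B \<in> \<A>. energy B < energy A}"
  assume "lmul g A \<notin> indecomposable"
  then have "lmul g A \<in> determined (carrier G) ?Y"
    using \<A>_lmul[OF g AA(1)] energy_lmul[OF g AA(2)] by (simp add: indecomposable_def)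
  then have "lmul (inv g) (lmul g A) \<in> determined (carrier G) (lmul (inv g) ` ?Y)"
    using g by (intro determined_lmul) (auto dest: sub)
  then have "A \<in> determined (carrier G) (lmul (inv g) ` ?Y)" using lmul_inv[OF g AA(2)] by simp
  then have "A \<in> determined (carrier G) ?Y"
  proof (rule determined_trans)
    fix C assume "C \<in> lmul (inv g) ` ?Y"
    then have "C \<in> ?Y" using g \<A>_lmul energy_lmul[OF _ sub] by auto
    then show "C \<in> determined (carrier G) ?Y" using sub by (intro determined_base) auto
  qed
  then show False using A by (simp add: indecomposable_def)
qed

text \<open>The level sets of \<open>c e\<close> belong to \<open>\<A>\<close>, so each is
  determined by finitely many indecomposable sets, and only finitely many of them are
  nonempty.\<close>

lemma c_determined:
  assumes e: "e \<in> E"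
  shows "\<exists>F. finite F \<and> F \<subseteq> indecomposable \<and>
    (\<forall>x\<in>carrier G. \<forall>y\<in>carrier G. agree F x y \<longrightarrow> c e x = c e y)"
proof -
  have "\<exists>F. finite F \<and> F \<subseteq> indecomposable \<and>
      (\<forall>x\<in>carrier G. \<forall>y\<in>carrier G. agree F x y \<longrightarrow> (c e x = z \<longleftrightarrow> c e y = z))" for z
  proof -
    let ?A = "{x \<in> carrier G. c e x = z}"
    have "cset {e} ?A" using e by (auto simp: cset_def cagree_def)
    then have "?A \<in> determined (carrier G) indecomposable"
      by (intro determined_indecomposable) (auto simp: \<A>_def)
    then obtain F where F: "finite F" "F \<subseteq> indecomposable"
      "\<And>x y. \<lbrakk>x \<in> carrier G; y \<in> carrier G; agree F x y\<rbrakk> \<Longrightarrow> x \<in> ?A \<longleftrightarrow> y \<in> ?A"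
      by (rule determinedE) blast
    show ?thesis
    proof (intro exI[of _ F] conjI ballI impI F(1,2))
      fix x y assume "x \<in> carrier G" "y \<in> carrier G" "agree F x y"
      then show "c e x = z \<longleftrightarrow> c e y = z" using F(3)[of x y] by simp
    qed
  qed
  then obtain F where F: "\<forall>z. finite (F z) \<and> F z \<subseteq> indecomposable \<and>
      (\<forall>x\<in>carrier G. \<forall>y\<in>carrier G. agree (F z) x y \<longrightarrow> (c e x = z \<longleftrightarrow> c e y = z))"
    by (rule choice[OF allI, THEN exE])
  let ?U = "\<Union>z\<in>c e ` carrier G. F z"
  have "c e x = c e y" if xy: "x \<in> carrier G" "y \<in> carrier G" and ag: "agree ?U x y" for x y
  proof -
    have "agree (F (c e x)) x y" using ag xy(1) unfolding agree_def by blast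
    then have "c e x = c e x \<longleftrightarrow> c e y = c e x"
      using spec[OF F, of "c e x"] xy by blast
    then show ?thesis by simp
  qed
  moreover have "finite ?U" by (rule finite_UN_I[OF finite_c_image[OF e]]) (use F in blast)
  moreover have "?U \<subseteq> indecomposable" using F by blast
  ultimately show ?thesis by blast
qed

definition Fd where "Fd e = (SOME F. finite F \<and> F \<subseteq> indecomposable \<and>
    (\<forall>x\<in>carrier G. \<forall>y\<in>carrier G. agree F x y \<longrightarrow> c e x = c e y))"

lemma Fd:
  assumes "e \<in> E"
  shows "finite (Fd e)" "Fd e \<subseteq> indecomposable"
    "\<lbrakk>x \<in> carrier G; y \<in> carrier G; agree (Fd e) x y\<rbrakk> \<Longrightarrow> c e x = c e y"
  using someI_ex[OF c_determined[OF assms], folded Fd_def] by blast+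

end

section \<open>The nested family and its finiteness properties\<close>

context almost_stable
begin

text \<open>Up to the action on Z, \<open>c\<close> at a translate of d is a translate of
  \<open>c d\<close>, and \<open>c e\<close> is constant when the orbit of e misses
  \<open>D0\<close>; hence the choice of places. Having finitely many orbits of sets yields both
  finite separation and a uniform bound on stabilizers.\<close>

definition F1 where "F1 = (\<Union>d\<in>D0. Fd d) \<union> (\<lambda>A. carrier G - A) ` (\<Union>d\<in>D0. Fd d)"

definition \<E> where "\<E> = (\<Union>g\<in>carrier G. lmul g ` F1)"

lemma F1: "finite F1" "F1 \<subseteq> indecomposable"
  using D0 Fd indecomposable_compl by (auto simp: F1_def subset_iff)

lemma \<E>_indecomposable: "A \<in> \<E> \<Longrightarrow> A \<in> indecomposable"
  using F1 indecomposable_lmul by (auto simp: \<E>_def)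

lemma indecomposable_sub: "A \<in> indecomposable \<Longrightarrow> A \<subseteq> carrier G"
  using indecomposable_\<A> sub by blast

lemma F1_sub: "F1 \<subseteq> \<E>"
proof
  fix B assume B: "B \<in> F1"
  have "lmul \<one> B = B" using lmul_one[of B] B F1 indecomposable_sub by blast
  then have "B \<in> lmul \<one> ` F1" using B image_eqI[of B "lmul \<one>" B F1] by simp
  then show "B \<in> \<E>" unfolding \<E>_def by blast
qed

lemma lmul_compl: "\<lbrakk>g \<in> carrier G; A \<subseteq> carrier G\<rbrakk> \<Longrightarrow> lmul g (carrier G - A) = carrier G - lmul g A"
  using lmul_iff[of g A] lmul_iff[of g "carrier G - A"] lmul_sub[of g A] lmul_sub[of g "carrier G - A"]
  by (intro Set.set_eqI) (auto 0 3)

lemma F1_compl: "A \<in> F1 \<Longrightarrow> carrier G - A \<in> F1"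
proof -
  assume "A \<in> F1"
  then consider "A \<in> (\<Union>d\<in>D0. Fd d)" | B where "B \<in> (\<Union>d\<in>D0. Fd d)" "A = carrier G - B"
    by (auto simp: F1_def)
  then show ?thesis
  proof cases
    case 2
    then have "B \<in> F1" by (simp add: F1_def)
    then have "carrier G - A = B" using 2 F1 indecomposable_sub by blast
    then show ?thesis using 2 by (simp add: F1_def)
  qed (simp add: F1_def)
qed

text \<open>If \<open>lmul g A\<close> contains x but not y, then k =
  \<open>inv g \<otimes> x\<close> lies in the finite set \<open>bdry (inv x \<otimes> y) A\<close>,
  and g is recovered as \<open>x \<otimes> inv k\<close>.\<close>

lemma \<E>_sep:
  assumes x: "x \<in> carrier G" and y: "y \<in> carrier G"
  shows "finite {A \<in> \<E>. x \<in> A \<and> y \<notin> A}"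
proof (rule finite_subset)
  let ?u = "inv x \<otimes> y"
  have u: "?u \<in> carrier G" using x y by simp
  show "{A \<in> \<E>. x \<in> A \<and> y \<notin> A} \<subseteq> (\<Union>A\<in>F1. (\<lambda>k. lmul (x \<otimes> inv k) A) ` bdry ?u A)"
  proof
    fix B assume "B \<in> {A \<in> \<E>. x \<in> A \<and> y \<notin> A}"
    then obtain g A where g: "g \<in> carrier G" "A \<in> F1" "B = lmul g A" "x \<in> B" "y \<notin> B"
      by (auto simp: \<E>_def)
    have AG: "A \<subseteq> carrier G" using g(2) F1 indecomposable_sub by blast
    let ?k = "inv g \<otimes> x"
    have k: "?k \<in> carrier G" "?k \<otimes> ?u = inv g \<otimes> y"
      using g(1) x y by (auto simp: m_assoc) (simp flip: m_assoc)
    have "?k \<in> bdry ?u A" using g k lmul_iff[OF g(1) AG] x y by (simp add: bdry_def)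
    moreover have "x \<otimes> inv ?k = g" using g(1) x by (simp add: inv_mult_group flip: m_assoc)
    then have "B = lmul (x \<otimes> inv ?k) A" using g(3) by simp
    ultimately show "B \<in> (\<Union>A\<in>F1. (\<lambda>k. lmul (x \<otimes> inv k) A) ` bdry ?u A)" using g(2) by blast
  qed
  have "finite (bdry ?u A)" if "A \<in> F1" for A
    using finite_bdry[OF u] \<A>_almost_inv indecomposable_\<A> F1 that by blast
  then show "finite (\<Union>A\<in>F1. (\<lambda>k. lmul (x \<otimes> inv k) A) ` bdry ?u A)" using F1 by blast
qed

sublocale tree: tree_set "carrier G" \<E>
proof
  show "A \<subseteq> carrier G" if "A \<in> \<E>" for A using \<E>_indecomposable indecomposable_sub that by blast
  show "A \<noteq> {}" if "A \<in> \<E>" for A using \<E>_indecomposable indecomposable_proper that by blast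
  show "carrier G - A \<in> \<E>" if "A \<in> \<E>" for A
  proof -
    obtain g B where g: "g \<in> carrier G" "B \<in> F1" "A = lmul g B" using \<open>A \<in> \<E>\<close> by (auto simp: \<E>_def)
    then have "carrier G - A = lmul g (carrier G - B)"
      using lmul_compl[OF g(1), of B] F1 indecomposable_sub by blast
    then show ?thesis using F1_compl[OF g(2)] g(1) by (auto simp: \<E>_def)
  qed
  show "A \<subseteq> B \<or> B \<subseteq> A \<or> A \<inter> B = {} \<or> A \<union> B = carrier G" if "A \<in> \<E>" "B \<in> \<E>" for A B
    using indecomposable_nested \<E>_indecomposable that by blast
qed (use \<E>_sep one_closed in auto)

lemma \<E>_lmul: "\<lbrakk>g \<in> carrier G; A \<in> \<E>\<rbrakk> \<Longrightarrow> lmul g A \<in> \<E>"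
proof -
  assume g: "g \<in> carrier G" and "A \<in> \<E>"
  then obtain k B where k: "k \<in> carrier G" "B \<in> F1" "A = lmul k B" by (auto simp: \<E>_def)
  then have "lmul g A = lmul (g \<otimes> k) B" using lmul_mult[OF g k(1), of B] F1 indecomposable_sub by blast
  then show "lmul g A \<in> \<E>" using k g by (auto simp: \<E>_def)
qed

lemma acts_\<E>: "acts G \<E> lmul"
  unfolding acts_def using \<E>_lmul lmul_one[OF tree.sub] lmul_mult[OF _ _ tree.sub] by simp

text \<open>The stabilizer acts freely by left multiplication on a boundary of A that is finite and,
  for a label leading from A to its complement, nonempty.\<close>

lemma finite_stab_indecomposable:
  assumes A: "A \<in> indecomposable"
  shows "finite (stabilizer G lmul A)"
proof -
  have AG: "A \<subseteq> carrier G" using A indecomposable_sub by blast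
  obtain x y where xy: "x \<in> A" "y \<in> carrier G" "y \<notin> A" using indecomposable_proper[OF A] AG by blast
  have xG: "x \<in> carrier G" using xy AG by blast
  let ?u = "inv x \<otimes> y"
  have u: "?u \<in> carrier G" "x \<otimes> ?u = y" using xG xy by (auto simp flip: m_assoc)
  have x: "x \<in> bdry ?u A" using xy xG u by (simp add: bdry_def)
  have "(\<lambda>h. h \<otimes> x) ` stabilizer G lmul A \<subseteq> bdry ?u A"
  proof
    fix k assume "k \<in> (\<lambda>h. h \<otimes> x) ` stabilizer G lmul A"
    then obtain h where h: "h \<in> carrier G" "lmul h A = A" "k = h \<otimes> x" by (auto simp: stabilizer_def)
    have "lmul h (bdry ?u A) = bdry ?u A" using bdry_lmul[OF h(1) AG u(1)] h(2) by simp
    moreover have "h \<otimes> x \<in> lmul h (bdry ?u A)" using x by (auto simp: lmul_def)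
    ultimately show "k \<in> bdry ?u A" using h(3) by simp
  qed
  moreover have "finite (bdry ?u A)"
    using finite_bdry[OF u(1)] \<A>_almost_inv indecomposable_\<A> A by blast
  ultimately have "finite ((\<lambda>h. h \<otimes> x) ` stabilizer G lmul A)" by (rule finite_subset)
  moreover have "inj_on (\<lambda>h. h \<otimes> x) (stabilizer G lmul A)"
    using xG by (intro inj_onI) (simp add: stabilizer_def)
  ultimately show ?thesis by (rule finite_imageD)
qed

text \<open>Stabilizers along an orbit are conjugate, and \<open>\<E>\<close> consists of finitely
  many orbits; the sum is a common bound.\<close>

lemma stab_bound:
  assumes "A \<in> \<E>"
  shows "finite (stabilizer G lmul A) \<and> card (stabilizer G lmul A) \<le> (\<Sum>B\<in>F1. card (stabilizer G lmul B))"
proof -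
  obtain g B where g: "g \<in> carrier G" "B \<in> F1" "A = lmul g B" using assms by (auto simp: \<E>_def)
  have BE: "B \<in> \<E>" using g(2) F1_sub by blast
  have fB: "finite (stabilizer G lmul B)" using finite_stab_indecomposable g(2) F1 by blast
  have "inj_on (\<lambda>k. inv g \<otimes> k \<otimes> g) (stabilizer G lmul A)"
    using g(1) by (intro inj_onI) (simp add: stabilizer_def)
  moreover have "(\<lambda>k. inv g \<otimes> k \<otimes> g) ` stabilizer G lmul A \<subseteq> stabilizer G lmul B"
  proof
    fix k assume "k \<in> (\<lambda>k. inv g \<otimes> k \<otimes> g) ` stabilizer G lmul A"
    then obtain h where h: "h \<in> stabilizer G lmul A" "k = inv g \<otimes> h \<otimes> g" by blast
    then have "h \<in> carrier G" by (simp add: stabilizer_def)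
    then show "k \<in> stabilizer G lmul B" using stabilizer_act[OF acts_\<E> g(1) BE] h g(3) by blast
  qed
  ultimately have "card (stabilizer G lmul A) \<le> card (stabilizer G lmul B)"
    using fB by (rule card_inj_on_le)
  also have "\<dots> \<le> (\<Sum>B\<in>F1. card (stabilizer G lmul B))"
    using F1(1) g(2) by (intro member_le_sum) auto
  finally show ?thesis using finite_stab_indecomposable[OF \<E>_indecomposable[OF assms]] by simp
qed

lemma finite_stab_\<E>: "A \<in> \<E> \<Longrightarrow> finite (stabilizer G lmul A)" using stab_bound by blast

abbreviation mv where "mv g \<equiv> image (lmul g)"

text \<open>
  Every \<open>c e\<close> is determined by finitely many members of \<open>\<E>\<close>, and any given member is needed for only
  finitely many \<open>e\<close>.
\<close>

lemma determining_sets: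
  "\<exists>K. (\<forall>e\<in>E. finite (K e) \<and> K e \<subseteq> \<E> \<and>
      (\<forall>x\<in>carrier G. \<forall>y\<in>carrier G. agree (K e) x y \<longrightarrow> c e x = c e y)) \<and>
    (\<forall>Q. finite Q \<longrightarrow> finite {e \<in> E. K e \<inter> Q \<noteq> {}})"
proof -
  define P where "P e d g \<longleftrightarrow> g \<in> carrier G \<and> d \<in> D0 \<and> e = \<phi> g d" for e d g
  define moved where "moved e \<longleftrightarrow> (\<exists>d g. P e d g)" for e
  define d where "d e = fst (SOME (d, g). P e d g)" for e
  define g where "g e = snd (SOME (d, g). P e d g)" for e
  have dg: "g e \<in> carrier G" "d e \<in> D0" "e = \<phi> (g e) (d e)" if "moved e" for e
  proof -
    have "\<exists>z. case z of (d, g) \<Rightarrow> P e d g" using that by (auto simp: moved_def)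
    then have "case (SOME (d, g). P e d g) of (d, g) \<Rightarrow> P e d g" by (rule someI_ex)
    then have "P e (d e) (g e)" by (simp add: d_def g_def split_beta)
    then show "g e \<in> carrier G" "d e \<in> D0" "e = \<phi> (g e) (d e)" by (auto simp: P_def)
  qed
  \<comment> \<open>If e is a translate of some d in \<open>D0\<close>, the sets determining
    \<open>c d\<close> are translated along; otherwise \<open>c e\<close> is constant and determined
    by the empty family.\<close>
  define K where "K e = (if moved e then lmul (g e) ` Fd (d e) else {})" for e
  have FdF1: "Fd x \<subseteq> F1" if "x \<in> D0" for x using that by (auto simp: F1_def)
  have K: "finite (K e) \<and> K e \<subseteq> \<E> \<and>
      (\<forall>x\<in>carrier G. \<forall>y\<in>carrier G. agree (K e) x y \<longrightarrow> c e x = c e y)" if e: "e \<in> E" for e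
  proof (cases "moved e")
    case True
    note dg = dg[OF True]
    have dE: "d e \<in> E" using dg(2) D0 by blast
    have "c e x = c e y" if xy: "x \<in> carrier G" "y \<in> carrier G" and ag: "agree (K e) x y" for x y
    proof -
      have "agree (Fd (d e)) (inv (g e) \<otimes> x) (inv (g e) \<otimes> y)"
        unfolding agree_def
      proof
        fix B assume B: "B \<in> Fd (d e)"
        have "B \<subseteq> carrier G" using B Fd(2)[OF dE] indecomposable_sub by blast
        moreover have "x \<in> lmul (g e) B \<longleftrightarrow> y \<in> lmul (g e) B"
          using agreeD[OF ag, of "lmul (g e) B"] B True by (simp add: K_def)
        ultimately show "inv (g e) \<otimes> x \<in> B \<longleftrightarrow> inv (g e) \<otimes> y \<in> B"
          using lmul_iff[OF dg(1)] xy by simp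
      qed
      then have "c (d e) (inv (g e) \<otimes> x) = c (d e) (inv (g e) \<otimes> y)"
        using Fd(3)[OF dE] xy dg(1) by simp
      then have "c (\<phi> (g e) (d e)) x = c (\<phi> (g e) (d e)) y"
        using c_move[OF dg(1) _ dE] xy by simp
      then show ?thesis using dg(3) by simp
    qed
    moreover have "K e \<subseteq> \<E>" using True FdF1[OF dg(2)] dg(1) by (auto simp: K_def \<E>_def)
    moreover have "finite (K e)" using True Fd(1)[OF dE] by (simp add: K_def)
    ultimately show ?thesis by blast
  next
    case False
    have "\<phi> (inv x) e \<notin> D0" if x: "x \<in> carrier G" for x
    proof
      assume D: "\<phi> (inv x) e \<in> D0"
      have "e = \<phi> x (\<phi> (inv x) e)" using acts_inv(2)[OF acts_E x e] by simp
      then show False using False D x unfolding moved_def P_def by blast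
    qed
    then have const: "\<And>x. x \<in> carrier G \<Longrightarrow> c e x = c e \<one>" by (rule c_constant[OF e])
    show ?thesis
    proof (intro conjI ballI impI)
      show "finite (K e)" "K e \<subseteq> \<E>" using False by (simp_all add: K_def)
      show "c e x = c e y" if "x \<in> carrier G" "y \<in> carrier G" for x y
        by (rule trans[OF const[OF that(1)] const[OF that(2), symmetric]])
    qed
  qed
  \<comment> \<open>Members of \<open>\<E>\<close> have finite stabilizers, so finitely many g carry
    a given A into \<open>Q\<close>, and each of them accounts for one place
    \<open>\<phi> g d\<close>.\<close>
  have "finite {e \<in> E. K e \<inter> Q \<noteq> {}}" if Q: "finite Q" for Q
  proof (rule finite_subset)
    show "{e \<in> E. K e \<inter> Q \<noteq> {}} \<subseteq>
      (\<Union>d\<in>D0. \<Union>A\<in>Fd d. (\<lambda>g. \<phi> g d) ` {g \<in> carrier G. lmul g A \<in> Q})"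
    proof
      fix e assume "e \<in> {e \<in> E. K e \<inter> Q \<noteq> {}}"
      then have "K e \<inter> Q \<noteq> {}" by simp
      then obtain A where A: "moved e" "A \<in> Fd (d e)" "lmul (g e) A \<in> Q"
        by (auto simp: K_def split: if_splits)
      show "e \<in> (\<Union>d\<in>D0. \<Union>A\<in>Fd d. (\<lambda>g. \<phi> g d) ` {g \<in> carrier G. lmul g A \<in> Q})"
      proof (intro UN_I[OF dg(2)[OF A(1)]] UN_I[OF A(2)])
        show "e \<in> (\<lambda>h. \<phi> h (d e)) ` {h \<in> carrier G. lmul h A \<in> Q}"
          using dg[OF A(1)] A(3) by blast
      qed
    qed
    have "finite {g \<in> carrier G. lmul g A \<in> Q}" if "x \<in> D0" "A \<in> Fd x" for x A
    proof -
      have "A \<in> \<E>" using FdF1 F1_sub that by blast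
      then show ?thesis using finite_transporter[OF acts_\<E> _ finite_stab_\<E> Q] by blast
    qed
    then show "finite (\<Union>d\<in>D0. \<Union>A\<in>Fd d. (\<lambda>g. \<phi> g d) ` {g \<in> carrier G. lmul g A \<in> Q})"
      using D0 Fd(1) by (intro finite_UN_I) auto
  qed
  note fin = this
  show ?thesis
  proof (rule exI[of _ K], rule conjI)
    show "\<forall>e\<in>E. finite (K e) \<and> K e \<subseteq> \<E> \<and>
        (\<forall>x\<in>carrier G. \<forall>y\<in>carrier G. agree (K e) x y \<longrightarrow> c e x = c e y)"
      by (rule ballI, rule K)
    show "\<forall>Q. finite Q \<longrightarrow> finite {e \<in> E. K e \<inter> Q \<noteq> {}}"
      by (intro allI impI, rule fin)
  qed
qed

text \<open>w0 fails to be H-invariant only on a finite set. On its H-closure \<open>D\<close> it is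
  replaced by an equivariant map from E to Z, which exists since the stabilizer of each e fixes a
  point of Z.\<close>

lemma fixed_point_finite:
  assumes H: "subgroup H G" and fin: "finite H"
  shows "\<exists>w\<in>W. H \<subseteq> stabilizer G M w"
proof -
  have HG: "H \<subseteq> carrier G" using H by (rule subgroup.subset)
  obtain f where f: "\<forall>e\<in>E. f e \<in> Z \<and> True \<and> (\<forall>g\<in>carrier G. f (\<phi> g e) = \<psi> g (f e))"
    using equivariant_choice[OF acts_E acts_Z, of "\<lambda>_ _. True"] stab_fix by auto
  define D where "D = (\<Union>k\<in>H. \<Union>h\<in>H. \<phi> k ` df w0 (M h w0))"
  have finD: "finite D" using fin w0_stable HG by (auto simp: D_def df_def subset_iff)
  have D_inv: "\<phi> h e \<in> D" if h: "h \<in> H" and e: "e \<in> D" for h e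
  proof -
    obtain k l x where x: "k \<in> H" "l \<in> H" "x \<in> df w0 (M l w0)" "e = \<phi> k x" using e by (auto simp: D_def)
    have "x \<in> E" "h \<in> carrier G" "k \<in> carrier G" using x h HG df_E by blast+
    then have "\<phi> h e = \<phi> (h \<otimes> k) x" using actsD(3)[OF acts_E, of h k x] x(4) by simp
    then show ?thesis using x subgroup.m_closed[OF H h x(1)] unfolding D_def by blast
  qed
  define w where "w = (\<lambda>e\<in>E. if e \<in> D then f e else w0 e)"
  have wE: "w \<in> E \<rightarrow>\<^sub>E Z" using f w0 by (auto simp: w_def)
  have "df w0 w \<subseteq> D" by (auto simp: df_def w_def split: if_splits)
  then have "w \<in> W" using wE finD by (auto simp: W_def intro: finite_subset)
  moreover have "M h w = w" if h: "h \<in> H" for h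
  proof (rule PiE_ext[OF M_in wE])
    show hG: "h \<in> carrier G" "w \<in> E \<rightarrow>\<^sub>E Z" using h HG wE by auto
    fix e assume e: "e \<in> E"
    let ?e = "\<phi> (inv h) e"
    have ih: "inv h \<in> H" using subgroup.m_inv_closed[OF H h] .
    have eE: "?e \<in> E" and e': "\<phi> h ?e = e" using E_in e hG acts_inv(2)[OF acts_E hG(1) e] by auto
    have De: "?e \<in> D \<longleftrightarrow> e \<in> D" using D_inv[OF ih] D_inv[OF h] e' by metis
    have "\<psi> h (w ?e) = w e"
    proof (cases "e \<in> D")
      case True
      then have "w ?e = f ?e" "w e = f e" using De e eE by (auto simp: w_def)
      moreover have "f (\<phi> h ?e) = \<psi> h (f ?e)" using bspec[OF f eE] hG(1) by blast
      ultimately show ?thesis using e' by simp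
    next
      case False
      have "e \<notin> df w0 (M h w0)"
      proof
        assume "e \<in> df w0 (M h w0)"
        then have "\<phi> \<one> e \<in> D" using h subgroup.one_closed[OF H] unfolding D_def by blast
        then show False using False actsD(2)[OF acts_E e] by simp
      qed
      then have "w0 e = \<psi> h (w0 ?e)" using e M_apply[OF w0 e] by (simp add: df_def)
      then show ?thesis using False De e eE by (simp add: w_def)
    qed
    then show "M h w e = w e" using M_apply[OF wE e] by simp
  qed
  ultimately show ?thesis using HG unfolding stabilizer_def by blast
qed

end

lemma acts_Pow: "acts G X a \<Longrightarrow> acts G (Pow X) (\<lambda>g. image (a g))"
  unfolding acts_def by (auto simp: image_image subset_iff intro!: image_cong)

lemma (in group) subgroup_stabilizer:
  assumes a: "acts G X a" and x: "x \<in> X"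
  shows "subgroup (stabilizer G a x) G"
proof (rule subgroupI)
  show "stabilizer G a x \<noteq> {}" using actsD(2)[OF a x] by (auto simp: stabilizer_def)
  show "inv g \<in> stabilizer G a x" if "g \<in> stabilizer G a x" for g
    using that acts_inv(1)[OF a, of g x] x by (auto simp: stabilizer_def)
  show "g \<otimes> h \<in> stabilizer G a x" if "g \<in> stabilizer G a x" "h \<in> stabilizer G a x" for g h
    using that actsD(3)[OF a, of g h x] x by (auto simp: stabilizer_def)
qed (auto simp: stabilizer_def)

section \<open>Matching stabilizers in VT and in W\<close>

context almost_stable
begin

lemma VT_sub: "v \<in> tree.VT \<Longrightarrow> v \<subseteq> \<E>"
  using tree.VT_orientation tree.orientationD(1) by blast

lemma subgroup_stab_mv: "v \<in> tree.VT \<Longrightarrow> subgroup (stabilizer G mv v) G"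
  using subgroup_stabilizer[OF acts_Pow[OF acts_\<E>]] VT_sub by blast

lemma stab_mv_mem:
  assumes v: "v \<in> tree.VT" and h: "h \<in> stabilizer G mv v" and A: "A \<in> \<E>"
  shows "lmul h A \<in> v \<longleftrightarrow> A \<in> v"
proof
  have h': "h \<in> carrier G" "mv h v = v" using h by (auto simp: stabilizer_def)
  show "A \<in> v \<Longrightarrow> lmul h A \<in> v" using h'(2) by blast
  assume "lmul h A \<in> v"
  then obtain B where B: "B \<in> v" "lmul h A = lmul h B" using h'(2) by blast
  then have "B \<in> \<E>" using VT_sub[OF v] by blast
  then have "B = A" using lmul_inv[OF h'(1) tree.sub] A B(2) by metis
  then show "A \<in> v" using B by simp
qed

text \<open>
  When the stabilizer \<open>H\<close> of \<open>v\<close> is infinite, the orbit \<open>h \<mapsto> h w0\<close> converges pointwise as \<open>h\<close> tends to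
  infinity in \<open>H\<close>, because \<open>h \<in> A \<longleftrightarrow> A \<in> v\<close> for almost all \<open>h\<close>; the limit is fixed by \<open>H\<close>.
\<close>

lemma vertex_fixes:
  assumes v: "v \<in> tree.VT"
  shows "\<exists>w\<in>W. stabilizer G mv v \<subseteq> stabilizer G M w"
proof (cases "finite (stabilizer G mv v)")
  case True
  then show ?thesis using fixed_point_finite[OF subgroup_stab_mv[OF v]] by blast
next
  case inf: False
  define H where "H = stabilizer G mv v"
  have H: "subgroup H G" unfolding H_def by (rule subgroup_stab_mv[OF v])
  have HG: "H \<subseteq> carrier G" using H by (rule subgroup.subset)
  define Q where "Q = sd v (tree.principal \<one>)"
  have Q: "finite Q" using v by (simp add: Q_def tree.VT_def)
  \<comment> \<open>h in A means \<one> in \<open>lmul (inv h) A\<close>, and h fixes v. The inverse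
    of an exceptional h thus carries A into the finite set \<open>Q\<close>, and A has a finite
    stabilizer.\<close>
  have cofin: "finite {h \<in> H. (h \<in> A) \<noteq> (A \<in> v)}" if A: "A \<in> \<E>" for A
  proof (rule finite_subset)
    show "finite {h \<in> carrier G. lmul (inv h) A \<in> Q}"
      by (rule finite_transporter_inv[OF acts_\<E> A finite_stab_\<E>[OF A] Q])
    show "{h \<in> H. (h \<in> A) \<noteq> (A \<in> v)} \<subseteq> {h \<in> carrier G. lmul (inv h) A \<in> Q}"
    proof
      fix h assume "h \<in> {h \<in> H. (h \<in> A) \<noteq> (A \<in> v)}"
      then have h: "h \<in> H" "(h \<in> A) \<noteq> (A \<in> v)" by auto
      then have hG: "h \<in> carrier G" using HG by blast
      have ih: "inv h \<in> stabilizer G mv v" using subgroup.m_inv_closed[OF H h(1)] by (simp add: H_def)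
      have "\<one> \<in> lmul (inv h) A \<longleftrightarrow> h \<in> A"
        using lmul_iff[OF _ tree.sub[OF A], of "inv h" \<one>] hG by simp
      moreover have "lmul (inv h) A \<in> v \<longleftrightarrow> A \<in> v" by (rule stab_mv_mem[OF v ih A])
      moreover have "lmul (inv h) A \<in> \<E>" using \<E>_lmul[OF _ A] hG by simp
      ultimately have "lmul (inv h) A \<in> Q" using h(2) by (auto simp: Q_def sd_def tree.principal_def)
      then show "h \<in> {h \<in> carrier G. lmul (inv h) A \<in> Q}" using hG by simp
    qed
  qed
  obtain K where K: "\<forall>e\<in>E. finite (K e) \<and> K e \<subseteq> \<E> \<and>
      (\<forall>x\<in>carrier G. \<forall>y\<in>carrier G. agree (K e) x y \<longrightarrow> c e x = c e y)"
    and KQ: "\<forall>Q. finite Q \<longrightarrow> finite {e \<in> E. K e \<inter> Q \<noteq> {}}"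
    using determining_sets by (elim exE conjE)
  have Kc: "c e x = c e y" if "e \<in> E" "x \<in> carrier G" "y \<in> carrier G" "agree (K e) x y" for e x y
    using bspec[OF K that(1)] that(2-4) by blast
  define good where "good e h \<longleftrightarrow> h \<in> H \<and> (\<forall>A\<in>K e. h \<in> A \<longleftrightarrow> A \<in> v)" for e h
  have bad: "finite {h \<in> H. \<not> good e h}" if e: "e \<in> E" for e
  proof (rule finite_subset)
    show "{h \<in> H. \<not> good e h} \<subseteq> (\<Union>A\<in>K e. {h \<in> H. (h \<in> A) \<noteq> (A \<in> v)})" by (auto simp: good_def)
    show "finite (\<Union>A\<in>K e. {h \<in> H. (h \<in> A) \<noteq> (A \<in> v)})"
      using bspec[OF K e] cofin by (intro finite_UN_I) blast+
  qed
  have ex_good: "\<exists>h\<in>H. R h" if "finite {h \<in> H. \<not> R h}" for R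
  proof (rule ccontr)
    assume "\<not> ?thesis"
    then have "{h \<in> H. \<not> R h} = H" by blast
    then show False using that inf by (simp add: H_def)
  qed
  \<comment> \<open>The limit value: \<open>c e\<close> is constant on the good h, which are all but
    finitely many elements of H.\<close>
  define w where "w = (\<lambda>e\<in>E. c e (SOME h. good e h))"
  have w: "w e = c e h" if e: "e \<in> E" and h: "good e h" for e h
  proof -
    have g: "good e (SOME h. good e h)" using h by (rule someI)
    have "agree (K e) (SOME h. good e h) h" using g h by (auto simp: agree_def good_def)
    then have "c e (SOME h. good e h) = c e h" using g h HG by (intro Kc[OF e]) (auto simp: good_def)
    then show ?thesis using e by (simp add: w_def)
  qed
  have wE: "w \<in> E \<rightarrow>\<^sub>E Z"
  proof (rule PiE_I)
    fix e assume e: "e \<in> E"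
    obtain h where h: "good e h" using ex_good[OF bad[OF e]] by blast
    then have "h \<in> carrier G" using HG by (auto simp: good_def)
    then show "w e \<in> Z" using w[OF e h] c_in[OF e] by simp
  qed (simp add: w_def)
  \<comment> \<open>Outside this set v and \<open>principal \<one>\<close> agree on
    \<open>K e\<close>, so \<one> agrees with the good elements there and \<open>w e\<close> equals
    \<open>c e \<one>\<close>, which is \<open>w0 e\<close>.\<close>
  have "df w0 w \<subseteq> {e \<in> E. K e \<inter> Q \<noteq> {}}"
  proof
    fix e assume "e \<in> df w0 w"
    then have e: "e \<in> E" "c e \<one> \<noteq> w e" by (auto simp: df_def c_one)
    obtain h where h: "good e h" using ex_good[OF bad[OF e(1)]] by blast
    then have "h \<in> carrier G" using HG by (auto simp: good_def)
    then have "\<not> agree (K e) \<one> h" using Kc[OF e(1), of \<one> h] e w[OF e(1) h] by auto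
    then obtain A where A: "A \<in> K e" "(\<one> \<in> A) \<noteq> (A \<in> v)" using h by (auto simp: agree_def good_def)
    then have "A \<in> \<E>" using bspec[OF K e(1)] by blast
    then have "A \<in> Q" using A(2) by (auto simp: Q_def sd_def tree.principal_def)
    then show "e \<in> {e \<in> E. K e \<inter> Q \<noteq> {}}" using A e by blast
  qed
  then have "finite (df w0 w)" using KQ Q by (meson finite_subset)
  then have "w \<in> W" using wE by (simp add: W_def)
  moreover have "M k w = w" if k: "k \<in> H" for k
  proof (rule PiE_ext[OF M_in wE])
    show kG: "k \<in> carrier G" "w \<in> E \<rightarrow>\<^sub>E Z" using k HG wE by auto
    fix e assume e: "e \<in> E"
    let ?e = "\<phi> (inv k) e"
    have eE: "?e \<in> E" using E_in[OF _ e] kG by simp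
    \<comment> \<open>The comparison at e uses an h that is good for \<open>?e\<close> while
      \<open>k \<otimes> h\<close> is good for e; each condition excludes finitely many h.\<close>
    have "finite ((\<lambda>h. inv k \<otimes> h) ` {h \<in> H. \<not> good e h})" using bad[OF e] by blast
    moreover have "{h \<in> H. \<not> (good ?e h \<and> good e (k \<otimes> h))} \<subseteq>
        {h \<in> H. \<not> good ?e h} \<union> (\<lambda>h. inv k \<otimes> h) ` {h \<in> H. \<not> good e h}"
    proof
      fix h assume h: "h \<in> {h \<in> H. \<not> (good ?e h \<and> good e (k \<otimes> h))}"
      then have hG: "h \<in> carrier G" "h \<in> H" using HG by auto
      have "h \<in> (\<lambda>h. inv k \<otimes> h) ` {h \<in> H. \<not> good e h}" if "\<not> good e (k \<otimes> h)"
      proof (rule image_eqI)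
        show "h = inv k \<otimes> (k \<otimes> h)" using hG kG by (simp flip: m_assoc)
        show "k \<otimes> h \<in> {h \<in> H. \<not> good e h}" using that subgroup.m_closed[OF H k hG(2)] by simp
      qed
      then show "h \<in> {h \<in> H. \<not> good ?e h} \<union> (\<lambda>h. inv k \<otimes> h) ` {h \<in> H. \<not> good e h}" using h by blast
    qed
    ultimately have "finite {h \<in> H. \<not> (good ?e h \<and> good e (k \<otimes> h))}"
      using bad[OF eE] by (meson finite_UnI finite_subset)
    from ex_good[OF this] obtain h where h: "h \<in> H" "good ?e h" "good e (k \<otimes> h)" by blast
    have "M k w e = \<psi> k (c ?e h)" using M_apply[OF wE e] w[OF eE h(2)] by simp
    also have "\<dots> = c e (k \<otimes> h)" using c_mult[OF kG(1) _ e] h(1) HG by auto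
    also have "\<dots> = w e" using w[OF e h(3)] by simp
    finally show "M k w e = w e" .
  qed
  ultimately show ?thesis using HG unfolding H_def stabilizer_def by blast
qed

text \<open>A finite stabilizer H is invariant under its own left translations, so its centre is
  fixed. If H is infinite, the translates h w0 tend to h w = w, so each A in \<open>\<E>\<close>
  contains almost all or almost no elements of H; the sets of the first kind form the
  vertex.\<close>

lemma W_element_fixes:
  assumes w: "w \<in> W"
  shows "\<exists>v\<in>tree.VT. stabilizer G M w \<subseteq> stabilizer G mv v"
proof -
  define H where "H = stabilizer G M w"
  have H: "subgroup H G" unfolding H_def by (rule subgroup_stabilizer[OF acts_W w])
  have HG: "H \<subseteq> carrier G" using H by (rule subgroup.subset)
  have coset: "lmul h H = H" if h: "h \<in> H" for h
  proof
    show "lmul h H \<subseteq> H" using subgroup.m_closed[OF H h] by (auto simp: lmul_def)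
    show "H \<subseteq> lmul h H"
    proof
      fix k assume k: "k \<in> H"
      have "inv h \<otimes> k \<in> H" using subgroup.m_closed[OF H subgroup.m_inv_closed[OF H h] k] .
      then show "k \<in> lmul h H" using lmul_iff[OF _ HG] h k HG by blast
    qed
  qed
  show ?thesis
  proof (cases "finite H")
    case True
    have ne: "H \<noteq> {}" using subgroup.one_closed[OF H] by blast
    have "mv h (tree.centre H) = tree.centre H" if h: "h \<in> H" for h
    proof -
      interpret p: tree_set_auto "carrier G" \<E> "\<lambda>x. h \<otimes> x"
      proof
        have hG: "h \<in> carrier G" using h HG by blast
        show "bij_betw (\<lambda>x. h \<otimes> x) (carrier G) (carrier G)"
          using hG by (intro bij_betwI[where g = "\<lambda>x. inv h \<otimes> x"]) (auto simp flip: m_assoc)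
        have "A \<in> lmul h ` \<E>" if A: "A \<in> \<E>" for A
          using acts_inv(2)[OF acts_\<E> hG A] \<E>_lmul[OF _ A, of "inv h"] hG by (metis image_eqI inv_closed)
        then show "image (\<lambda>x. h \<otimes> x) ` \<E> = \<E>" using \<E>_lmul[OF hG] by (auto simp: lmul_def)
      qed
      show ?thesis using p.image_centre[OF HG] coset[OF h] by (simp add: lmul_def)
    qed
    then have "H \<subseteq> stabilizer G mv (tree.centre H)" using HG by (auto simp: stabilizer_def)
    then show ?thesis using tree.centre_VT[OF True ne HG] by (auto simp: H_def)
  next
    case inf: False
    \<comment> \<open>Since h fixes w, a difference between \<open>c e h\<close> and
      \<open>w e\<close> is one between h w0 and h w at e, hence one between w0 and w at
      \<open>\<phi> (inv h) e\<close>.\<close>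
    have cw: "finite {h \<in> H. c e h \<noteq> w e}" if e: "e \<in> E" for e
    proof (rule finite_subset)
      show "finite {h \<in> carrier G. \<phi> (inv h) e \<in> df w0 w}"
        using w by (intro finite_transporter_inv[OF acts_E e finite_stab[OF e]]) (simp add: W_def)
      show "{h \<in> H. c e h \<noteq> w e} \<subseteq> {h \<in> carrier G. \<phi> (inv h) e \<in> df w0 w}"
      proof
        fix h assume "h \<in> {h \<in> H. c e h \<noteq> w e}"
        then have h: "h \<in> carrier G" "M h w = w" "c e h \<noteq> w e" by (auto simp: H_def stabilizer_def)
        then have "M h w0 e \<noteq> M h w e" by (simp add: c_def)
        then show "h \<in> {h \<in> carrier G. \<phi> (inv h) e \<in> df w0 w}"
          using M_neq_iff[OF h(1) w0 W_maps[OF w] e] h(1) by simp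
      qed
    qed
    have cof: "finite {h \<in> H. \<exists>e\<in>F. c e h \<noteq> w e}" if "finite F" "F \<subseteq> E" for F
    proof -
      have "{h \<in> H. \<exists>e\<in>F. c e h \<noteq> w e} = (\<Union>e\<in>F. {h \<in> H. c e h \<noteq> w e})" by blast
      then show ?thesis using cw that by (simp only:) (intro finite_UN_I, auto)
    qed
    \<comment> \<open>A point x at which every \<open>c e\<close> with e in F has its limit value
      \<open>w e\<close> shows on which side of A almost all of H lies.\<close>
    have split: "finite {h \<in> H. (h \<in> A) \<noteq> (x \<in> A)}"
      if F: "cset F A" and x: "x \<in> carrier G" "\<And>e. e \<in> F \<Longrightarrow> c e x = w e" for F A x
    proof (rule finite_subset)
      show "finite {h \<in> H. \<exists>e\<in>F. c e h \<noteq> w e}" using F by (intro cof) (auto simp: cset_def)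
      show "{h \<in> H. (h \<in> A) \<noteq> (x \<in> A)} \<subseteq> {h \<in> H. \<exists>e\<in>F. c e h \<noteq> w e}"
      proof
        fix h assume "h \<in> {h \<in> H. (h \<in> A) \<noteq> (x \<in> A)}"
        then have h: "h \<in> H" "h \<in> carrier G" "(h \<in> A) \<noteq> (x \<in> A)" using HG by auto
        then have "\<not> cagree F h x" using csetD[OF F h(2) x(1)] by blast
        then show "h \<in> {h \<in> H. \<exists>e\<in>F. c e h \<noteq> w e}" using h(1) x(2) by (auto simp: cagree_def)
      qed
    qed
    define v where "v = {A \<in> \<E>. finite {h \<in> H. h \<notin> A}}"
    have both: False if "finite {h \<in> H. h \<notin> A}" "finite {h \<in> H. h \<in> A}" for A
    proof -
      have "H = {h \<in> H. h \<notin> A} \<union> {h \<in> H. h \<in> A}" by blast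
      then show False using that inf by (metis finite_UnI)
    qed
    have dec: "finite {h \<in> H. h \<notin> A} \<or> finite {h \<in> H. h \<in> A}" if A: "A \<in> \<E>" for A
    proof -
      obtain F where F: "cset F A" using indecomposable_\<A>[OF \<E>_indecomposable[OF A]] by (auto simp: \<A>_def)
      have "finite {h \<in> H. \<exists>e\<in>F. c e h \<noteq> w e}" using F by (intro cof) (auto simp: cset_def)
      then have "{h \<in> H. \<exists>e\<in>F. c e h \<noteq> w e} \<noteq> H" using inf by auto
      then obtain x where x: "x \<in> H" "\<And>e. e \<in> F \<Longrightarrow> c e x = w e" by blast
      have "finite {h \<in> H. (h \<in> A) \<noteq> (x \<in> A)}" using x HG by (intro split[OF F]) auto
      then show ?thesis by (cases "x \<in> A") auto
    qed
    have compl_eq: "{h \<in> H. h \<notin> carrier G - A} = {h \<in> H. h \<in> A}" for A using HG by blast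
    have o: "tree.orientation v"
      unfolding tree.orientation_def
    proof (intro conjI ballI impI)
      show "v \<subseteq> \<E>" by (auto simp: v_def)
      show "B \<in> v" if "A \<in> v" "B \<in> \<E>" "A \<subseteq> B" for A B
        using that unfolding v_def by (auto elim!: rev_finite_subset)
      show "carrier G - A \<notin> v" if "A \<in> v" for A
      proof
        assume "carrier G - A \<in> v"
        then have "finite {h \<in> H. h \<notin> carrier G - A}" by (simp only: v_def mem_Collect_eq)
        then show False using that both[of A] unfolding compl_eq by (simp add: v_def)
      qed
      \<comment> \<open>Every pair is decided by \<open>dec\<close>, so the midpoint clause holds
        vacuously.\<close>
      show "v = tree.up A" if "A \<in> \<E>" "A \<notin> v \<and> carrier G - A \<notin> v" for A
      proof -
        have "infinite {h \<in> H. h \<notin> A}" using that by (simp add: v_def)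
        moreover have "infinite {h \<in> H. h \<notin> carrier G - A}"
          using that tree.compl[OF that(1)] by (simp only: v_def mem_Collect_eq) simp
        ultimately show ?thesis using dec[OF that(1)] unfolding compl_eq by simp
      qed
    qed
    have "\<forall>B\<in>F1. \<exists>F. cset F B" using F1 indecomposable_\<A> by (auto simp: \<A>_def)
    then obtain F where F: "\<forall>B\<in>F1. cset (F B) B" by (rule bchoice[THEN exE])
    \<comment> \<open>If w0 and w agree at the places determining \<open>lmul g B\<close>, then
      \<one> can serve as x in \<open>split\<close>, and v agrees with
      \<open>principal \<one>\<close> on this set. Otherwise g carries a place of \<open>F B\<close>
      into the finite set \<open>df w0 w\<close>, which leaves finitely many g.\<close>
    have "finite (sd v (tree.principal \<one>))"
    proof (rule finite_subset)
      show "finite (\<Union>B\<in>F1. \<Union>e\<in>F B. (\<lambda>g. lmul g B) ` {g \<in> carrier G. \<phi> g e \<in> df w0 w})"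
      proof (intro finite_UN_I finite_imageI)
        show "finite F1" by (rule F1)
        show "finite (F B)" if "B \<in> F1" for B using bspec[OF F that] by (simp add: cset_def)
        show "finite {g \<in> carrier G. \<phi> g e \<in> df w0 w}" if "B \<in> F1" "e \<in> F B" for B e
        proof -
          have e: "e \<in> E" using bspec[OF F that(1)] that(2) by (auto simp: cset_def)
          show ?thesis using finite_transporter[OF acts_E e finite_stab[OF e]] w by (simp add: W_def)
        qed
      qed
      show "sd v (tree.principal \<one>) \<subseteq>
        (\<Union>B\<in>F1. \<Union>e\<in>F B. (\<lambda>g. lmul g B) ` {g \<in> carrier G. \<phi> g e \<in> df w0 w})"
      proof
        fix A assume A: "A \<in> sd v (tree.principal \<one>)"
        then have AE: "A \<in> \<E>" by (auto simp: sd_def v_def tree.principal_def)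
        then obtain g B where g: "g \<in> carrier G" "B \<in> F1" "A = lmul g B" by (auto simp: \<E>_def)
        have FB: "cset (F B) B" using F g(2) by blast
        have cs: "cset (\<phi> g ` F B) A" using cset_lmul[OF g(1) FB] g(3) by simp
        have "\<exists>e\<in>F B. \<phi> g e \<in> df w0 w"
        proof (rule ccontr)
          assume n: "\<not> ?thesis"
          have "c e \<one> = w e" if e: "e \<in> \<phi> g ` F B" for e
          proof -
            have "e \<in> E" using e cs by (auto simp: cset_def)
            moreover have "e \<notin> df w0 w" using e n by blast
            ultimately show ?thesis by (simp add: c_one df_def)
          qed
          then have fin: "finite {h \<in> H. (h \<in> A) \<noteq> (\<one> \<in> A)}" by (intro split[OF cs]) auto
          have "A \<in> v \<longleftrightarrow> \<one> \<in> A"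
          proof (cases "\<one> \<in> A")
            case True
            then show ?thesis using fin AE by (simp add: v_def)
          next
            case False
            then show ?thesis using fin AE both[of A] by (auto simp: v_def)
          qed
          then show False using A AE by (auto simp: sd_def tree.principal_def)
        qed
        then obtain e where e: "e \<in> F B" "\<phi> g e \<in> df w0 w" by blast
        show "A \<in> (\<Union>B\<in>F1. \<Union>e\<in>F B. (\<lambda>g. lmul g B) ` {g \<in> carrier G. \<phi> g e \<in> df w0 w})"
          by (rule UN_I[OF g(2)], rule UN_I[OF e(1)], rule image_eqI[of _ _ g]) (use g e in simp_all)
      qed
    qed
    then have vT: "v \<in> tree.VT" using tree.VT_I[OF o one_closed] by blast
    have sub: "mv k v \<subseteq> v" if k: "k \<in> H" for k
    proof
      fix B assume "B \<in> mv k v"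
      then obtain A where A: "A \<in> \<E>" "finite {h \<in> H. h \<notin> A}" "B = lmul k A" by (auto simp: v_def)
      have kG: "k \<in> carrier G" using k HG by blast
      have "{h \<in> H. h \<notin> B} \<subseteq> (\<lambda>h. k \<otimes> h) ` {h \<in> H. h \<notin> A}"
      proof
        fix h assume "h \<in> {h \<in> H. h \<notin> B}"
        then have h: "h \<in> H" "h \<notin> B" "h \<in> carrier G" using HG by auto
        have "inv k \<otimes> h \<in> H" using subgroup.m_closed[OF H subgroup.m_inv_closed[OF H k] h(1)] .
        moreover have "inv k \<otimes> h \<notin> A" using lmul_iff[OF kG tree.sub[OF A(1)] h(3)] h(2) A(3) by simp
        moreover have "h = k \<otimes> (inv k \<otimes> h)" using kG h(3) by (simp flip: m_assoc)
        ultimately show "h \<in> (\<lambda>h. k \<otimes> h) ` {h \<in> H. h \<notin> A}" by blast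
      qed
      then have "finite {h \<in> H. h \<notin> B}" using A(2) by (meson finite_imageI finite_subset)
      then show "B \<in> v" using \<E>_lmul[OF kG A(1)] A(3) by (simp add: v_def)
    qed
    have "mv k v = v" if k: "k \<in> H" for k
    proof
      show "mv k v \<subseteq> v" by (rule sub[OF k])
      have kG: "k \<in> carrier G" using k HG by blast
      have "mv k (mv (inv k) v) = v"
        using acts_inv(2)[OF acts_Pow[OF acts_\<E>] kG, of v] VT_sub[OF vT] by simp
      moreover have "mv (inv k) v \<subseteq> v" by (rule sub[OF subgroup.m_inv_closed[OF H k]])
      ultimately show "v \<subseteq> mv k v" by (metis image_mono)
    qed
    then have "H \<subseteq> stabilizer G mv v" using HG by (auto simp: stabilizer_def)
    then show ?thesis using vT by (auto simp: H_def)
  qed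
qed

lemma vertex_set_class:
  "vertex_set_of_G_tree G (almost_eq E Z `` {w0}) (\<lambda>g. restrict (M g) (almost_eq E Z `` {w0}))"
proof -
  interpret r: retraction_data G \<E> W M "\<Sum>B\<in>F1. card (stabilizer G lmul B)"
  proof
    show "lmul g A \<in> \<E>" if "g \<in> carrier G" "A \<in> \<E>" for g A using \<E>_lmul that .
    show "acts G W M" by (rule acts_W)
    show "W \<noteq> {}" using w0_W by blast
  qed (use stab_bound vertex_fixes W_element_fixes in blast)+
  have "W = almost_eq E Z `` {w0}" using w0 by (auto simp: W_def df_def almost_eq_def)
  then show ?thesis using r.vertex_set by simp
qed

end

theorem theorem8p1:
  fixes G :: "('g, 'm) monoid_scheme"
    and E :: "'e set" and \<phi> :: "'g \<Rightarrow> 'e \<Rightarrow> 'e"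
    and Z :: "'z set" and \<psi> :: "'g \<Rightarrow> 'z \<Rightarrow> 'z"
    and W :: "('e \<Rightarrow> 'z) set"
  assumes "group G" and "finitely_generable G"
    and "group_action G E \<phi>" and "group_action G Z \<psi>"
    and "quasifree G E \<phi>"
    and "\<forall>e\<in>E. \<exists>z\<in>Z. stabilizes (stabilizer G \<phi> e) \<psi> z"
    and "W \<in> (E \<rightarrow>\<^sub>E Z) // almost_eq E Z"
    and "G_stable G (maps_action G E \<phi> Z \<psi>) W"
  shows "vertex_set_of_G_tree G W (\<lambda>g. restrict (maps_action G E \<phi> Z \<psi> g) W)"
proof -
  interpret group G by fact
  obtain S where S: "finite S" "S \<subseteq> carrier G" "generate G S = carrier G"
    using \<open>finitely_generable G\<close> by (auto simp: finitely_generable_def)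
  let ?M = "maps_action G E \<phi> Z \<psi>"
  obtain w0 where w0: "w0 \<in> E \<rightarrow>\<^sub>E Z" "W = almost_eq E Z `` {w0}"
    using \<open>W \<in> (E \<rightarrow>\<^sub>E Z) // almost_eq E Z\<close> by (rule quotientE)
  have aM: "acts G (E \<rightarrow>\<^sub>E Z) ?M"
    using group_action_maps[OF assms(3,4)] by (rule acts_of_group_action)
  have w0W: "w0 \<in> W" using w0 by (simp add: almost_eq_def)
  have "almost_stable G S E \<phi> Z \<psi> w0"
  proof unfold_locales
    show "acts G E \<phi>" "acts G Z \<psi>" using assms(3,4) by (auto intro: acts_of_group_action)
    show "finite (stabilizer G \<phi> e)" if "e \<in> E" for e
      using \<open>quasifree G E \<phi>\<close> that by (simp add: quasifree_def)
    show "\<exists>z\<in>Z. stabilizer G \<phi> e \<subseteq> stabilizer G \<psi> z" if "e \<in> E" for e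
      using bspec[OF assms(6) that] by (auto simp: stabilizes_def stabilizer_def)
    show "finite {e \<in> E. w0 e \<noteq> ?M g w0 e}" if g: "g \<in> carrier G" for g
    proof -
      have "?M g w0 \<in> (\<Union>g\<in>carrier G. ?M g ` W)" using g w0W by blast
      then have "?M g w0 \<in> W" using assms(8) unfolding G_stable_def by (simp only:)
      then show ?thesis using w0(2) by (simp add: almost_eq_def)
    qed
  qed (use S aM w0 in auto)
  then show ?thesis unfolding w0(2) by (rule almost_stable.vertex_set_class)
qed

end
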